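(* Let $\mathbb{G}$ be a Carnot group, let $1<p\leq\infty$, let $\Omega\subset\mathbb{G}$ be open, and let $u\in C^0(\Omega)$ be a real-valued continuous function. Then the following are equivalent: (i) $u$ is a viscosity solution of $\Delta^N_{p,\mathbb{G}}u=0$ in $\Omega$; (ii) for every $x\in\Omega$, $u(x)=\mu_p(\varepsilon,u)(x)+o(\varepsilon^2)$ as $\varepsilon\to0^+$ in the viscosity sense.
   Context: **Carnot groups.** A finite-dimensional real Lie algebra $\mathfrak g$ is stratified of step $k$ if $\mathfrak g=V_1\oplus\cdots\oplus V_k$ with $[V_1,V_i]=V_{i+1}$ for $1\le i\le k-1$ and $[V_1,V_k]=\{0\}$. A Carnot group $\mathbb{G}$ of step $k$ is a connected, simply connected Lie group whose Lie algebra is stratified of step $k$. Put $v_i=\dim V_i$, $h_0=0$, $h_i=\sum_{j=1}^i v_j$, $m=h_k$. Via the exponential map (in a basis of $\mathfrak g$ adapted to the stratification), $\mathbb{G}$ is identified with $(\mathbb{R}^m,\cdot)$, where $\cdot$ is given by the Baker–Campbell–Hausdorff formula; the identity is $0$. Write $x=(x^{(1)},\ldots,x^{(k)})$ with $x^{(j)}=(x_{h_{j-1}+1},\ldots,x_{h_j})\in\mathbb{R}^{v_j}$. **Pseudonorm and balls.** $|x|_{\mathbb{G}}=\big(\sum_{j=1}^k\|x^{(j)}\|^{2k!/j}\big)^{1/(2k!)}$, where $\|\cdot\|$ is the Euclidean norm, and $B_R(x)=\{y\in\mathbb{G}:|y^{-1}\cdot x|_{\mathbb{G}}<R\}$. The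 measure on $\mathbb{G}$ is Lebesgue measure on $\mathbb{R}^m$ (which is the Haar measure). **Horizontal derivatives.** The Jacobian basis $X_1,\ldots,X_m$ consists of the left-invariant vector fields with $X_j(0)=\partial_j$. For a $C^1$ function $u$, $\nabla_{V_1}u=\sum_{i=1}^{v_1}(X_iu)X_i$, identified with $(X_1u,\ldots,X_{v_1}u)\in\mathbb{R}^{v_1}$, and $|\nabla_{V_1}u|$ is its Euclidean norm. For a horizontal field $F=\sum_{i=1}^{v_1}F_iX_i$, $\operatorname{div}_{V_1}F=\sum_{i=1}^{v_1}X_iF_i$. The symmetrized horizontal Hessian of a $C^2$ function $u$ is $D^{2,*}_{V_1}u=\big(\tfrac12(X_iX_j+X_jX_i)u\big)_{1\le i,j\le v_1}$. **Normalized $p$-Laplacian.** At points where $\nabla_{V_1}u\neq0$, $$\Delta^N_{p,\mathbb{G}}u=\frac{\operatorname{div}_{V_1}(|\nabla_{V_1}u|^{p-2}\nabla_{V_1}u)}{|\nabla_{V_1}u|^{p-2}}\quad(1\le p<\infty),\qquad \Delta^N_{\infty,\mathbb{G}}u=\Big\langle D^{2,*}_{V_1}u\,\frac{\nabla_{V_1}u}{|\nabla_{V_1}u|},\frac{\nabla_{V_1}u}{|\nabla_{V_1}u|}\Big\rangle .$$ **Viscosity solutions.** A lower semicontinuous function $u$ on $\Omega$ is a viscosity supersolution of $\Delta^N_{p,\mathbb{G}}u=0$ in $\Omega$ if for every $x_0\in\Omega$ and every $\phi\in C^2(\Omega)$ such that $\nabla_{V_1}\phi(x_0)\ne0$ and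 $u-\phi$ has a strict minimum at $x_0$, one has $\Delta^N_{p,\mathbb{G}}\phi(x_0)\le0$. An upper semicontinuous function $u$ is a viscosity subsolution if for every $x_0\in\Omega$ and every $\phi\in C^2(\Omega)$ such that $\nabla_{V_1}\phi(x_0)\ne0$ and $u-\phi$ has a strict maximum at $x_0$, one has $\Delta^N_{p,\mathbb{G}}\phi(x_0)\ge0$. A continuous function is a viscosity solution if it is both a viscosity supersolution and a viscosity subsolution. **The number $\mu_p$.** For $u$ continuous on $\overline{B_\varepsilon(x)}$, $\mu_p(\varepsilon,u)(x)$ is the unique real number satisfying $$\|u-\mu_p(\varepsilon,u)(x)\|_{L^p(\overline{B_\varepsilon(x)})}=\min_{\lambda\in\mathbb{R}}\|u-\lambda\|_{L^p(\overline{B_\varepsilon(x)})}$$ (existence and uniqueness are known). **Asymptotic expansion in the viscosity sense.** A continuous function $u$ defined in a neighborhood of $x$ satisfies $u(x)=\mu_p(\varepsilon,u)(x)+o(\varepsilon^2)$ as $\varepsilon\to0^+$ in the viscosity sense if: (a) for every $C^2$ function $\phi$ defined in a neighborhood of $x$ such that $u-\phi$ has a strict minimum at $x$ (in that neighborhood), $u(x)=\phi(x)$ and $\nabla_{V_1}\phi(x)\neq0$, one has $\phi(x)\ge\mu_p(\varepsilon,\phi)(x)+o(\varepsilon^2)$, i.e. $\liminf_{\varepsilon\to0^+}\frac{\phi(x)-\mu_p(\varepsilon,\phi)(x)}{\varepsilon^2}\ge0$; (b) for every $C^2$ function $\phi$ defined in a neighborhood of $x$ such that $u-\phi$ has a strict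 maximum at $x$ (in that neighborhood), $u(x)=\phi(x)$ and $\nabla_{V_1}\phi(x)\ne0$, one has $\phi(x)\le\mu_p(\varepsilon,\phi)(x)+o(\varepsilon^2)$, i.e. $\limsup_{\varepsilon\to0^+}\frac{\phi(x)-\mu_p(\varepsilon,\phi)(x)}{\varepsilon^2}\le0$. *)

theory Defs
  imports "HOL-Analysis.Analysis" "HOL-Probability.Essential_Supremum"
begin

section \<open>Carnot groups in exponential coordinates\<close>

text \<open>
  A Lie algebra of dimension $m$ with a basis adapted to the stratification is represented as
  \<^typ>\<open>real ^ 'n\<close> with a bracket \<open>br\<close>; the function \<open>deg\<close> records to which layer each
  basis vector belongs, so that the coordinates of $x^{(j)}$ are those with index of degree \<open>j\<close>.
  (The index type carries no order; the ordering of coordinates by layers is immaterial.)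
\<close>

definition layer :: "('n::finite \<Rightarrow> nat) \<Rightarrow> nat \<Rightarrow> (real ^ 'n) set" where
  "layer deg j = {x. \<forall>i. x $ i \<noteq> 0 \<longrightarrow> deg i = j}"

definition layer_proj :: "('n::finite \<Rightarrow> nat) \<Rightarrow> nat \<Rightarrow> real ^ 'n \<Rightarrow> real ^ 'n" where
  "layer_proj deg j x = (\<chi> i. if deg i = j then x $ i else 0)"

locale stratified_lie_algebra =
  fixes k :: nat
    and deg :: "'n::finite \<Rightarrow> nat"
    and br :: "real ^ 'n \<Rightarrow> real ^ 'n \<Rightarrow> real ^ 'n"
  assumes bilinear_br: "bilinear br"
    and br_self: "\<And>x. br x x = 0"
    and jacobi: "\<And>x y z. br x (br y z) + br y (br z x) + br z (br x y) = 0"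
    and deg_range: "\<And>i. deg i \<in> {1..k}"
    and br_layer: "\<And>j. 1 \<le> j \<Longrightarrow> j < k \<Longrightarrow>
      span {br x y | x y. x \<in> layer deg 1 \<and> y \<in> layer deg j} = layer deg (Suc j)"
    and br_top: "\<And>x y. x \<in> layer deg 1 \<Longrightarrow> y \<in> layer deg k \<Longrightarrow> br x y = 0"

fun iter_br :: "('a::zero \<Rightarrow> 'a \<Rightarrow> 'a) \<Rightarrow> 'a list \<Rightarrow> 'a" where
  "iter_br br [] = 0"
| "iter_br br [x] = x"
| "iter_br br (x # y # zs) = br x (iter_br br (y # zs))"

text \<open>
  The Baker--Campbell--Hausdorff product, in Dynkin's form:
  $$\sum_{n\ge1}\frac{(-1)^{n+1}}{n}\sum_{r_i+s_i>0}
    \frac{[x^{r_1}y^{s_1}\cdots x^{r_n}y^{s_n}]}{\sum_i(r_i+s_i)\,\prod_i r_i!\,s_i!}$$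
  with right-nested brackets. In a Lie algebra that is nilpotent of step \<open>k\<close>, brackets of more
  than \<open>k\<close> factors vanish, so only the (finitely many) terms with $\sum_i(r_i+s_i)\le k$ are kept.
\<close>

definition bch_exponents :: "nat \<Rightarrow> (nat \<times> nat) list set" where
  "bch_exponents k = {rs. rs \<noteq> [] \<and> (\<forall>(r, s) \<in> set rs. 0 < r + s) \<and> (\<Sum>(r, s)\<leftarrow>rs. r + s) \<le> k}"

definition bch :: "nat \<Rightarrow> ('a::real_vector \<Rightarrow> 'a \<Rightarrow> 'a) \<Rightarrow> 'a \<Rightarrow> 'a \<Rightarrow> 'a" where
  "bch k br x y = (\<Sum>rs \<in> bch_exponents k.
     ((-1) ^ (length rs + 1) /
       (real (length rs) * real (\<Sum>(r, s)\<leftarrow>rs. r + s) * (\<Prod>(r, s)\<leftarrow>rs. fact r * fact s))) *\<^sub>R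
     iter_br br (concat (map (\<lambda>(r, s). replicate r x @ replicate s y) rs)))"

text \<open>
  The group of a stratified Lie algebra in exponential coordinates: a group structure on
  \<^typ>\<open>real ^ 'n\<close> whose product is given by the Baker--Campbell--Hausdorff formula.
  The identity is \<open>0\<close> and the inverse of \<open>x\<close> is \<open>- x\<close>. The group axioms belong to the notion of
  a Lie group; they exclude no stratified Lie algebra, because the Baker--Campbell--Hausdorff
  product of a nilpotent Lie algebra is always a group law.
\<close>

locale carnot_group =
  stratified_lie_algebra k deg br + group mul "0 :: real ^ 'n" uminus
  for k :: nat
    and deg :: "'n::finite \<Rightarrow> nat"
    and br :: "real ^ 'n \<Rightarrow> real ^ 'n \<Rightarrow> real ^ 'n"
    and mul :: "real ^ 'n \<Rightarrow> real ^ 'n \<Rightarrow> real ^ 'n" +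
  assumes mul_eq_bch: "\<And>x y. mul x y = bch k br x y"

text \<open>The exponents $2k!/j$ are natural numbers, so the division on \<^typ>\<open>nat\<close> is exact.\<close>

definition gnorm :: "nat \<Rightarrow> ('n::finite \<Rightarrow> nat) \<Rightarrow> real ^ 'n \<Rightarrow> real" where
  "gnorm k deg x = root (2 * fact k) (\<Sum>j = 1..k. norm (layer_proj deg j x) ^ (2 * fact k div j))"

definition gball ::
  "nat \<Rightarrow> ('n::finite \<Rightarrow> nat) \<Rightarrow> (real ^ 'n \<Rightarrow> real ^ 'n \<Rightarrow> real ^ 'n) \<Rightarrow> real ^ 'n \<Rightarrow> real \<Rightarrow> (real ^ 'n) set"
  where "gball k deg mul x R = {y. gnorm k deg (mul (- y) x) < R}"


section \<open>Horizontal derivatives\<close>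

text \<open>
  The left-invariant field $X_j$ with $X_j(0)=\partial_j$ is $X_j(x)=d(L_x)_0(\partial_j)$, where
  $L_x$ is left translation by $x$.
\<close>

definition jac_field :: "(real ^ 'n \<Rightarrow> real ^ 'n \<Rightarrow> real ^ 'n) \<Rightarrow> 'n::finite \<Rightarrow> real ^ 'n \<Rightarrow> real ^ 'n" where
  "jac_field mul j x = frechet_derivative (\<lambda>y. mul x y) (at 0) (axis j 1)"

definition jac_deriv ::
  "(real ^ 'n \<Rightarrow> real ^ 'n \<Rightarrow> real ^ 'n) \<Rightarrow> 'n::finite \<Rightarrow> (real ^ 'n \<Rightarrow> real) \<Rightarrow> real ^ 'n \<Rightarrow> real" where
  "jac_deriv mul j u x = frechet_derivative u (at x) (jac_field mul j x)"

text \<open>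
  Horizontal vectors are given by their components with respect to the Jacobian basis; the
  components of degree other than \<open>1\<close> are zero, so norms and inner products are those of
  $\mathbb{R}^{v_1}$.
\<close>

definition hgrad ::
  "('n::finite \<Rightarrow> nat) \<Rightarrow> (real ^ 'n \<Rightarrow> real ^ 'n \<Rightarrow> real ^ 'n) \<Rightarrow> (real ^ 'n \<Rightarrow> real) \<Rightarrow> real ^ 'n \<Rightarrow> real ^ 'n"
  where "hgrad deg mul u x = (\<chi> i. if deg i = 1 then jac_deriv mul i u x else 0)"

definition hdiv ::
  "('n::finite \<Rightarrow> nat) \<Rightarrow> (real ^ 'n \<Rightarrow> real ^ 'n \<Rightarrow> real ^ 'n) \<Rightarrow> (real ^ 'n \<Rightarrow> real ^ 'n) \<Rightarrow> real ^ 'n \<Rightarrow> real"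
  where "hdiv deg mul F x = (\<Sum>i | deg i = 1. jac_deriv mul i (\<lambda>y. F y $ i) x)"

definition hhess ::
  "('n::finite \<Rightarrow> nat) \<Rightarrow> (real ^ 'n \<Rightarrow> real ^ 'n \<Rightarrow> real ^ 'n) \<Rightarrow> (real ^ 'n \<Rightarrow> real) \<Rightarrow> real ^ 'n \<Rightarrow> real ^ 'n ^ 'n"
  where "hhess deg mul u x = (\<chi> i j. if deg i = 1 \<and> deg j = 1
    then (jac_deriv mul i (jac_deriv mul j u) x + jac_deriv mul j (jac_deriv mul i u) x) / 2
    else 0)"

definition normalized_plap ::
  "('n::finite \<Rightarrow> nat) \<Rightarrow> (real ^ 'n \<Rightarrow> real ^ 'n \<Rightarrow> real ^ 'n) \<Rightarrow> ereal \<Rightarrow> (real ^ 'n \<Rightarrow> real) \<Rightarrow> real ^ 'n \<Rightarrow> real"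
  where "normalized_plap deg mul p u x =
    (if p = \<infinity> then
       (let \<nu> = hgrad deg mul u x /\<^sub>R norm (hgrad deg mul u x) in (hhess deg mul u x *v \<nu>) \<bullet> \<nu>)
     else
       hdiv deg mul
         (\<lambda>y. (norm (hgrad deg mul u y) powr (real_of_ereal p - 2)) *\<^sub>R hgrad deg mul u y) x
         / norm (hgrad deg mul u x) powr (real_of_ereal p - 2))"


section \<open>Viscosity solutions\<close>

definition C2_on :: "('a::real_normed_vector) set \<Rightarrow> ('a \<Rightarrow> real) \<Rightarrow> bool" where
  "C2_on U f \<longleftrightarrow> (\<exists>(f' :: 'a \<Rightarrow> 'a \<Rightarrow>\<^sub>L real) (f'' :: 'a \<Rightarrow> 'a \<Rightarrow>\<^sub>L 'a \<Rightarrow>\<^sub>L real).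
     (\<forall>x\<in>U. (f has_derivative blinfun_apply (f' x)) (at x)) \<and>
     (\<forall>x\<in>U. (f' has_derivative blinfun_apply (f'' x)) (at x)) \<and>
     continuous_on U f'')"

definition lsc_on :: "('a::topological_space) set \<Rightarrow> ('a \<Rightarrow> real) \<Rightarrow> bool" where
  "lsc_on U u \<longleftrightarrow> (\<forall>x\<in>U. \<forall>a < u x. \<forall>\<^sub>F y in at x within U. a < u y)"

definition usc_on :: "('a::topological_space) set \<Rightarrow> ('a \<Rightarrow> real) \<Rightarrow> bool" where
  "usc_on U u \<longleftrightarrow> (\<forall>x\<in>U. \<forall>a > u x. \<forall>\<^sub>F y in at x within U. u y < a)"

definition strict_min_at :: "'a set \<Rightarrow> ('a \<Rightarrow> real) \<Rightarrow> 'a \<Rightarrow> bool" where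
  "strict_min_at U f x \<longleftrightarrow> x \<in> U \<and> (\<forall>y \<in> U - {x}. f x < f y)"

definition strict_max_at :: "'a set \<Rightarrow> ('a \<Rightarrow> real) \<Rightarrow> 'a \<Rightarrow> bool" where
  "strict_max_at U f x \<longleftrightarrow> x \<in> U \<and> (\<forall>y \<in> U - {x}. f y < f x)"

definition viscosity_supersolution ::
  "('n::finite \<Rightarrow> nat) \<Rightarrow> (real ^ 'n \<Rightarrow> real ^ 'n \<Rightarrow> real ^ 'n) \<Rightarrow> ereal \<Rightarrow> (real ^ 'n) set \<Rightarrow> (real ^ 'n \<Rightarrow> real) \<Rightarrow> bool"
  where "viscosity_supersolution deg mul p \<Omega> u \<longleftrightarrow> lsc_on \<Omega> u \<and>
    (\<forall>x0\<in>\<Omega>. \<forall>\<phi>. C2_on \<Omega> \<phi> \<and> hgrad deg mul \<phi> x0 \<noteq> 0 \<and> strict_min_at \<Omega> (\<lambda>y. u y - \<phi> y) x0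
      \<longrightarrow> normalized_plap deg mul p \<phi> x0 \<le> 0)"

definition viscosity_subsolution ::
  "('n::finite \<Rightarrow> nat) \<Rightarrow> (real ^ 'n \<Rightarrow> real ^ 'n \<Rightarrow> real ^ 'n) \<Rightarrow> ereal \<Rightarrow> (real ^ 'n) set \<Rightarrow> (real ^ 'n \<Rightarrow> real) \<Rightarrow> bool"
  where "viscosity_subsolution deg mul p \<Omega> u \<longleftrightarrow> usc_on \<Omega> u \<and>
    (\<forall>x0\<in>\<Omega>. \<forall>\<phi>. C2_on \<Omega> \<phi> \<and> hgrad deg mul \<phi> x0 \<noteq> 0 \<and> strict_max_at \<Omega> (\<lambda>y. u y - \<phi> y) x0
      \<longrightarrow> normalized_plap deg mul p \<phi> x0 \<ge> 0)"

definition viscosity_solution ::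
  "('n::finite \<Rightarrow> nat) \<Rightarrow> (real ^ 'n \<Rightarrow> real ^ 'n \<Rightarrow> real ^ 'n) \<Rightarrow> ereal \<Rightarrow> (real ^ 'n) set \<Rightarrow> (real ^ 'n \<Rightarrow> real) \<Rightarrow> bool"
  where "viscosity_solution deg mul p \<Omega> u \<longleftrightarrow> continuous_on \<Omega> u \<and>
    viscosity_supersolution deg mul p \<Omega> u \<and> viscosity_subsolution deg mul p \<Omega> u"


section \<open>The generalized mean and the asymptotic expansion\<close>

definition Lp_norm :: "ereal \<Rightarrow> ('a::euclidean_space) set \<Rightarrow> ('a \<Rightarrow> real) \<Rightarrow> real" where
  "Lp_norm p S f =
    (if p = \<infinity> then real_of_ereal (esssup (lebesgue_on S) (\<lambda>y. ereal \<bar>f y\<bar>))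
     else (LINT y|lebesgue_on S. \<bar>f y\<bar> powr real_of_ereal p) powr (1 / real_of_ereal p))"

definition mu_p ::
  "nat \<Rightarrow> ('n::finite \<Rightarrow> nat) \<Rightarrow> (real ^ 'n \<Rightarrow> real ^ 'n \<Rightarrow> real ^ 'n) \<Rightarrow> ereal \<Rightarrow> real \<Rightarrow> (real ^ 'n \<Rightarrow> real) \<Rightarrow> real ^ 'n \<Rightarrow> real"
  where "mu_p k deg mul p \<epsilon> u x =
    (THE \<mu>. \<forall>c. Lp_norm p (closure (gball k deg mul x \<epsilon>)) (\<lambda>y. u y - \<mu>)
                 \<le> Lp_norm p (closure (gball k deg mul x \<epsilon>)) (\<lambda>y. u y - c))"

text \<open>
  In the next definition \<open>\<Omega>\<close> is the domain of \<open>u\<close> and \<open>N\<close> ranges over the open neighbourhoods of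
  \<open>x\<close> in it on which a test function is defined. Only small \<open>\<epsilon>\<close> matter, for which the closed ball
  lies in \<open>N\<close>, so the values of the (total) function \<open>\<phi>\<close> outside \<open>N\<close> play no role.
\<close>

definition asymptotic_mean_viscosity ::
  "nat \<Rightarrow> ('n::finite \<Rightarrow> nat) \<Rightarrow> (real ^ 'n \<Rightarrow> real ^ 'n \<Rightarrow> real ^ 'n) \<Rightarrow> ereal \<Rightarrow> (real ^ 'n) set \<Rightarrow> (real ^ 'n \<Rightarrow> real) \<Rightarrow> real ^ 'n \<Rightarrow> bool"
  where "asymptotic_mean_viscosity k deg mul p \<Omega> u x \<longleftrightarrow>
    (\<forall>N \<phi>. open N \<and> x \<in> N \<and> N \<subseteq> \<Omega> \<and> C2_on N \<phi> \<and> strict_min_at N (\<lambda>y. u y - \<phi> y) x \<and>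
        u x = \<phi> x \<and> hgrad deg mul \<phi> x \<noteq> 0
      \<longrightarrow> Liminf (at_right 0) (\<lambda>\<epsilon>. ereal ((\<phi> x - mu_p k deg mul p \<epsilon> \<phi> x) / \<epsilon>\<^sup>2)) \<ge> 0) \<and>
    (\<forall>N \<phi>. open N \<and> x \<in> N \<and> N \<subseteq> \<Omega> \<and> C2_on N \<phi> \<and> strict_max_at N (\<lambda>y. u y - \<phi> y) x \<and>
        u x = \<phi> x \<and> hgrad deg mul \<phi> x \<noteq> 0
      \<longrightarrow> Limsup (at_right 0) (\<lambda>\<epsilon>. ereal ((\<phi> x - mu_p k deg mul p \<epsilon> \<phi> x) / \<epsilon>\<^sup>2)) \<le> 0)"

end

theory Submission
  imports Defs
begin

text \<open>
  Both properties reduce to one expansion: if \<open>\<phi>\<close> is \<open>C\<^sup>2\<close> near \<open>x\<close> and its horizontal gradient \<open>\<xi>\<close>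
  does not vanish at \<open>x\<close>, then the best constant on the ball of radius \<open>\<epsilon>\<close> is
  \<open>\<phi>(x) + \<kappa> \<epsilon>\<^sup>2 \<Delta>\<phi>(x) + o(\<epsilon>\<^sup>2)\<close> for a constant \<open>\<kappa> > 0\<close>. After left translation and dilation,
  \<open>\<phi>\<close> becomes \<open>\<phi>(x) + \<epsilon> \<langle>\<xi>, z\<rangle> + \<epsilon>\<^sup>2 q(z) + o(\<epsilon>\<^sup>2)\<close> uniformly on the closed unit ball, where \<open>q\<close> is
  half the horizontal Hessian plus a linear form in the second layer.
  For finite \<open>p\<close> the best constant is the zero of \<open>c \<mapsto> \<integral> \<bar>f - c\<bar>\<^sup>p\<^sup>-\<^sup>2 (f - c)\<close>; its second-order coefficient is
  the mean of \<open>q\<close> with weight \<open>\<bar>\<langle>\<xi>, z\<rangle>\<bar>\<^sup>p\<^sup>-\<^sup>2\<close>, which is integrable because \<open>p > 1\<close>. Invariance of the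
  ball under reflections in vectors of a layer kills the linear form and fixes the ratio \<open>p - 1\<close> between
  the weighted second moments along \<open>\<xi>\<close> and across it, which is where the normalized \<open>p\<close>-Laplacian comes
  from. For \<open>p = \<infinity>\<close> the best constant is the midrange, and the extrema concentrate at \<open>\<plusminus> \<xi> / \<bar>\<xi>\<bar>\<close>.
  A test function given only near \<open>x\<close> is glued to minus a \<open>C\<^sup>2\<close> majorant on \<open>\<Omega>\<close>.
\<close>

section \<open>Change of variables over an unordered index type\<close>

text \<open>The singularity of the weight for 1 < p < 2 shapes the analysis: \<open>spow p\<close>
  is then not Lipschitz at 0, so the integral condition on the best constant is not differentiated
  in the constant. Its sign at two trial constants, off by multiples of \<epsilon> squared, brackets
  the minimizer, and this sign comes from one limit of difference quotients whose majorant is built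
  from the weight itself. Because only signs enter, the Jacobian of the ball parametrization is
  never computed. No explicit moment of the pseudonorm ball is used either: every moment that
  matters comes from reflections, which are linear involutions and hence preserve volume. On the
  group side a bracket raises the degree. Left translations are therefore unitriangular with respect
  to the degree and preserve volume. A dilated coordinate of degree j has size \<epsilon> to the j,
  so layers beyond the second drop out at order \<epsilon> squared. The two notions of viscosity
  differ in their test functions, global on \<open>\<Omega>\<close> on one side, local with matching
  value on the other; gluing and the addition of a constant pass between them.\<close>

typedef ('n::finite) idx = "{..<CARD('n)}"
  by (auto intro!: exI[of _ 0])

instance idx :: (finite) finite
proof
  have "(UNIV :: 'a idx set) = Abs_idx ` {..<CARD('a)}"
    using type_definition.Abs_image[OF type_definition_idx] by auto
  then show "finite (UNIV :: 'a idx set)" by (rule ssubst) simp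
qed

instantiation idx :: (finite) wellorder
begin
definition less_eq_idx where "x \<le> y \<longleftrightarrow> Rep_idx x \<le> Rep_idx y"
definition less_idx where "x < y \<longleftrightarrow> Rep_idx x < Rep_idx y"
instance
proof
  fix P :: "'a idx \<Rightarrow> bool" and a
  assume "\<And>x. (\<And>y. y < x \<Longrightarrow> P y) \<Longrightarrow> P x"
  then have "Rep_idx a = n \<longrightarrow> P a" for n
    by (induction n arbitrary: a rule: less_induct) (metis less_idx_def)
  then show "P a" by blast
qed (auto simp: less_eq_idx_def less_idx_def Rep_idx_inject)
end

lemma CARD_idx: "CARD(('n::finite) idx) = CARD('n)"
  using type_definition.card[OF type_definition_idx] by auto

lemma ex_bij_idx: "\<exists>c :: 'n::finite idx \<Rightarrow> 'n. bij c"
  using finite_same_card_bij[of "UNIV :: 'n idx set" "UNIV :: 'n set"] by (auto simp: CARD_idx)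


text \<open>A push-forward identity composes freely, also between different types, and
  \<open>integral_distr\<close> turns it into a substitution rule.\<close>

definition preserves_lborel :: "('a::euclidean_space \<Rightarrow> 'b::euclidean_space) \<Rightarrow> bool" where
  "preserves_lborel f \<longleftrightarrow> f \<in> borel_measurable borel \<and> distr lborel borel f = lborel"

lemma preserves_lborel_comp:
  assumes "preserves_lborel f" "preserves_lborel g"
  shows "preserves_lborel (g \<circ> f)"
proof -
  have [measurable]: "f \<in> borel_measurable borel" "g \<in> borel_measurable borel"
    using assms by (auto simp: preserves_lborel_def)
  have "distr lborel borel (g \<circ> f) = distr (distr lborel borel f) borel g"
    by (subst distr_distr) auto
  then show ?thesis using assms by (auto simp: preserves_lborel_def)
qed

text \<open>The preimage of a box under \<open>f\<close> is its image under the inverse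
  \<open>g\<close>, whose volume the theorem on differentiable images gives from the determinant of
  \<open>g'\<close>; boxes determine \<open>lborel\<close>. Hence the derivative of the inverse is
  the one that enters.\<close>

lemma preserves_lborel_diffeo:
  fixes f g :: "real^'n::{finite,wellorder} \<Rightarrow> real^'n::_"
  assumes fg: "\<And>x. f (g x) = x" and gf: "\<And>x. g (f x) = x"
    and f: "continuous_on UNIV f"
    and g': "\<And>x. (g has_derivative g' x) (at x)"
    and det: "\<And>x. \<bar>det (matrix (g' x))\<bar> = 1"
  shows "preserves_lborel f"
proof -
  have fm[measurable]: "f \<in> borel_measurable borel"
    using f by (rule borel_measurable_continuous_onI)
  have "lborel = distr lborel borel f"
  proof (rule lborel_eqI)
    fix l u :: "real^'n::_" assume le: "\<And>b. b \<in> Basis \<Longrightarrow> l \<bullet> b \<le> u \<bullet> b"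
    have vim: "f -` box l u = g ` box l u" 
      using fg gf by (auto simp: image_iff) metis
    have "g ` box l u \<in> lmeasurable \<and> measure lebesgue (g ` box l u) = measure lebesgue (box l u)"
    proof (subst has_measure_differentiable_image[where f' = g'])
      show "inj_on g (box l u)" by (metis fg inj_on_inverseI)
      show "((\<lambda>x. \<bar>det (matrix (g' x))\<bar>) has_integral measure lebesgue (box l u)) (box l u)"
        unfolding det by (metis integrable_integral lmeasurable_box lmeasurable_iff_integrable_on lmeasure_integral)
    qed (auto intro: has_derivative_at_withinI g')
    then have "emeasure lebesgue (g ` box l u) = emeasure lebesgue (box l u)"
      by (simp add: emeasure_eq_measure2 fmeasurableD2)
    moreover have "g ` box l u \<in> sets borel"
      unfolding vim[symmetric] using measurable_sets[OF fm, of "box l u"] by simp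
    ultimately have "emeasure lborel (g ` box l u) = emeasure lborel (box l u)" by simp
    then show "emeasure (distr lborel borel f) (box l u) = (\<Prod>b\<in>Basis. (u - l) \<bullet> b)"
      using le by (simp add: emeasure_distr vim emeasure_lborel_box)
  qed simp
  then show ?thesis by (simp add: preserves_lborel_def)
qed

definition reindex :: "('m::finite \<Rightarrow> 'n::finite) \<Rightarrow> real^'n \<Rightarrow> real^'m" where
  "reindex c x = (\<chi> i. x $ c i)"

lemma linear_reindex: "linear (reindex c)"
  by (auto intro!: linearI simp: reindex_def vec_eq_iff)

lemma reindex_inv: "bij c \<Longrightarrow> reindex c (reindex (inv c) x) = x" "bij c \<Longrightarrow> reindex (inv c) (reindex c y) = y"
  by (auto simp: reindex_def vec_eq_iff bij_is_inj bij_is_surj surj_f_inv_f)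

lemma emeasure_lborel_box_vec:
  fixes l u :: "real^'n::finite"
  assumes "\<And>i. l $ i \<le> u $ i"
  shows "emeasure lborel (box l u) = (\<Prod>i\<in>UNIV. u $ i - l $ i)"
proof -
  have "(\<Prod>b\<in>Basis. (u - l) \<bullet> b) = (\<Prod>i\<in>UNIV. u $ i - l $ i)"
  proof (rule prod.reindex_bij_witness[where i = "\<lambda>i. axis i 1" and j = "\<lambda>b. THE i. b = axis i 1"])
  qed (auto simp: Basis_vec_def axis_eq_axis inner_axis)
  then show ?thesis using assms
    by (subst emeasure_lborel_box) (auto simp: Basis_vec_def inner_axis)
qed

text \<open>Permuting coordinates maps boxes to boxes and permutes the factors of their volume, so
  no determinant is involved, and source and target may have different index types.\<close>

lemma preserves_lborel_reindex:
  fixes c :: "'m::finite \<Rightarrow> 'n::finite"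
  assumes c: "bij c"
  shows "preserves_lborel (reindex c)"
proof -
  have cont: "continuous_on UNIV (reindex c)"
    by (simp add: linear_continuous_on linear_linear linear_reindex)
  have fm[measurable]: "reindex c \<in> borel_measurable borel"
    using cont by (rule borel_measurable_continuous_onI)
  have "lborel = distr lborel borel (reindex c)"
  proof (rule lborel_eqI)
    fix l u :: "real^'m" assume "\<And>b. b \<in> Basis \<Longrightarrow> l \<bullet> b \<le> u \<bullet> b"
    then have le: "l $ i \<le> u $ i" for i
      by (metis axis_in_Basis_iff cart_eq_inner_axis one_neq_zero Basis_real_def singletonI)
    have "reindex c -` box l u = box (reindex (inv c) l) (reindex (inv c) u)"
    proof -
      have "(\<forall>i. l $ i < x $ c i \<and> x $ c i < u $ i) = (\<forall>j. l $ inv c j < x $ j \<and> x $ j < u $ inv c j)" for x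
        using c by (metis bij_inv_eq_iff)
      then show ?thesis by (auto simp: reindex_def mem_box_cart)
    qed
    then have "emeasure (distr lborel borel (reindex c)) (box l u) = (\<Prod>i\<in>UNIV. u $ inv c i - l $ inv c i)"
      using le by (simp add: emeasure_distr emeasure_lborel_box_vec reindex_def)
    also have "(\<Prod>i\<in>UNIV. u $ inv c i - l $ inv c i) = (\<Prod>i\<in>UNIV. u $ i - l $ i)"
      by (rule prod.reindex_bij_betw) (use c in \<open>simp add: bij_imp_bij_inv\<close>)
    also have "ennreal \<dots> = emeasure lborel (box l u)" using le by (simp add: emeasure_lborel_box_vec)
    also have "\<dots> = (\<Prod>b\<in>Basis. (u - l) \<bullet> b)"
      using le by (subst emeasure_lborel_box) (auto simp: Basis_vec_def inner_axis)
    finally show "emeasure (distr lborel borel (reindex c)) (box l u) = (\<Prod>b\<in>Basis. (u - l) \<bullet> b)" .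
  qed simp
  then show ?thesis by (simp add: preserves_lborel_def)
qed

text \<open>\<open>B t\<close> is \<open>A\<close> conjugated by the diagonal matrix with entries t
  to the \<open>d i\<close>. Conjugation keeps the determinant, while every off-diagonal entry that
  may be nonzero acquires a positive power of t; as t tends to 0 from the right, \<open>B t\<close>
  tends to the identity. The grading thus replaces a linear order of the indices.\<close>

lemma det_unitriangular_by_grading:
  fixes A :: "real^'n^'n" and d :: "'n \<Rightarrow> nat"
  assumes A: "\<And>i j. \<not> d j < d i \<Longrightarrow> A $ i $ j = (if i = j then 1 else 0)"
  shows "det A = 1"
proof -
  define B where "B t = (\<chi> i j. A $ i $ j * (t ^ d i / t ^ d j))" for t :: real
  have detB: "det (B t) = det A" if "t > 0" for t
    unfolding det_def
  proof (rule sum.cong)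
    fix p assume "p \<in> {p. p permutes (UNIV :: 'n set)}"
    then have "(\<Prod>i\<in>UNIV. t ^ d (p i)) = (\<Prod>i\<in>UNIV. t ^ d i)"
      using prod.permute[of p UNIV "\<lambda>i. t ^ d i"] by (simp add: o_def)
    moreover have "(\<Prod>i\<in>UNIV. t ^ d i) \<noteq> 0" using that by simp
    ultimately show "of_int (sign p) * (\<Prod>i\<in>UNIV. B t $ i $ p i) = of_int (sign p) * (\<Prod>i\<in>UNIV. A $ i $ p i)"
      by (simp add: B_def prod.distrib prod_dividef)
  qed simp
  have "((\<lambda>t. B t $ i $ j) \<longlongrightarrow> mat 1 $ i $ j) (at_right 0)" for i j
  proof (cases "d j < d i")
    case True
    then have "i \<noteq> j" by auto
    have "((\<lambda>t::real. t ^ (d i - d j)) \<longlongrightarrow> 0 ^ (d i - d j)) (at_right 0)"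
      by (intro tendsto_intros)
    then have "((\<lambda>t::real. A $ i $ j * t ^ (d i - d j)) \<longlongrightarrow> A $ i $ j * 0) (at_right 0)"
      using True by (intro tendsto_intros) (auto simp: power_0_left)
    moreover have "\<forall>\<^sub>F t::real in at_right 0. A $ i $ j * t ^ (d i - d j) = B t $ i $ j"
      unfolding eventually_at_right_field using True
      by (intro exI[of _ 1]) (auto simp: B_def power_diff)
    ultimately show ?thesis using \<open>i \<noteq> j\<close> by (simp add: mat_def filterlim_cong tendsto_cong)
  next
    case False
    have "\<forall>\<^sub>F t::real in at_right 0. mat 1 $ i $ j = B t $ i $ j"
      unfolding eventually_at_right_field using A[OF False]
      by (intro exI[of _ 1]) (auto simp: B_def mat_def)
    then show ?thesis by (rule tendsto_eventually[OF eventually_mono]) simp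
  qed
  note lim = this
  have "((\<lambda>t. det (B t)) \<longlongrightarrow> det (mat 1 :: real^'n^'n)) (at_right 0)"
    unfolding det_def by (intro tendsto_sum tendsto_mult tendsto_prod tendsto_const lim)
  moreover have "((\<lambda>t. det (B t)) \<longlongrightarrow> det A) (at_right 0)"
    by (rule tendsto_eventually) (auto simp: eventually_at_right_field detB intro!: exI[of _ 1])
  ultimately show ?thesis by (auto dest: tendsto_unique[rotated])
qed

text \<open>The change-of-variables theorem of the library requires a well-ordered index type;
  the results are transported along a reindexing of the coordinates.\<close>

lemma preserves_lborel_transport:
  fixes f :: "real^'n::finite \<Rightarrow> real^'n" and c :: "'m::finite \<Rightarrow> 'n"
  assumes c: "bij c" and F: "preserves_lborel (reindex c \<circ> f \<circ> reindex (inv c))"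
  shows "preserves_lborel f"
proof -
  have "f = reindex (inv c) \<circ> (reindex c \<circ> f \<circ> reindex (inv c)) \<circ> reindex c"
    using c by (simp add: fun_eq_iff reindex_inv)
  then show ?thesis
    using preserves_lborel_comp preserves_lborel_reindex c F bij_imp_bij_inv by metis
qed

lemma preserves_lborel_unitriangular:
  fixes f g :: "real^'n::finite \<Rightarrow> real^'n" and d :: "'n \<Rightarrow> nat"
  assumes fg: "\<And>x. f (g x) = x" and gf: "\<And>x. g (f x) = x"
    and f: "continuous_on UNIV f"
    and g': "\<And>x. (g has_derivative g' x) (at x)"
    and tri: "\<And>x i j. \<not> d j < d i \<Longrightarrow> g' x (axis j 1) $ i = (if i = j then 1 else 0)"
  shows "preserves_lborel f"
proof -
  obtain c :: "'n idx \<Rightarrow> 'n" where c: "bij c" using ex_bij_idx by blast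
  have bl: "bounded_linear (reindex c)" "bounded_linear (reindex (inv c))"
    by (auto simp: linear_linear linear_reindex)
  have ax: "reindex (inv c) (axis j 1) = axis (c j) 1" for j
    by (simp add: reindex_def vec_eq_iff axis_def) (metis c bij_inv_eq_iff)
  have inj: "c i = c j \<longleftrightarrow> i = j" for i j
    using c by (auto simp: bij_def inj_eq)
  show ?thesis
  proof (rule preserves_lborel_transport[OF c],
      rule preserves_lborel_diffeo[where g = "reindex c \<circ> g \<circ> reindex (inv c)" 
        and g' = "\<lambda>x. reindex c \<circ> g' (reindex (inv c) x) \<circ> reindex (inv c)"])
    show "continuous_on UNIV (reindex c \<circ> f \<circ> reindex (inv c))"
      by (intro continuous_on_compose linear_continuous_on bl continuous_on_subset[OF f]) auto
    fix x
    show "(reindex c \<circ> g \<circ> reindex (inv c) has_derivative reindex c \<circ> g' (reindex (inv c) x) \<circ> reindex (inv c)) (at x)"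
      by (intro diff_chain_at has_derivative_bounded_linear bl g' bounded_linear_imp_has_derivative)
    show "\<bar>det (matrix (reindex c \<circ> g' (reindex (inv c) x) \<circ> reindex (inv c)))\<bar> = 1"
      by (subst det_unitriangular_by_grading[where d = "d \<circ> c"])
        (auto simp: matrix_def ax inj tri reindex_def[of c])
  qed (use c fg gf in \<open>auto simp: reindex_inv\<close>)
qed

text \<open>The determinant of an involution squares to 1; reflections thereby preserve volume
  without their determinant being computed.\<close>

lemma preserves_lborel_involution:
  fixes f :: "real^'n::finite \<Rightarrow> real^'n"
  assumes f: "linear f" and ff: "\<And>x. f (f x) = x"
  shows "preserves_lborel f"
proof -
  obtain c :: "'n idx \<Rightarrow> 'n" where c: "bij c" using ex_bij_idx by blast
  define h where "h = reindex c \<circ> f \<circ> reindex (inv c)"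
  have lin: "linear h" unfolding h_def
    by (intro linear_compose linear_reindex f)
  have hh: "h \<circ> h = id" using c ff by (simp add: h_def fun_eq_iff reindex_inv)
  have "det (matrix h) * det (matrix h) = 1"
    using matrix_compose[OF lin lin] hh by (metis det_mul det_I matrix_id_mat_1 id_def)
  then have "\<bar>det (matrix h)\<bar> = 1"
    by (auto simp: square_eq_1_iff)
  then have "preserves_lborel h"
    using lin hh
    by (intro preserves_lborel_diffeo[where g = h and g' = "\<lambda>_. h"])
      (auto simp: linear_linear linear_continuous_on fun_eq_iff bounded_linear_imp_has_derivative)
  then show ?thesis unfolding h_def using c by (rule preserves_lborel_transport[rotated])
qed

lemma preserves_lborel_integral:
  assumes "preserves_lborel f" and "g \<in> borel_measurable borel"
  shows "(LINT x|lborel. g (f x)) = (LINT x|lborel. (g x :: real))"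
  using assms integral_distr[of f lborel borel g] by (auto simp: preserves_lborel_def)

section \<open>The best constant in the L-p norm\<close>

text \<open>Up to the factor p this is the derivative of \<open>\<bar>t\<bar> powr p\<close>, so the
  best constant c is characterized by a vanishing integral of \<open>spow p (f y - c)\<close>. The
  function is odd, which is what reflections exploit.\<close>

definition spow :: "real \<Rightarrow> real \<Rightarrow> real" where
  "spow p t = sgn t * \<bar>t\<bar> powr (p - 1)"

lemma spow_minus: "spow p (- t) = - spow p t"
  by (simp add: spow_def sgn_minus)

lemma abs_spow: "\<bar>spow p t\<bar> = \<bar>t\<bar> powr (p - 1)"
  by (simp add: spow_def abs_mult abs_sgn_eq)

lemma spow_mult: "0 < c \<Longrightarrow> spow p (c * t) = c powr (p - 1) * spow p t"
  by (simp add: spow_def sgn_mult abs_mult powr_mult)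

lemma spow_mult_self: "spow p t * t = \<bar>t\<bar> powr p"
proof (cases "t = 0")
  case False
  then have "\<bar>t\<bar> powr p = \<bar>t\<bar> powr (p - 1) * \<bar>t\<bar>"
    using powr_mult_base[of "\<bar>t\<bar>" "p - 1"] by (simp add: mult.commute)
  then show ?thesis by (auto simp: spow_def sgn_if abs_if)
qed auto

lemma spow_strict_mono:
  assumes "1 < p" "s < t" shows "spow p s < spow p t"
proof -
  consider "0 \<le> s" | "s < 0" "0 < t" | "t \<le> 0" by linarith
  then show ?thesis
  proof cases
    case 1
    then show ?thesis using assms powr_less_mono2[of "p - 1" s t]
      by (cases "s = 0") (auto simp: spow_def)
  next
    case 2
    then have "spow p s < 0" "0 < spow p t" by (auto simp: spow_def)
    then show ?thesis by linarith
  next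
    case 3
    then show ?thesis using assms powr_less_mono2[of "p - 1" "- t" "- s"]
      by (cases "t = 0") (auto simp: spow_def)
  qed
qed

lemma spow_mono: "1 < p \<Longrightarrow> s \<le> t \<Longrightarrow> spow p s \<le> spow p t"
  using spow_strict_mono[of p s t] by (cases "s = t") auto

lemma abs_powr_has_derivative:
  assumes "t \<noteq> 0"
  shows "((\<lambda>t. \<bar>t\<bar> powr q) has_real_derivative q * (sgn t * \<bar>t\<bar> powr (q - 1))) (at t)"
proof (cases "0 < t")
  case True
  have "((\<lambda>t. t powr q) has_real_derivative q * t powr (q - 1)) (at t)"
    using True by (rule has_real_derivative_powr)
  moreover have "\<forall>\<^sub>F s in nhds t. \<bar>s\<bar> powr q = s powr q"
    using eventually_nhds_in_open[of "{0<..}" t] True by (auto elim!: eventually_mono)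
  ultimately show ?thesis using True DERIV_cong_ev[OF refl _ refl] by fastforce
next
  case False
  have "((\<lambda>t. (- t) powr q) has_real_derivative - (q * (- t) powr (q - 1))) (at t)"
    using False assms by (auto intro!: derivative_eq_intros)
  moreover have "\<forall>\<^sub>F s in nhds t. \<bar>s\<bar> powr q = (- s) powr q"
    using eventually_nhds_in_open[of "{..<0}" t] False assms by (auto elim!: eventually_mono)
  ultimately show ?thesis using False assms DERIV_cong_ev[OF refl _ refl] by fastforce
qed

lemma isCont_spow:
  assumes "1 < p" shows "isCont (spow p) t"
proof (cases "t = 0")
  case True
  have "((\<lambda>t. \<bar>t\<bar> powr (p - 1)) \<longlongrightarrow> \<bar>0\<bar> powr (p - 1)) (at (0 :: real))"
    using assms by (intro tendsto_intros) auto
  then have "((\<lambda>t. \<bar>spow p t\<bar>) \<longlongrightarrow> 0) (at 0)" by (simp add: abs_spow)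
  then have "(spow p \<longlongrightarrow> 0) (at 0)" by (rule tendsto_rabs_zero_cancel)
  then show ?thesis using True by (simp add: isCont_def spow_def)
next
  case False
  have *: "isCont (sgn :: real \<Rightarrow> real) t" using False by (simp add: isCont_def tendsto_sgn)
  show ?thesis unfolding spow_def[abs_def] using False *
    by (intro continuous_intros) auto
qed

lemma continuous_on_spow [continuous_intros]:
  assumes "1 < p" "continuous_on S f" shows "continuous_on S (\<lambda>x. spow p (f x))"
  using assms continuous_on_compose2[of UNIV "spow p" S f] continuous_at_imp_continuous_on isCont_spow
  by blast

lemma borel_measurable_spow [measurable]:
  "1 < p \<Longrightarrow> spow p \<in> borel_measurable borel"
  by (intro borel_measurable_continuous_onI continuous_at_imp_continuous_on) (auto intro: isCont_spow)

lemma spow_has_derivative: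
  assumes "t \<noteq> 0"
  shows "(spow p has_real_derivative (p - 1) * \<bar>t\<bar> powr (p - 2)) (at t)"
proof -
  have "((\<lambda>s. sgn t * \<bar>s\<bar> powr (p - 1)) has_real_derivative
      sgn t * ((p - 1) * (sgn t * \<bar>t\<bar> powr (p - 1 - 1)))) (at t)"
    by (intro DERIV_cmult abs_powr_has_derivative assms)
  moreover have "\<forall>\<^sub>F s in nhds t. sgn t * \<bar>s\<bar> powr (p - 1) = spow p s"
  proof (cases "0 < t")
    case True
    then show ?thesis using eventually_nhds_in_open[of "{0<..}" t]
      by (auto elim!: eventually_mono simp: spow_def)
  next
    case False
    then show ?thesis using eventually_nhds_in_open[of "{..<0}" t] assms
      by (auto elim!: eventually_mono simp: spow_def)
  qed
  ultimately have "(spow p has_real_derivative sgn t * ((p - 1) * (sgn t * \<bar>t\<bar> powr (p - 1 - 1)))) (at t)"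
    using DERIV_cong_ev[OF refl, of "\<lambda>s. sgn t * \<bar>s\<bar> powr (p - 1)" "spow p" t] by metis
  moreover have "sgn t * ((p - 1) * (sgn t * \<bar>t\<bar> powr (p - 1 - 1))) = (p - 1) * \<bar>t\<bar> powr (p - 2)"
    using assms by (auto simp: sgn_if)
  ultimately show ?thesis by (simp only:)
qed

lemma abs_powr_has_derivative_spow:
  assumes "1 < p"
  shows "((\<lambda>t. \<bar>t\<bar> powr p) has_real_derivative p * spow p t) (at t)"
proof (cases "t = 0")
  case True
  \<comment> \<open>At 0 the difference quotient of the p-th power is \<open>spow p h\<close>
    itself, and p > 1 makes that tend to 0.\<close>
  have "((\<lambda>h. (\<bar>0 + h\<bar> powr p - \<bar>0\<bar> powr p) / h) \<longlongrightarrow> 0) (at (0 :: real))"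
  proof (rule Lim_transform_eventually)
    show "(spow p \<longlongrightarrow> 0) (at 0)"
      using isCont_spow[OF assms, of 0] by (simp add: isCont_def spow_def)
    show "\<forall>\<^sub>F h in at 0. spow p h = (\<bar>0 + h\<bar> powr p - \<bar>0\<bar> powr p) / h"
      using assms spow_mult_self[of p]
      by (auto simp: eventually_at field_simps intro!: exI[of _ 1])
  qed
  then show ?thesis using True by (simp add: DERIV_def spow_def)
next
  case False
  then show ?thesis using abs_powr_has_derivative[OF False, of p] by (simp add: spow_def)
qed

text \<open>The mean value theorem gives a slope \<open>p * spow p s\<close> at an intermediate s;
  strict monotonicity of \<open>spow p\<close> compares it with the tangent slope at
  \<open>a\<close>.\<close>

lemma abs_powr_strict_convex:
  assumes p: "1 < p" and "a \<noteq> b"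
  shows "\<bar>a\<bar> powr p + p * spow p a * (b - a) < \<bar>b\<bar> powr p"
proof (cases "a < b")
  case True
  then obtain s where s: "a < s" "s < b" "\<bar>b\<bar> powr p - \<bar>a\<bar> powr p = (b - a) * (p * spow p s)"
    using MVT2[of a b "\<lambda>t. \<bar>t\<bar> powr p" "\<lambda>t. p * spow p t"] abs_powr_has_derivative_spow[OF p] by blast
  have "(b - a) * (p * spow p a) < (b - a) * (p * spow p s)"
    using True p spow_strict_mono[OF p s(1)] by simp
  then show ?thesis using s(3) by (simp add: algebra_simps)
next
  case False
  with assms have "b < a" by simp
  then obtain s where s: "b < s" "s < a" "\<bar>a\<bar> powr p - \<bar>b\<bar> powr p = (a - b) * (p * spow p s)"
    using MVT2[of b a "\<lambda>t. \<bar>t\<bar> powr p" "\<lambda>t. p * spow p t"] abs_powr_has_derivative_spow[OF p] by blast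
  have "(a - b) * (p * spow p s) < (a - b) * (p * spow p a)"
    using \<open>b < a\<close> p spow_strict_mono[OF p s(2)] by simp
  then show ?thesis using s(3) by (simp add: algebra_simps)
qed

text \<open>For \<open>p < 2\<close> the derivative of \<^term>\<open>spow p\<close> is unbounded at \<open>0\<close>; the bound is uniform because an
  increment \<open>h\<close> that could cross \<open>0\<close> satisfies \<open>\<bar>h\<bar> powr (p - 1) \<le> C * \<bar>h\<bar> * \<bar>a\<bar> powr (p - 2)\<close>.\<close>

lemma spow_diff_le:
  assumes p: "1 < p" and M: "0 < M"
  obtains C where "0 \<le> C"
    "\<And>a h. a \<noteq> 0 \<Longrightarrow> \<bar>a\<bar> \<le> M \<Longrightarrow> \<bar>h\<bar> \<le> M \<Longrightarrow>
      \<bar>spow p (a + h) - spow p a\<bar> \<le> C * \<bar>h\<bar> * (\<bar>a\<bar> powr (p - 2) + 1)"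
proof -
  \<comment> \<open>\<open>c1\<close> bounds the derivative on segments that stay away from 0;
    \<open>c2\<close> bounds both values when \<open>h\<close> dominates \<open>a\<close>, and
    \<open>c3\<close> rewrites \<open>\<bar>h\<bar> powr (p - 2)\<close> in that case. The sums in
    \<open>c1\<close> and \<open>c3\<close> have one term for p \<le> 2 and one for p > 2; the
    summand 1 in the final bound serves p > 2.\<close>
  define c1 where "c1 = (p - 1) * ((1/2) powr (p - 2) + (2 * M) powr (p - 2))"
  define c2 where "c2 = 3 powr (p - 1) + 2 powr (p - 1)"
  define c3 where "c3 = (1/2) powr (p - 2) + M powr (p - 2)"
  have nn: "0 \<le> c1" "0 \<le> c2" "0 \<le> c3" using p by (auto simp: c1_def c2_def c3_def)
  have "\<bar>spow p (a + h) - spow p a\<bar> \<le> (c1 + c2 * c3) * \<bar>h\<bar> * (\<bar>a\<bar> powr (p - 2) + 1)"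
    if a: "a \<noteq> 0" "\<bar>a\<bar> \<le> M" and h: "\<bar>h\<bar> \<le> M" for a h
  \<comment> \<open>For small \<open>h\<close> the segment from a to a + h keeps the distance
    \<open>\<bar>a\<bar> / 2\<close> from 0 and the mean value estimate applies; otherwise the two
    values are estimated separately.\<close>
  proof (cases "\<bar>h\<bar> \<le> \<bar>a\<bar> / 2")
    case True
    have seg: "\<bar>a\<bar> / 2 \<le> \<bar>s\<bar> \<and> \<bar>s\<bar> \<le> 2 * M \<and> s \<noteq> 0" if s: "s \<in> closed_segment a (a + h)" for s
    proof -
      have "\<bar>s - a\<bar> \<le> \<bar>h\<bar>" using segment_bound1[OF s] by simp
      then show ?thesis using True a h by linarith
    qed
    have bound: "(p - 1) * \<bar>s\<bar> powr (p - 2) \<le> c1 * (\<bar>a\<bar> powr (p - 2) + 1)"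
      if "s \<in> closed_segment a (a + h)" for s
    proof -
      have "\<bar>s\<bar> powr (p - 2) \<le> ((1/2) powr (p - 2) + (2 * M) powr (p - 2)) * (\<bar>a\<bar> powr (p - 2) + 1)"
      proof (cases "p \<le> 2")
        case True
        have "\<bar>s\<bar> powr (p - 2) \<le> (1/2 * \<bar>a\<bar>) powr (p - 2)"
          using seg[OF that] a True by (intro powr_mono2') auto
        also have "\<dots> = (1/2) powr (p - 2) * \<bar>a\<bar> powr (p - 2)" by (simp only: powr_mult)
        also have "\<dots> \<le> ((1/2) powr (p - 2) + (2 * M) powr (p - 2)) * (\<bar>a\<bar> powr (p - 2) + 1)"
          by (intro mult_mono) auto
        finally show ?thesis .
      next
        case False
        have "\<bar>s\<bar> powr (p - 2) \<le> (2 * M) powr (p - 2) * 1"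
          using seg[OF that] a False by (simp add: powr_mono2)
        also have "\<dots> \<le> ((1/2) powr (p - 2) + (2 * M) powr (p - 2)) * (\<bar>a\<bar> powr (p - 2) + 1)"
          by (intro mult_mono) auto
        finally show ?thesis .
      qed
      then show ?thesis unfolding c1_def using p
        by (simp add: mult.assoc mult_left_mono)
    qed
    have *: "norm (spow p (a + h) - spow p a) \<le> (c1 * (\<bar>a\<bar> powr (p - 2) + 1)) * norm ((a + h) - a)"
    proof (rule field_differentiable_bound[of "closed_segment a (a + h)" "spow p" "\<lambda>s. (p - 1) * \<bar>s\<bar> powr (p - 2)" "c1 * (\<bar>a\<bar> powr (p - 2) + 1)" "a + h" a])
      fix s assume s: "s \<in> closed_segment a (a + h)"
      then show "(spow p has_field_derivative (p - 1) * \<bar>s\<bar> powr (p - 2)) (at s within closed_segment a (a + h))"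
        using seg[OF s] by (blast intro: has_field_derivative_at_within spow_has_derivative)
      show "norm ((p - 1) * \<bar>s\<bar> powr (p - 2)) \<le> c1 * (\<bar>a\<bar> powr (p - 2) + 1)"
        using bound[OF s] p by (simp add: abs_mult)
    qed auto
    have "c1 * (\<bar>a\<bar> powr (p - 2) + 1) * \<bar>h\<bar> \<le> (c1 + c2 * c3) * \<bar>h\<bar> * (\<bar>a\<bar> powr (p - 2) + 1)"
      using nn by (simp add: algebra_simps)
    then show ?thesis using * by simp
  next
    case False
    then have h0: "\<bar>h\<bar> > 0" "\<bar>a\<bar> < 2 * \<bar>h\<bar>" using a by auto
    have ah: "\<bar>a + h\<bar> \<le> 3 * \<bar>h\<bar>" "\<bar>a\<bar> \<le> 2 * \<bar>h\<bar>" using h0 by linarith+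
    have "\<bar>spow p (a + h) - spow p a\<bar> \<le> \<bar>a + h\<bar> powr (p - 1) + \<bar>a\<bar> powr (p - 1)"
      using abs_spow[of p "a + h"] abs_spow[of p a] by linarith
    also have "\<dots> \<le> (3 * \<bar>h\<bar>) powr (p - 1) + (2 * \<bar>h\<bar>) powr (p - 1)"
      by (intro add_mono powr_mono2 abs_ge_zero ah) (use p in simp_all)
    also have "\<dots> = c2 * \<bar>h\<bar> powr (p - 1)" by (simp add: c2_def powr_mult distrib_right)
    also have "\<bar>h\<bar> powr (p - 1) = \<bar>h\<bar> * \<bar>h\<bar> powr (p - 2)"
      using h0(1) powr_add[of "\<bar>h\<bar>" 1 "p - 2"] by (simp del: zero_less_abs_iff)
    also have "\<bar>h\<bar> powr (p - 2) \<le> c3 * (\<bar>a\<bar> powr (p - 2) + 1)"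
    proof (cases "p \<le> 2")
      case True
      have "\<bar>h\<bar> powr (p - 2) \<le> (1/2 * \<bar>a\<bar>) powr (p - 2)"
        by (rule powr_mono2') (use h0 True a(1) in \<open>simp_all del: zero_less_abs_iff\<close>)
      also have "\<dots> = (1/2) powr (p - 2) * \<bar>a\<bar> powr (p - 2)" by (simp only: powr_mult)
      also have "\<dots> \<le> c3 * (\<bar>a\<bar> powr (p - 2) + 1)"
        unfolding c3_def by (intro mult_mono) auto
      finally show ?thesis .
    next
      case False
      have "\<bar>h\<bar> powr (p - 2) \<le> M powr (p - 2) * 1"
        unfolding mult_1_right by (rule powr_mono2) (use h False in simp_all)
      also have "\<dots> \<le> c3 * (\<bar>a\<bar> powr (p - 2) + 1)"
        unfolding c3_def by (intro mult_mono) auto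
      finally show ?thesis .
    qed
    finally have "\<bar>spow p (a + h) - spow p a\<bar> \<le> c2 * (\<bar>h\<bar> * (c3 * (\<bar>a\<bar> powr (p - 2) + 1)))"
      using nn by (simp add: mult_left_mono)
    also have "\<dots> \<le> (c1 + c2 * c3) * \<bar>h\<bar> * (\<bar>a\<bar> powr (p - 2) + 1)"
      using nn by (simp add: algebra_simps)
    finally show ?thesis .
  qed
  moreover have "0 \<le> c1 + c2 * c3" using nn by simp
  ultimately show ?thesis by (rule that[rotated])
qed

section \<open>Minimizers of the p-norm over compact sets\<close>

lemma set_integrable_compact:
  fixes f :: "'a::euclidean_space \<Rightarrow> real"
  shows "compact S \<Longrightarrow> continuous_on S f \<Longrightarrow> set_integrable lborel S f"
  unfolding set_integrable_def by (rule borel_integrable_compact)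

text \<open>\<open>Lp_norm\<close> integrates over \<open>lebesgue_on\<close>, whereas all
  substitutions are done in \<open>lborel\<close>; a Borel integrand has the same integral in the
  completion.\<close>

lemma lebesgue_on_compact_integral:
  fixes f :: "'a::euclidean_space \<Rightarrow> real"
  assumes S: "compact S" and f: "continuous_on S f"
  shows "(LINT y|lebesgue_on S. f y) = (LINT y:S|lborel. f y)"
proof -
  have m: "(\<lambda>x. indicator S x *\<^sub>R f x) \<in> borel_measurable borel"
    using borel_integrable_compact[OF assms] by auto
  have "(LINT y|lebesgue_on S. f y) = (LINT y|lebesgue. indicator S y *\<^sub>R f y)"
    using fmeasurableD[OF lmeasurable_compact[OF S]] by (subst integral_restrict_space) auto
  also have "\<dots> = (LINT y|lborel. indicator S y *\<^sub>R f y)"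
    using m by (intro integral_completion) simp
  finally show ?thesis by (simp add: set_lebesgue_integral_def)
qed

text \<open>\<open>mu_p\<close> with the closed ball replaced by an arbitrary set, which separates
  the minimization from the group.\<close>

definition best_const :: "ereal \<Rightarrow> 'a::euclidean_space set \<Rightarrow> ('a \<Rightarrow> real) \<Rightarrow> real" where
  "best_const p S f = (THE \<mu>. \<forall>c. Lp_norm p S (\<lambda>y. f y - \<mu>) \<le> Lp_norm p S (\<lambda>y. f y - c))"

text \<open>Integrating the tangent inequality of \<open>\<bar>t\<bar> powr p\<close> at
  \<open>f y - m\<close> removes its linear term by the hypothesis on \<open>m\<close>. Every other
  constant is strictly worse, so existence and uniqueness behind \<open>THE\<close> come
  together.\<close>

lemma Lp_minimizer:
  fixes f :: "'a::euclidean_space \<Rightarrow> real"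
  assumes p: "1 < p" and S: "compact S" "emeasure lborel S \<noteq> 0" and f: "continuous_on S f"
    and m: "(LINT y:S|lborel. spow p (f y - m)) = 0"
  shows "best_const (ereal p) S f = m"
proof -
  define J where "J c = (LINT y:S|lborel. \<bar>f y - c\<bar> powr p)" for c
  have cont: "continuous_on S (\<lambda>y. \<bar>f y - c\<bar> powr p)" for c
    unfolding spow_mult_self[symmetric] using p f by (intro continuous_intros)
  note int = set_integrable_compact[OF S(1)]
  have Lp: "Lp_norm (ereal p) S (\<lambda>y. f y - c) = J c powr (1 / p)" for c
    unfolding Lp_norm_def J_def using lebesgue_on_compact_integral[OF S(1) cont] by simp
  have J0: "0 \<le> J c" for c
    unfolding J_def set_lebesgue_integral_def by (intro Bochner_Integration.integral_nonneg) auto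
  have Jless: "J m < J c" if "c \<noteq> m" for c
  proof -
    \<comment> \<open>The gap in the tangent inequality: it is positive everywhere, so over a set of
      nonzero measure its integral cannot vanish.\<close>
    define g where "g y = \<bar>f y - c\<bar> powr p - \<bar>f y - m\<bar> powr p - p * (m - c) * spow p (f y - m)" for y
    have cg: "continuous_on S (\<lambda>y. p * (m - c) * spow p (f y - m))"
      using f p by (intro continuous_intros)
    have gpos: "0 < g y" for y
      using abs_powr_strict_convex[OF p, of "f y - m" "f y - c"] that by (simp add: g_def algebra_simps)
    have "(LINT y:S|lborel. g y) = J c - J m - (LINT y:S|lborel. p * (m - c) * spow p (f y - m))"
      unfolding g_def J_def using cont cg
      by (simp add: set_integral_diff(2) set_integral_diff(1) int)
    then have gJ: "(LINT y:S|lborel. g y) = J c - J m" using m by simp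
    have intg: "integrable lborel (\<lambda>y. indicator S y *\<^sub>R g y)"
      unfolding g_def[abs_def] by (intro borel_integrable_compact S continuous_on_diff cont cg)
    have "(LINT y:S|lborel. g y) \<noteq> 0"
    proof
      assume "(LINT y:S|lborel. g y) = 0"
      then have "AE y in lborel. indicator S y *\<^sub>R g y = 0"
        unfolding set_lebesgue_integral_def
        by (subst (asm) integral_nonneg_eq_0_iff_AE[OF intg]) (auto simp: gpos less_imp_le indicator_def)
      then have "AE y in lborel. y \<notin> S"
        by eventually_elim (auto simp: indicator_def less_imp_neq[OF gpos, symmetric] split: if_splits)
      then have "S \<in> null_sets lborel"
        using borel_compact[OF S(1)] by (subst (asm) AE_iff_null_sets[symmetric]) auto
      then show False using S(2) by auto
    qed
    moreover have "0 \<le> (LINT y:S|lborel. g y)"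
      unfolding set_lebesgue_integral_def by (intro Bochner_Integration.integral_nonneg) (auto simp: less_imp_le gpos indicator_def)
    ultimately show ?thesis using gJ by linarith
  qed
  have less: "Lp_norm (ereal p) S (\<lambda>y. f y - m) < Lp_norm (ereal p) S (\<lambda>y. f y - c)" if "c \<noteq> m" for c
    unfolding Lp using Jless[OF that] J0[of m] p by (intro powr_less_mono2) auto
  show ?thesis unfolding best_const_def
  proof (rule the_equality)
    show "\<forall>c. Lp_norm (ereal p) S (\<lambda>y. f y - m) \<le> Lp_norm (ereal p) S (\<lambda>y. f y - c)"
      using less by (metis less_imp_le order_refl)
    show "\<mu> = m" if "\<forall>c. Lp_norm (ereal p) S (\<lambda>y. f y - \<mu>) \<le> Lp_norm (ereal p) S (\<lambda>y. f y - c)" for \<mu>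
      using that less by (meson linorder_not_less)
  qed
qed

lemma spow_integral_continuous:
  fixes f :: "'a::euclidean_space \<Rightarrow> real"
  assumes p: "1 < p" and S: "compact S" and f: "continuous_on S f"
  shows "continuous_on {a..b} (\<lambda>c. LINT y:S|lborel. spow p (f y - c))"
  unfolding continuous_on_sequentially o_def
proof (intro allI impI ballI)
  fix X :: "nat \<Rightarrow> real" and c assume "c \<in> {a..b}" "(\<forall>n. X n \<in> {a..b}) \<and> X \<longlonglongrightarrow> c"
  then have X: "\<And>n. X n \<in> {a..b}" "X \<longlonglongrightarrow> c" by auto
  note int = borel_integrable_compact[OF S]
  have cont: "continuous_on S (\<lambda>y. spow p (f y - c))" for c
    using p f by (intro continuous_intros)
  \<comment> \<open>Monotonicity of \<open>spow p\<close> confines the values for constants in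
    \<open>{a..b}\<close> between those at the endpoints, which supplies the dominating
    function.\<close>
  have b: "\<bar>spow p (f y - X n)\<bar> \<le> \<bar>spow p (f y - a)\<bar> + \<bar>spow p (f y - b)\<bar>" for y n
    using spow_mono[OF p, of "f y - X n" "f y - a"] spow_mono[OF p, of "f y - b" "f y - X n"] X(1)[of n]
    by auto
  show "(\<lambda>n. LINT y:S|lborel. spow p (f y - X n)) \<longlonglongrightarrow> (LINT y:S|lborel. spow p (f y - c))"
    unfolding set_lebesgue_integral_def
  proof (rule integral_dominated_convergence[where
        w = "\<lambda>y. indicator S y *\<^sub>R (\<bar>spow p (f y - a)\<bar> + \<bar>spow p (f y - b)\<bar>)"])
    show "AE y in lborel. (\<lambda>n. indicator S y *\<^sub>R spow p (f y - X n)) \<longlonglongrightarrow> indicator S y *\<^sub>R spow p (f y - c)"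
      by (intro always_eventually allI tendsto_intros isCont_tendsto_compose[OF isCont_spow[OF p]] X)
    show "integrable lborel (\<lambda>y. indicator S y *\<^sub>R (\<bar>spow p (f y - a)\<bar> + \<bar>spow p (f y - b)\<bar>))"
      by (intro int continuous_intros cont)
    show "(\<lambda>y. indicator S y *\<^sub>R spow p (f y - c)) \<in> borel_measurable lborel"
      using int[OF cont] by auto
    show "(\<lambda>y. indicator S y *\<^sub>R spow p (f y - X n)) \<in> borel_measurable lborel" for n
      using int[OF cont] by auto
    show "AE y in lborel. norm (indicator S y *\<^sub>R spow p (f y - X n))
        \<le> indicator S y *\<^sub>R (\<bar>spow p (f y - a)\<bar> + \<bar>spow p (f y - b)\<bar>)" for n
      using b by (intro always_eventually allI) (auto simp: indicator_def)
  qed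
qed

text \<open>The intermediate value theorem locates a zero of the continuous integral between the two
  constants, so signs alone localize the minimizer.\<close>

lemma Lp_minimizer_bracket:
  fixes f :: "'a::euclidean_space \<Rightarrow> real"
  assumes p: "1 < p" and S: "compact S" "emeasure lborel S \<noteq> 0" and f: "continuous_on S f"
    and ab: "a \<le> b" "0 \<le> (LINT y:S|lborel. spow p (f y - a))" "(LINT y:S|lborel. spow p (f y - b)) \<le> 0"
  shows "best_const (ereal p) S f \<in> {a..b}"
proof -
  obtain m where "a \<le> m" "m \<le> b" "(LINT y:S|lborel. spow p (f y - m)) = 0"
    using IVT2'[of "\<lambda>c. LINT y:S|lborel. spow p (f y - c)" b 0 a] ab
      spow_integral_continuous[OF p S(1) f] by blast
  then show ?thesis using Lp_minimizer[OF p S f, of m] by simp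
qed

section \<open>Integrability of the weight and limits of difference quotients\<close>

text \<open>A translation along \<open>\<xi>\<close> moved onto a Lipschitz cut-off bounds the integrals of the difference
  quotients of \<^term>\<open>\<lambda>z. spow p (\<xi> \<bullet> z)\<close>; Fatou's lemma then applies.\<close>

lemma integrable_powr_inner:
  fixes \<xi> :: "'a::euclidean_space"
  assumes p: "1 < p" and \<xi>: "\<xi> \<noteq> 0" and K: "compact K"
  shows "set_integrable lborel K (\<lambda>z. \<bar>\<xi> \<bullet> z\<bar> powr (p - 2))"
proof -
  obtain R where R: "\<And>z. z \<in> K \<Longrightarrow> norm z \<le> R"
    using compact_imp_bounded[OF K] by (auto simp: bounded_iff)
  \<comment> \<open>This cut-off is 1-Lipschitz, at least 1 on \<open>K\<close>, and zero where the
    norm is R + 1 or more.\<close>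
  define w where "w z = max 0 (R + 1 - norm z)" for z :: 'a
  have w0: "0 \<le> w z" for z by (simp add: w_def)
  have w1: "1 \<le> w z" if "z \<in> K" for z using R[OF that] by (simp add: w_def)
  have wc: "continuous_on A w" for A unfolding w_def by (intro continuous_intros)
  \<comment> \<open>Moving by \<open>\<epsilon> n *\<^sub>R e\<close> changes
    \<open>\<xi> \<bullet> z\<close> by exactly \<open>\<epsilon> n\<close>, so a shift in the
    argument of \<open>spow p\<close> becomes a shift of \<open>w\<close>.\<close>
  define e where "e = \<xi> /\<^sub>R (\<xi> \<bullet> \<xi>)"
  have e: "\<xi> \<bullet> e = 1" using \<xi> by (simp add: e_def)
  \<comment> \<open>The extra \<open>norm e\<close> leaves room for the shifted cut-offs, since
    \<open>\<epsilon> n \<le> 1\<close>.\<close>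
  define B where "B = cball (0 :: 'a) (R + 1 + norm e)"
  have B: "compact B" by (simp add: B_def)
  have sc: "continuous_on A (\<lambda>z. spow p (\<xi> \<bullet> z + c))" for A c
    using p by (intro continuous_intros)
  have sc0: "continuous_on A (\<lambda>z. spow p (\<xi> \<bullet> z))" for A
    using p by (intro continuous_intros)
  define C where "C = (LINT z:B|lborel. \<bar>spow p (\<xi> \<bullet> z)\<bar> * norm e)"
  define \<epsilon> where "\<epsilon> n = 1 / real (Suc n)" for n
  have \<epsilon>: "0 < \<epsilon> n" "\<epsilon> n \<le> 1" for n by (auto simp: \<epsilon>_def)
  define D where "D n z = (spow p (\<xi> \<bullet> z + \<epsilon> n) - spow p (\<xi> \<bullet> z)) / \<epsilon> n * w z" for n z
  have D0: "0 \<le> D n z" for n z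
    using \<epsilon>[of n] spow_mono[OF p, of "\<xi> \<bullet> z" "\<xi> \<bullet> z + \<epsilon> n"] w0[of z] by (simp add: D_def)
  have Dm[measurable]: "D n \<in> borel_measurable borel" for n
    unfolding D_def[abs_def] using \<epsilon>[of n]
    by (intro borel_measurable_continuous_onI continuous_intros wc sc sc0) auto
  have intw: "integrable lborel (\<lambda>z. g z * w z)" if g: "\<And>A. continuous_on A g" for g
  proof -
    have "(\<lambda>z. g z * w z) = (\<lambda>z. indicator B z *\<^sub>R (g z * w z))"
      by (auto simp: fun_eq_iff indicator_def B_def w_def max_def) (smt (verit) norm_ge_zero)
    then show ?thesis
      using borel_integrable_compact[OF B continuous_on_mult[OF g wc]] by simp
  qed
  have int1: "integrable lborel (\<lambda>z. spow p (\<xi> \<bullet> z + c) * w z)" for c by (rule intw[OF sc])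
  have int0: "integrable lborel (\<lambda>z. spow p (\<xi> \<bullet> z) * w z)" by (rule intw[OF sc0])
  have Deq: "D n = (\<lambda>z. (spow p (\<xi> \<bullet> z + \<epsilon> n) * w z - spow p (\<xi> \<bullet> z) * w z) / \<epsilon> n)" for n
    by (auto simp: D_def fun_eq_iff algebra_simps diff_divide_distrib)
  have intD: "integrable lborel (D n)" for n
    unfolding Deq by (intro integrable_divide Bochner_Integration.integrable_diff int0 int1)
  have "(LINT z|lborel. D n z) \<le> C" for n
  proof -
    have tr: "integrable lborel (\<lambda>z. g (z - \<epsilon> n *\<^sub>R e)) \<and> (LINT z|lborel. g (z - \<epsilon> n *\<^sub>R e)) = (LINT z|lborel. g z)"
      if "integrable lborel g" for g :: "'a \<Rightarrow> real"
      using that integrable_distr_eq[of "(+) (- (\<epsilon> n *\<^sub>R e))" lborel borel g]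
        integral_distr[of "(+) (- (\<epsilon> n *\<^sub>R e))" lborel borel g] lborel_distr_plus[of "- (\<epsilon> n *\<^sub>R e)"]
      by simp
    have sh: "\<xi> \<bullet> (z - \<epsilon> n *\<^sub>R e) + \<epsilon> n = \<xi> \<bullet> z" for z
      by (simp add: inner_diff_right e)
    have intsh: "integrable lborel (\<lambda>z. spow p (\<xi> \<bullet> z) * w (z - \<epsilon> n *\<^sub>R e))"
      and eqsh: "(LINT z|lborel. spow p (\<xi> \<bullet> z) * w (z - \<epsilon> n *\<^sub>R e)) = (LINT z|lborel. spow p (\<xi> \<bullet> z + \<epsilon> n) * w z)"
      using tr[OF int1[of "\<epsilon> n"]] by (simp_all only: sh)
    have "(LINT z|lborel. D n z) = ((LINT z|lborel. spow p (\<xi> \<bullet> z + \<epsilon> n) * w z) - (LINT z|lborel. spow p (\<xi> \<bullet> z) * w z)) / \<epsilon> n"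
      unfolding Deq by (subst integral_divide_zero, subst Bochner_Integration.integral_diff[OF int1 int0]) simp
    also have "\<dots> = (LINT z|lborel. (spow p (\<xi> \<bullet> z) * w (z - \<epsilon> n *\<^sub>R e) - spow p (\<xi> \<bullet> z) * w z) / \<epsilon> n)"
      unfolding eqsh[symmetric] by (simp add: Bochner_Integration.integral_diff[OF intsh int0])
    also have "\<dots> \<le> C" unfolding C_def set_lebesgue_integral_def
    proof (rule integral_mono)
      show "integrable lborel (\<lambda>z. indicator B z *\<^sub>R (\<bar>spow p (\<xi> \<bullet> z)\<bar> * norm e))"
        by (intro borel_integrable_compact B continuous_intros sc0)
      show "integrable lborel (\<lambda>z. (spow p (\<xi> \<bullet> z) * w (z - \<epsilon> n *\<^sub>R e) - spow p (\<xi> \<bullet> z) * w z) / \<epsilon> n)"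
        by (intro integrable_divide Bochner_Integration.integrable_diff int0 intsh)
      fix z
      have ne: "norm (\<epsilon> n *\<^sub>R e) \<le> norm e" using \<epsilon>[of n] by (simp add: mult_left_le_one_le)
      have Lip: "\<bar>w (z - \<epsilon> n *\<^sub>R e) - w z\<bar> \<le> \<epsilon> n * norm e"
      proof -
        have "\<bar>norm (z - \<epsilon> n *\<^sub>R e) - norm z\<bar> \<le> norm (\<epsilon> n *\<^sub>R e)"
          using norm_triangle_ineq3[of "z - \<epsilon> n *\<^sub>R e" z] by simp
        then show ?thesis using \<epsilon>[of n] by (auto simp: w_def max_def abs_if split: if_splits)
      qed
      have "(spow p (\<xi> \<bullet> z) * w (z - \<epsilon> n *\<^sub>R e) - spow p (\<xi> \<bullet> z) * w z) / \<epsilon> n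
          = spow p (\<xi> \<bullet> z) * ((w (z - \<epsilon> n *\<^sub>R e) - w z) / \<epsilon> n)"
        by (simp add: algebra_simps diff_divide_distrib)
      also have "\<dots> \<le> \<bar>spow p (\<xi> \<bullet> z)\<bar> * (\<bar>w (z - \<epsilon> n *\<^sub>R e) - w z\<bar> / \<epsilon> n)"
        using \<epsilon>[of n] abs_ge_self[of "spow p (\<xi> \<bullet> z) * ((w (z - \<epsilon> n *\<^sub>R e) - w z) / \<epsilon> n)"] by (simp add: abs_mult)
      also have "\<dots> \<le> indicator B z *\<^sub>R (\<bar>spow p (\<xi> \<bullet> z)\<bar> * norm e)"
      proof (cases "z \<in> B")
        case True
        moreover have "\<bar>w (z - \<epsilon> n *\<^sub>R e) - w z\<bar> / \<epsilon> n \<le> norm e"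
          using Lip \<epsilon>[of n] by (simp add: divide_le_eq mult.commute)
        ultimately show ?thesis by (simp add: mult_left_mono del: times_divide_eq_right)
      next
        case False
        have "norm z \<le> norm (z - \<epsilon> n *\<^sub>R e) + norm e"
          using norm_triangle_ineq[of "z - \<epsilon> n *\<^sub>R e" "\<epsilon> n *\<^sub>R e"] ne by simp
        then have "w z = 0" "w (z - \<epsilon> n *\<^sub>R e) = 0"
          using False norm_ge_zero[of e] unfolding B_def w_def max_def mem_cball_0 by (simp_all, linarith?)
        then show ?thesis by simp
      qed
      finally show "(spow p (\<xi> \<bullet> z) * w (z - \<epsilon> n *\<^sub>R e) - spow p (\<xi> \<bullet> z) * w z) / \<epsilon> n
        \<le> indicator B z *\<^sub>R (\<bar>spow p (\<xi> \<bullet> z)\<bar> * norm e)" .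
    qed
    finally show ?thesis .
  qed
  then have nnD: "(\<integral>\<^sup>+z. ennreal (D n z) \<partial>lborel) \<le> ennreal C" for n
    by (subst nn_integral_eq_integral[OF intD]) (auto simp: D0 ennreal_leI)
  have lim: "ennreal (indicator K z *\<^sub>R ((p - 1) * \<bar>\<xi> \<bullet> z\<bar> powr (p - 2))) \<le> liminf (\<lambda>n. ennreal (D n z))" for z
  \<comment> \<open>On the hyperplane \<open>\<xi> \<bullet> z = 0\<close> the left-hand side is 0,
    because \<open>0 powr (p - 2)\<close> is 0 for every p; elsewhere on \<open>K\<close> the bound
    uses \<open>1 \<le> w z\<close>.\<close>
  proof (cases "z \<in> K \<and> \<xi> \<bullet> z \<noteq> 0")
    case True
    have "((\<lambda>h. (spow p (\<xi> \<bullet> z + h) - spow p (\<xi> \<bullet> z)) / h) \<longlongrightarrow> (p - 1) * \<bar>\<xi> \<bullet> z\<bar> powr (p - 2)) (at 0)"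
      using spow_has_derivative[of "\<xi> \<bullet> z" p] True by (simp add: DERIV_def)
    moreover have "filterlim \<epsilon> (at 0) sequentially"
      unfolding filterlim_at \<epsilon>_def using LIMSEQ_inverse_real_of_nat by (auto simp: inverse_eq_divide)
    ultimately have "(\<lambda>n. (spow p (\<xi> \<bullet> z + \<epsilon> n) - spow p (\<xi> \<bullet> z)) / \<epsilon> n) \<longlonglongrightarrow> (p - 1) * \<bar>\<xi> \<bullet> z\<bar> powr (p - 2)"
      by (rule filterlim_compose)
    then have "(\<lambda>n. ennreal (D n z)) \<longlonglongrightarrow> ennreal ((p - 1) * \<bar>\<xi> \<bullet> z\<bar> powr (p - 2) * w z)"
      unfolding D_def by (intro tendsto_ennrealI tendsto_mult_right)
    then have "liminf (\<lambda>n. ennreal (D n z)) = ennreal ((p - 1) * \<bar>\<xi> \<bullet> z\<bar> powr (p - 2) * w z)"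
      by (rule lim_imp_Liminf[rotated]) simp
    moreover have "(p - 1) * \<bar>\<xi> \<bullet> z\<bar> powr (p - 2) * 1 \<le> (p - 1) * \<bar>\<xi> \<bullet> z\<bar> powr (p - 2) * w z"
      using p w1 True by (intro mult_left_mono) auto
    ultimately show ?thesis using True by (simp add: ennreal_leI)
  qed (auto simp: indicator_def)
  have "(\<integral>\<^sup>+z. ennreal (indicator K z *\<^sub>R ((p - 1) * \<bar>\<xi> \<bullet> z\<bar> powr (p - 2))) \<partial>lborel)
      \<le> (\<integral>\<^sup>+z. liminf (\<lambda>n. ennreal (D n z)) \<partial>lborel)"
    by (intro nn_integral_mono lim)
  also have "\<dots> \<le> liminf (\<lambda>n. \<integral>\<^sup>+z. ennreal (D n z) \<partial>lborel)"
    by (intro nn_integral_liminf) simp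
  also have "\<dots> \<le> ennreal C"
    by (intro Liminf_le) (auto intro!: nnD always_eventually)
  finally have fin: "(\<integral>\<^sup>+z. ennreal (indicator K z *\<^sub>R ((p - 1) * \<bar>\<xi> \<bullet> z\<bar> powr (p - 2))) \<partial>lborel) < \<infinity>"
    using ennreal_less_top[of C] by (simp add: order.strict_trans1)
  have "set_integrable lborel K (\<lambda>z. (p - 1) * \<bar>\<xi> \<bullet> z\<bar> powr (p - 2))"
    unfolding set_integrable_def
  proof (rule integrableI_nonneg)
    show "(\<lambda>z. indicator K z *\<^sub>R ((p - 1) * \<bar>\<xi> \<bullet> z\<bar> powr (p - 2))) \<in> borel_measurable lborel"
      using borel_compact[OF K] by measurable
    show "AE z in lborel. 0 \<le> indicator K z *\<^sub>R ((p - 1) * \<bar>\<xi> \<bullet> z\<bar> powr (p - 2))"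
      using p by (auto simp: indicator_def)
  qed (fact fin)
  from set_integrable_mult_right[OF this, of "1 / (p - 1)"] show ?thesis using p by simp
qed

lemma set_integrable_powr_inner_mult:
  fixes \<xi> :: "'a::euclidean_space"
  assumes p: "1 < p" and \<xi>: "\<xi> \<noteq> 0" and K: "compact K" and g: "continuous_on K g"
  shows "set_integrable lborel K (\<lambda>z. \<bar>\<xi> \<bullet> z\<bar> powr (p - 2) * (g z :: real))"
proof -
  have Kb: "K \<in> sets borel" using borel_compact[OF K] .
  obtain M where M: "\<And>z. z \<in> K \<Longrightarrow> \<bar>g z\<bar> \<le> M" 
    using compact_imp_bounded[OF compact_continuous_image[OF g K]] by (auto simp: bounded_iff)
  have "set_integrable lborel K (\<lambda>z. M * \<bar>\<xi> \<bullet> z\<bar> powr (p - 2))"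
    by (intro set_integrable_mult_right integrable_powr_inner p \<xi> K)
  then show ?thesis unfolding set_integrable_def
  proof (rule Bochner_Integration.integrable_bound)
    have [measurable]: "(\<lambda>z. indicator K z *\<^sub>R g z) \<in> borel_measurable borel"
      using borel_integrable_compact[OF K g] by auto
    have "(\<lambda>z. \<bar>\<xi> \<bullet> z\<bar> powr (p - 2) * (indicator K z *\<^sub>R g z)) \<in> borel_measurable lborel" by measurable
    then show "(\<lambda>z. indicator K z *\<^sub>R (\<bar>\<xi> \<bullet> z\<bar> powr (p - 2) * g z)) \<in> borel_measurable lborel"
      by (simp add: mult.left_commute)
    show "AE z in lborel. norm (indicator K z *\<^sub>R (\<bar>\<xi> \<bullet> z\<bar> powr (p - 2) * g z))
        \<le> norm (indicator K z *\<^sub>R (M * \<bar>\<xi> \<bullet> z\<bar> powr (p - 2)))"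
      using M by (intro always_eventually allI)
        (auto simp: indicator_def abs_mult mult.commute intro!: mult_right_mono order_trans[OF M abs_ge_self])
  qed
qed

lemma AE_inner_nonzero:
  fixes \<xi> :: "'a::euclidean_space"
  assumes "\<xi> \<noteq> 0"
  shows "AE z in lborel. \<xi> \<bullet> z \<noteq> 0"
proof -
  have "{z. \<xi> \<bullet> z = 0} \<in> null_sets lebesgue"
    using negligible_hyperplane[of \<xi> 0] assms by (simp add: negligible_iff_null_sets)
  moreover have "{z. \<xi> \<bullet> z = 0} \<in> sets borel" by (intro borel_closed closed_hyperplane)
  ultimately have "{z. \<xi> \<bullet> z = 0} \<in> null_sets lborel" by (simp add: null_sets_completion_iff)
  from AE_not_in[OF this] show ?thesis by simp
qed

text \<open>Dominated convergence: off the null hyperplane \<open>\<xi> \<bullet> z = 0\<close> the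
  integrand converges by differentiability of \<open>spow p\<close>, and \<open>spow_diff_le\<close>
  dominates it through the integrable weight. The factor \<open>w\<close> serves the moment
  identity, the moving \<open>r \<epsilon>\<close> the Taylor remainder of a test function.\<close>

lemma spow_difference_quotient_limit:
  fixes \<xi> :: "'a::euclidean_space"
  assumes p: "1 < p" and \<xi>: "\<xi> \<noteq> 0" and K: "compact K"
    and r: "uniform_limit K r r0 (at_right 0)" "continuous_on K r0"
    and rc: "\<forall>\<^sub>F \<epsilon> in at_right 0. continuous_on K (r \<epsilon>)"
    and w: "continuous_on K w"
  shows "((\<lambda>\<epsilon>. (LINT z:K|lborel. w z * (spow p (\<xi> \<bullet> z + \<epsilon> * r \<epsilon> z) - spow p (\<xi> \<bullet> z))) / \<epsilon>)
    \<longlongrightarrow> (p - 1) * (LINT z:K|lborel. \<bar>\<xi> \<bullet> z\<bar> powr (p - 2) * (w z * r0 z))) (at_right 0)"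
proof -
  obtain M0 where M0: "\<And>z. z \<in> K \<Longrightarrow> \<bar>r0 z\<bar> \<le> M0"
    using compact_imp_bounded[OF compact_continuous_image[OF r(2) K]] by (auto simp: bounded_iff)
  obtain L where L: "\<And>z. z \<in> K \<Longrightarrow> norm z \<le> L"
    using compact_imp_bounded[OF K] by (auto simp: bounded_iff)
  \<comment> \<open>One bound for \<open>r \<epsilon> z\<close> near \<epsilon> = 0 and for
    \<open>\<xi> \<bullet> z\<close>, as \<open>spow_diff_le\<close> uses the same bound for base
    point and increment.\<close>
  define M where "M = \<bar>M0\<bar> + 1 + norm \<xi> * \<bar>L\<bar>"
  have Mpos: "0 < M" by (simp add: M_def add_pos_nonneg)
  obtain C where C: "0 \<le> C" "\<And>a h. a \<noteq> 0 \<Longrightarrow> \<bar>a\<bar> \<le> M \<Longrightarrow> \<bar>h\<bar> \<le> M \<Longrightarrow>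
      \<bar>spow p (a + h) - spow p a\<bar> \<le> C * \<bar>h\<bar> * (\<bar>a\<bar> powr (p - 2) + 1)"
    using spow_diff_le[OF p Mpos] by blast
  have "\<forall>\<^sub>F \<epsilon> in at_right 0. \<forall>z\<in>K. dist (r \<epsilon> z) (r0 z) < 1"
    using r(1) by (auto simp: uniform_limit_iff)
  with rc have "\<forall>\<^sub>F \<epsilon> in at_right 0. continuous_on K (r \<epsilon>) \<and> (\<forall>z\<in>K. dist (r \<epsilon> z) (r0 z) < 1)"
    by (rule eventually_conj)
  then obtain b0 where b0: "b0 > 0" "\<And>\<epsilon>. 0 < \<epsilon> \<Longrightarrow> \<epsilon> < b0 \<Longrightarrow> continuous_on K (r \<epsilon>) \<and> (\<forall>z\<in>K. dist (r \<epsilon> z) (r0 z) < 1)"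
    by (auto simp: eventually_at_right_field)
  define b where "b = min b0 1"
  have b: "0 < b" using b0 by (simp add: b_def)
  have rM: "\<bar>r \<epsilon> z\<bar> \<le> M" if "0 < \<epsilon>" "\<epsilon> < b" "z \<in> K" for \<epsilon> z
  proof -
    have "\<bar>r \<epsilon> z - r0 z\<bar> < 1" using b0(2)[of \<epsilon>] that by (auto simp: b_def dist_real_def)
    moreover have "0 \<le> norm \<xi> * \<bar>L\<bar>" by simp
    ultimately show ?thesis using M0[OF that(3)] unfolding M_def by linarith
  qed
  have zM: "\<bar>\<xi> \<bullet> z\<bar> \<le> M" if "z \<in> K" for z
  proof -
    have "\<bar>\<xi> \<bullet> z\<bar> \<le> norm \<xi> * norm z" by (rule Cauchy_Schwarz_ineq2)
    also have "\<dots> \<le> norm \<xi> * \<bar>L\<bar>" using L[OF that] by (intro mult_left_mono) auto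
    finally show ?thesis unfolding M_def by linarith
  qed
  show ?thesis
  proof (rule tendsto_at_right_sequentially[OF b])
    fix X assume X: "\<And>n. 0 < X n" "\<And>n. X n < b" "X \<longlonglongrightarrow> (0::real)"
    have X0: "filterlim X (at_right 0) sequentially"
      unfolding filterlim_at using X(3) X(1) less_imp_neq[OF X(1), symmetric] by (auto intro!: always_eventually)
    define F where "F n z = indicator K z *\<^sub>R ((w z * (spow p (\<xi> \<bullet> z + X n * r (X n) z) - spow p (\<xi> \<bullet> z))) / X n)" for n z
    have "(\<lambda>n. LINT z|lborel. F n z) \<longlonglongrightarrow> (LINT z|lborel. indicator K z *\<^sub>R ((p - 1) * (\<bar>\<xi> \<bullet> z\<bar> powr (p - 2) * (w z * r0 z))))"
    proof (rule integral_dominated_convergence[where w = "\<lambda>z. indicator K z *\<^sub>R (C * M * (\<bar>\<xi> \<bullet> z\<bar> powr (p - 2) * \<bar>w z\<bar> + \<bar>w z\<bar>))"])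
      show "(\<lambda>z. indicator K z *\<^sub>R ((p - 1) * (\<bar>\<xi> \<bullet> z\<bar> powr (p - 2) * (w z * r0 z)))) \<in> borel_measurable lborel"
        using set_integrable_mult_right[OF set_integrable_powr_inner_mult[OF p \<xi> K continuous_on_mult[OF w r(2)]], of "p - 1"]
        unfolding set_integrable_def by (rule borel_measurable_integrable)
      show "F n \<in> borel_measurable lborel" for n
      proof -
        have "continuous_on K (\<lambda>z. (w z * (spow p (\<xi> \<bullet> z + X n * r (X n) z) - spow p (\<xi> \<bullet> z))) / X n)"
          using b0(2)[of "X n"] X(1,2)[of n] p w by (intro continuous_intros) (auto simp: b_def)
        from borel_integrable_compact[OF K this] show ?thesis unfolding F_def[abs_def] by auto
      qed
      show "integrable lborel (\<lambda>z. indicator K z *\<^sub>R (C * M * (\<bar>\<xi> \<bullet> z\<bar> powr (p - 2) * \<bar>w z\<bar> + \<bar>w z\<bar>)))"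
      proof -
        have aw: "continuous_on K (\<lambda>z. \<bar>w z\<bar>)" using w by (rule continuous_on_rabs)
        have "set_integrable lborel K (\<lambda>z. \<bar>\<xi> \<bullet> z\<bar> powr (p - 2) * \<bar>w z\<bar> + \<bar>w z\<bar>)"
          by (intro set_integral_add(1) set_integrable_powr_inner_mult[OF p \<xi> K aw] set_integrable_compact[OF K aw])
        from set_integrable_mult_right[OF this, of "C * M"] show ?thesis
          by (simp add: set_integrable_def)
      qed
      show "AE z in lborel. norm (F n z) \<le> indicator K z *\<^sub>R (C * M * (\<bar>\<xi> \<bullet> z\<bar> powr (p - 2) * \<bar>w z\<bar> + \<bar>w z\<bar>))" for n
        using AE_inner_nonzero[OF \<xi>]
      proof eventually_elim
        case (elim z)
        show ?case
        proof (cases "z \<in> K")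
          case True
          have Xn: "0 < X n" "X n \<le> 1" using X(1,2)[of n] by (auto simp: b_def)
          note rr = rM[OF X(1) X(2) True, of n]
          have "\<bar>X n * r (X n) z\<bar> \<le> 1 * M" unfolding abs_mult using Xn rr by (intro mult_mono) auto
          then have "\<bar>spow p (\<xi> \<bullet> z + X n * r (X n) z) - spow p (\<xi> \<bullet> z)\<bar> \<le> C * \<bar>X n * r (X n) z\<bar> * (\<bar>\<xi> \<bullet> z\<bar> powr (p - 2) + 1)"
            using C(2)[OF elim zM[OF True]] by simp
          also have "\<dots> \<le> C * (X n * M) * (\<bar>\<xi> \<bullet> z\<bar> powr (p - 2) + 1)"
            using C(1) Xn rr by (intro mult_right_mono mult_left_mono) (auto simp: abs_mult intro!: mult_left_mono)
          finally have "\<bar>spow p (\<xi> \<bullet> z + X n * r (X n) z) - spow p (\<xi> \<bullet> z)\<bar> / X n \<le> C * M * (\<bar>\<xi> \<bullet> z\<bar> powr (p - 2) + 1)"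
            using Xn by (simp add: divide_le_eq algebra_simps)
          then have "\<bar>w z\<bar> * (\<bar>spow p (\<xi> \<bullet> z + X n * r (X n) z) - spow p (\<xi> \<bullet> z)\<bar> / X n) \<le> \<bar>w z\<bar> * (C * M * (\<bar>\<xi> \<bullet> z\<bar> powr (p - 2) + 1))"
            by (intro mult_left_mono) auto
          moreover have "norm (F n z) = \<bar>w z\<bar> * (\<bar>spow p (\<xi> \<bullet> z + X n * r (X n) z) - spow p (\<xi> \<bullet> z)\<bar> / X n)"
            using True Xn by (simp add: F_def abs_mult)
          ultimately show ?thesis using True by (simp add: algebra_simps)
        qed (simp add: F_def)
      qed
      show "AE z in lborel. (\<lambda>n. F n z) \<longlonglongrightarrow> indicator K z *\<^sub>R ((p - 1) * (\<bar>\<xi> \<bullet> z\<bar> powr (p - 2) * (w z * r0 z)))"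
        using AE_inner_nonzero[OF \<xi>]
      proof eventually_elim
        case (elim z)
        show ?case
        proof (cases "z \<in> K")
          case True
          have rlim: "(\<lambda>n. r (X n) z) \<longlonglongrightarrow> r0 z"
            using tendsto_uniform_limitI[OF r(1) True] X0 by (rule filterlim_compose)
          \<comment> \<open>Caratheodory's form of the derivative expresses the quotient without
            dividing by \<open>r (X n) z\<close>, which may vanish.\<close>
          obtain g where g: "\<And>y. spow p y - spow p (\<xi> \<bullet> z) = g y * (y - \<xi> \<bullet> z)"
            "isCont g (\<xi> \<bullet> z)" "g (\<xi> \<bullet> z) = (p - 1) * \<bar>\<xi> \<bullet> z\<bar> powr (p - 2)"
            using spow_has_derivative[OF elim, of p] unfolding CARAT_DERIV by blast
          have "(\<lambda>n. \<xi> \<bullet> z + X n * r (X n) z) \<longlonglongrightarrow> \<xi> \<bullet> z + 0 * r0 z"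
            by (intro tendsto_intros X rlim)
          then have "(\<lambda>n. w z * (g (\<xi> \<bullet> z + X n * r (X n) z) * r (X n) z)) \<longlonglongrightarrow> w z * (g (\<xi> \<bullet> z) * r0 z)"
            by (intro tendsto_intros rlim isCont_tendsto_compose[OF g(2)]) simp
          moreover have "F n z = w z * (g (\<xi> \<bullet> z + X n * r (X n) z) * r (X n) z)" for n
            using True X(1)[of n] by (simp add: F_def g(1))
          ultimately show ?thesis using True by (simp add: g(3) mult_ac)
        qed (simp add: F_def)
      qed
    qed
    then show "(\<lambda>n. (LINT z:K|lborel. w z * (spow p (\<xi> \<bullet> z + X n * r (X n) z) - spow p (\<xi> \<bullet> z))) / X n)
        \<longlonglongrightarrow> (p - 1) * (LINT z:K|lborel. \<bar>\<xi> \<bullet> z\<bar> powr (p - 2) * (w z * r0 z))"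
    proof -
      have "(LINT z|lborel. F n z) = (LINT z:K|lborel. w z * (spow p (\<xi> \<bullet> z + X n * r (X n) z) - spow p (\<xi> \<bullet> z))) / X n" for n
        unfolding F_def set_lebesgue_integral_def by (subst integral_divide_zero[symmetric]) simp
      moreover assume "(\<lambda>n. LINT z|lborel. F n z) \<longlonglongrightarrow> (LINT z|lborel. indicator K z *\<^sub>R ((p - 1) * (\<bar>\<xi> \<bullet> z\<bar> powr (p - 2) * (w z * r0 z))))"
      ultimately show ?thesis
        by (simp add: set_lebesgue_integral_def mult.left_commute[of _ "p - 1"])
    qed
  qed
qed

section \<open>Moments of reflection-invariant sets\<close>

text \<open>The reflection in the hyperplane orthogonal to \<omega>. For \<omega> = 0 division by
  zero yields 0, so the map is then the identity and still an involution.\<close>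

definition hreflect :: "real^'n \<Rightarrow> real^'n \<Rightarrow> real^'n" where
  "hreflect \<omega> z = z - (2 * (\<omega> \<bullet> z) / (\<omega> \<bullet> \<omega>)) *\<^sub>R \<omega>"

lemma inner_hreflect: "v \<bullet> hreflect \<omega> z = v \<bullet> z - 2 * (\<omega> \<bullet> z) / (\<omega> \<bullet> \<omega>) * (v \<bullet> \<omega>)"
  by (simp add: hreflect_def inner_diff_right)

lemma inner_hreflect_self: "\<omega> \<bullet> hreflect \<omega> z = - (\<omega> \<bullet> z)"
  by (cases "\<omega> = 0") (auto simp: inner_hreflect)

lemma inner_hreflect_orthogonal: "v \<bullet> \<omega> = 0 \<Longrightarrow> v \<bullet> hreflect \<omega> z = v \<bullet> z"
  by (simp add: inner_hreflect)

lemma hreflect_hreflect: "hreflect \<omega> (hreflect \<omega> z) = z"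
  unfolding hreflect_def[of \<omega> "hreflect \<omega> z"] inner_hreflect_self by (simp add: hreflect_def)

lemma linear_hreflect: "linear (hreflect \<omega>)"
  by (rule linearI)
    (simp_all add: hreflect_def inner_add_right algebra_simps add_divide_distrib scaleR_add_left)

text \<open>An involution that maps \<open>K\<close> into itself leaves the indicator of
  \<open>K\<close> unchanged, and it preserves \<open>lborel\<close>.\<close>

lemma hreflect_integral:
  fixes g :: "real^'n \<Rightarrow> real"
  assumes K: "K \<in> sets borel" "\<And>z. z \<in> K \<Longrightarrow> hreflect \<omega> z \<in> K" and g: "g \<in> borel_measurable borel"
  shows "(LINT z:K|lborel. g (hreflect \<omega> z)) = (LINT z:K|lborel. g z)"
proof -
  have "indicator K (hreflect \<omega> z) = (indicator K z :: real)" for z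
    using K(2)[of z] K(2)[of "hreflect \<omega> z"] by (auto simp: indicator_def hreflect_hreflect)
  moreover have "(\<lambda>z. indicator K z *\<^sub>R g z) \<in> borel_measurable borel"
    using K(1) g by measurable
  ultimately show ?thesis
    using preserves_lborel_integral[OF preserves_lborel_involution[OF linear_hreflect hreflect_hreflect, of \<omega>],
        of "\<lambda>z. indicator K z *\<^sub>R g z"]
    by (simp add: set_lebesgue_integral_def)
qed

lemma hreflect_integral_zero:
  fixes g :: "real^'n \<Rightarrow> real"
  assumes "K \<in> sets borel" "\<And>z. z \<in> K \<Longrightarrow> hreflect \<omega> z \<in> K" and "g \<in> borel_measurable borel"
    and "\<And>z. g (hreflect \<omega> z) = - g z"
  shows "(LINT z:K|lborel. g z) = 0"
  using hreflect_integral[OF assms(1-3)] by (simp add: assms(4) set_lebesgue_integral_def)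

text \<open>Models the closed unit ball \<open>K\<close>, the first layer \<open>V\<close> and the
  horizontal gradient \<xi>. Reflections in vectors of \<open>V\<close> determine all weighted
  second moments on \<open>V\<close> up to one scalar, without a formula for
  \<open>K\<close>.\<close>

locale reflection_invariant =
  fixes K :: "(real^'n) set" and V :: "(real^'n) set" and \<xi> :: "real^'n" and p :: real
  assumes p: "1 < p" and K: "compact K" "emeasure lborel K \<noteq> 0" and V: "subspace V"
    and inv: "\<And>\<omega> z. \<omega> \<in> V \<Longrightarrow> z \<in> K \<Longrightarrow> hreflect \<omega> z \<in> K"
    and \<xi>: "\<xi> \<in> V" "\<xi> \<noteq> 0"
begin

lemma K_borel [measurable]: "K \<in> sets borel"
  using K(1) by (rule borel_compact)

text \<open>Off the hyperplane \<open>\<xi> \<bullet> z = 0\<close> the weight is, up to the factor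
  p - 1, the derivative of \<open>spow p\<close> at \<open>\<xi> \<bullet> z\<close>; it arises from
  linearizing the condition on the best constant.\<close>

definition wint :: "(real^'n \<Rightarrow> real) \<Rightarrow> real" where
  "wint g = (LINT z:K|lborel. \<bar>\<xi> \<bullet> z\<bar> powr (p - 2) * g z)"

lemma wint_add: "continuous_on K f \<Longrightarrow> continuous_on K g \<Longrightarrow> wint (\<lambda>z. f z + g z) = wint f + wint g"
  unfolding wint_def distrib_left
  by (intro set_integral_add(2) set_integrable_powr_inner_mult[OF p \<xi>(2) K(1)])

lemma wint_mult: "wint (\<lambda>z. c * f z) = c * wint f"
  unfolding wint_def by (simp add: mult.left_commute[of _ c])

lemma wint_sum:
  "finite I \<Longrightarrow> (\<And>i. i \<in> I \<Longrightarrow> continuous_on K (f i)) \<Longrightarrow> wint (\<lambda>z. \<Sum>i\<in>I. f i z) = (\<Sum>i\<in>I. wint (f i))"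
proof (induction I rule: finite_induct)
  case empty
  then show ?case using wint_mult[of 0 "\<lambda>_. 0"] by simp
next
  case (insert i I)
  then show ?case by (simp add: wint_add continuous_on_sum)
qed

text \<open>The hyperplane \<open>\<xi> \<bullet> z = 0\<close> is null and \<open>K\<close> is not,
  so an integrand positive off the hyperplane has positive integral.\<close>

lemma wint_pos:
  assumes "\<And>z. 0 < \<bar>\<xi> \<bullet> z\<bar> \<Longrightarrow> 0 < g z" "continuous_on K g" "g \<in> borel_measurable borel"
  shows "0 < wint g"
proof -
  define f where "f z = indicator K z *\<^sub>R (\<bar>\<xi> \<bullet> z\<bar> powr (p - 2) * g z)" for z
  have int: "integrable lborel f"
    using set_integrable_powr_inner_mult[OF p \<xi>(2) K(1) assms(2)]
    by (simp add: f_def[abs_def] set_integrable_def)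
  have nn: "0 \<le> f z" for z
    using assms(1)[of z] by (cases "\<xi> \<bullet> z = 0") (auto simp: f_def indicator_def)
  have "(LINT z|lborel. f z) \<noteq> 0"
  proof
    assume "(LINT z|lborel. f z) = 0"
    then have "AE z in lborel. f z = 0"
      by (subst (asm) integral_nonneg_eq_0_iff_AE[OF int]) (auto simp: nn)
    with AE_inner_nonzero[OF \<xi>(2)] have "AE z in lborel. z \<notin> K"
      by eventually_elim (use assms(1) in \<open>fastforce simp: f_def indicator_def split: if_splits\<close>)
    then have "K \<in> null_sets lborel"
      by (subst (asm) AE_iff_null_sets[symmetric]) auto
    then show False using K(2) by auto
  qed
  moreover have "0 \<le> (LINT z|lborel. f z)" by (simp add: nn)
  ultimately show ?thesis by (simp add: wint_def set_lebesgue_integral_def f_def)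
qed

text \<open>Reflection in \<xi> makes the integrand odd. The linear part of a test function thus has
  best constant 0, which is why the expansion of the mean has no term of first order in
  \<epsilon>.\<close>

lemma spow_integral_zero: "(LINT z:K|lborel. spow p (\<xi> \<bullet> z)) = 0"
proof (rule hreflect_integral_zero[where \<omega> = \<xi>])
  show "(\<lambda>z. spow p (\<xi> \<bullet> z)) \<in> borel_measurable borel" using p by measurable
qed (auto intro: inv \<xi> simp: inner_hreflect_self spow_minus)

text \<open>The reflection in \<eta> reverses the linear form and, by orthogonality to \<xi>, fixes
  the weight. This disposes of the second-layer part of the expansion.\<close>

lemma wint_linear_zero:
  assumes "\<eta> \<bullet> \<xi> = 0" "\<And>z. z \<in> K \<Longrightarrow> hreflect \<eta> z \<in> K"
  shows "wint (\<lambda>z. \<eta> \<bullet> z) = 0"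
  unfolding wint_def
proof (rule hreflect_integral_zero[where \<omega> = \<eta>])
  show "(\<lambda>z. \<bar>\<xi> \<bullet> z\<bar> powr (p - 2) * (\<eta> \<bullet> z)) \<in> borel_measurable borel" by measurable
qed (use assms in \<open>auto simp: inner_hreflect_self inner_hreflect_orthogonal inner_commute\<close>)

lemma wint_cross_zero:
  assumes "\<tau> \<in> V" "\<tau> \<bullet> \<xi> = 0"
  shows "wint (\<lambda>z. (\<xi> \<bullet> z) * (\<tau> \<bullet> z)) = 0"
  unfolding wint_def
proof (rule hreflect_integral_zero[where \<omega> = \<tau>])
  show "(\<lambda>z. \<bar>\<xi> \<bullet> z\<bar> powr (p - 2) * ((\<xi> \<bullet> z) * (\<tau> \<bullet> z))) \<in> borel_measurable borel" by measurable
qed (use assms inv in \<open>auto simp: inner_hreflect_self inner_hreflect_orthogonal inner_commute\<close>)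

text \<open>Rotating \<open>\<xi>\<close> towards \<open>\<tau>\<close>, the integral of \<^term>\<open>spow p\<close> at \<open>\<xi> + t \<tau>\<close> times the
  orthogonal direction \<open>\<tau> - t \<xi>\<close> vanishes; the identity is its derivative at \<open>t = 0\<close>.\<close>

lemma wint_orthogonal_square:
  assumes \<tau>: "\<tau> \<in> V" "\<tau> \<bullet> \<xi> = 0" "\<tau> \<bullet> \<tau> = \<xi> \<bullet> \<xi>"
  shows "(p - 1) * wint (\<lambda>z. (\<tau> \<bullet> z) * (\<tau> \<bullet> z)) = wint (\<lambda>z. (\<xi> \<bullet> z) * (\<xi> \<bullet> z))"
proof -
  have sc: "continuous_on K (\<lambda>z. spow p (\<xi> \<bullet> z + t * (\<tau> \<bullet> z)))" for t
    using p by (intro continuous_intros)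
  have sc0: "continuous_on K (\<lambda>z. spow p (\<xi> \<bullet> z))"
    using p by (intro continuous_intros)
  note ic = set_integrable_compact[OF K(1)]
  \<comment> \<open>Equal lengths and orthogonality of \<xi> and \<tau> make
    \<open>\<xi> + t *\<^sub>R \<tau>\<close> orthogonal to
    \<open>\<tau> - t *\<^sub>R \<xi>\<close>; the reflection in the latter fixes the first factor
    and reverses the second.\<close>
  have z0: "(LINT z:K|lborel. spow p (\<xi> \<bullet> z + t * (\<tau> \<bullet> z)) * (\<tau> \<bullet> z - t * (\<xi> \<bullet> z))) = 0" for t
  proof (rule hreflect_integral_zero[where \<omega> = "\<tau> - t *\<^sub>R \<xi>"])
    show "\<And>z. z \<in> K \<Longrightarrow> hreflect (\<tau> - t *\<^sub>R \<xi>) z \<in> K"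
      by (intro inv subspace_diff V subspace_scale \<tau> \<xi>)
    show "(\<lambda>z. spow p (\<xi> \<bullet> z + t * (\<tau> \<bullet> z)) * (\<tau> \<bullet> z - t * (\<xi> \<bullet> z))) \<in> borel_measurable borel"
      using p by measurable
    fix z
    have 1: "\<xi> \<bullet> w + t * (\<tau> \<bullet> w) = (\<xi> + t *\<^sub>R \<tau>) \<bullet> w" "\<tau> \<bullet> w - t * (\<xi> \<bullet> w) = (\<tau> - t *\<^sub>R \<xi>) \<bullet> w" for w
      by (simp_all add: inner_add_left inner_diff_left)
    have "(\<xi> + t *\<^sub>R \<tau>) \<bullet> (\<tau> - t *\<^sub>R \<xi>) = 0"
      using \<tau> by (simp add: inner_add_left inner_diff_right inner_commute algebra_simps)
    then show "spow p (\<xi> \<bullet> hreflect (\<tau> - t *\<^sub>R \<xi>) z + t * (\<tau> \<bullet> hreflect (\<tau> - t *\<^sub>R \<xi>) z)) *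
        (\<tau> \<bullet> hreflect (\<tau> - t *\<^sub>R \<xi>) z - t * (\<xi> \<bullet> hreflect (\<tau> - t *\<^sub>R \<xi>) z)) =
        - (spow p (\<xi> \<bullet> z + t * (\<tau> \<bullet> z)) * (\<tau> \<bullet> z - t * (\<xi> \<bullet> z)))"
      unfolding 1 by (simp add: inner_hreflect_self inner_hreflect_orthogonal)
  qed simp
  define Q where "Q w t = (LINT z:K|lborel. w z * (spow p (\<xi> \<bullet> z + t * (\<tau> \<bullet> z)) - spow p (\<xi> \<bullet> z)))" for w t
  \<comment> \<open>This is the identity \<open>z0\<close> for t minus that for 0, divided by t. The
    quotient of \<open>Q\<close> with weight \<open>\<xi> \<bullet> z\<close> has a finite limit, so
    its extra factor t removes it as t tends to 0.\<close>
  have eq: "Q (\<lambda>z. \<tau> \<bullet> z) t / t = Q (\<lambda>z. \<xi> \<bullet> z) t / t * t + wint (\<lambda>z. (\<xi> \<bullet> z) * (\<xi> \<bullet> z))" if "0 < t" for t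
  proof -
    have "Q (\<lambda>z. \<tau> \<bullet> z) t - t * Q (\<lambda>z. \<xi> \<bullet> z) t =
        (LINT z:K|lborel. (\<tau> \<bullet> z) * (spow p (\<xi> \<bullet> z + t * (\<tau> \<bullet> z)) - spow p (\<xi> \<bullet> z)) -
          t * ((\<xi> \<bullet> z) * (spow p (\<xi> \<bullet> z + t * (\<tau> \<bullet> z)) - spow p (\<xi> \<bullet> z))))"
      unfolding Q_def
      by (subst set_integral_diff(2)) (auto intro!: ic continuous_intros sc sc0 p)
    also have "\<dots> = (LINT z:K|lborel. spow p (\<xi> \<bullet> z + t * (\<tau> \<bullet> z)) * (\<tau> \<bullet> z - t * (\<xi> \<bullet> z))
         - (spow p (\<xi> \<bullet> z) * (\<tau> \<bullet> z) - t * (spow p (\<xi> \<bullet> z) * (\<xi> \<bullet> z))))"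
      by (simp add: algebra_simps)
    also have "\<dots> = 0 - ((LINT z:K|lborel. spow p (\<xi> \<bullet> z) * (\<tau> \<bullet> z)) - t * (LINT z:K|lborel. spow p (\<xi> \<bullet> z) * (\<xi> \<bullet> z)))"
      unfolding z0[of t, symmetric]
      by (subst set_integral_diff(2), auto intro!: ic continuous_intros sc sc0 p)
        (subst set_integral_diff(2), auto intro!: ic continuous_intros sc sc0 p)
    also have "(LINT z:K|lborel. spow p (\<xi> \<bullet> z) * (\<tau> \<bullet> z)) = 0" using z0[of 0] by simp
    also have "(LINT z:K|lborel. spow p (\<xi> \<bullet> z) * (\<xi> \<bullet> z)) = wint (\<lambda>z. (\<xi> \<bullet> z) * (\<xi> \<bullet> z))"
    proof -
      have "\<bar>a\<bar> powr p = \<bar>a\<bar> powr (p - 2) * (a * a)" for a :: real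
      proof (cases "a = 0")
        case False
        have "\<bar>a\<bar> powr (p - 2 + 2) = \<bar>a\<bar> powr (p - 2) * \<bar>a\<bar> powr 2" by (rule powr_add)
        also have "\<bar>a\<bar> powr 2 = a * a" using False by (simp add: power2_eq_square)
        finally show ?thesis by simp
      qed simp
      then show ?thesis by (simp add: wint_def spow_mult_self)
    qed
    finally have "Q (\<lambda>z. \<tau> \<bullet> z) t = t * Q (\<lambda>z. \<xi> \<bullet> z) t + t * wint (\<lambda>z. (\<xi> \<bullet> z) * (\<xi> \<bullet> z))" by simp
    then show ?thesis using that by (simp add: field_simps)
  qed
  have lim: "((\<lambda>t. Q w t / t) \<longlongrightarrow> (p - 1) * wint (\<lambda>z. w z * (\<tau> \<bullet> z))) (at_right 0)" if "continuous_on K w" for w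
    unfolding Q_def wint_def
    by (rule spow_difference_quotient_limit[OF p \<xi>(2) K(1), where r = "\<lambda>_ z. \<tau> \<bullet> z"])
      (auto intro!: continuous_intros that uniform_limit_const always_eventually)
  have "((\<lambda>t. Q (\<lambda>z. \<xi> \<bullet> z) t / t * t + wint (\<lambda>z. (\<xi> \<bullet> z) * (\<xi> \<bullet> z))) \<longlongrightarrow>
      (p - 1) * wint (\<lambda>z. (\<xi> \<bullet> z) * (\<tau> \<bullet> z)) * 0 + wint (\<lambda>z. (\<xi> \<bullet> z) * (\<xi> \<bullet> z))) (at_right 0)"
    by (intro tendsto_intros lim continuous_intros)
  moreover have "\<forall>\<^sub>F t in at_right 0. Q (\<lambda>z. \<xi> \<bullet> z) t / t * t + wint (\<lambda>z. (\<xi> \<bullet> z) * (\<xi> \<bullet> z)) = Q (\<lambda>z. \<tau> \<bullet> z) t / t"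
    using eq by (auto simp: eventually_at_right_field intro!: exI[of _ 1])
  ultimately have "((\<lambda>t. Q (\<lambda>z. \<tau> \<bullet> z) t / t) \<longlongrightarrow> wint (\<lambda>z. (\<xi> \<bullet> z) * (\<xi> \<bullet> z))) (at_right 0)"
    by (simp add: tendsto_cong)
  moreover have "continuous_on K (\<lambda>z. \<tau> \<bullet> z)" by (intro continuous_intros)
  note lim[OF this]
  ultimately show ?thesis by (auto intro: tendsto_unique[rotated])
qed

text \<open>The value of \<open>wint\<close> on the square of \<open>\<tau> \<bullet> z\<close> for
  a unit \<tau> in \<open>V\<close> orthogonal to \<xi>. It is defined through \<xi>, so that it
  makes sense when \<open>V\<close> is a line.\<close>

definition cross_moment :: real where
  "cross_moment = wint (\<lambda>z. (\<xi> \<bullet> z) * (\<xi> \<bullet> z)) / ((p - 1) * (\<xi> \<bullet> \<xi>))"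

lemma cross_moment_pos: "0 < cross_moment"
proof -
  have "0 < wint (\<lambda>z. (\<xi> \<bullet> z) * (\<xi> \<bullet> z))"
    by (rule wint_pos) (auto intro!: continuous_intros simp: zero_less_mult_iff)
  then show ?thesis using p \<xi> by (simp add: cross_moment_def)
qed

text \<open>Decompose \<open>v\<close> along and across \<xi>. The mixed term vanishes by
  reflection; the parallel part counts p - 1 times, and p - 1 = 1 + (p - 2) separates the Euclidean
  square from the correction.\<close>

lemma wint_square:
  assumes v: "v \<in> V"
  shows "wint (\<lambda>z. (v \<bullet> z) * (v \<bullet> z)) = cross_moment * (v \<bullet> v + (p - 2) * (\<xi> \<bullet> v)\<^sup>2 / (\<xi> \<bullet> \<xi>))"
proof -
  have nz: "\<xi> \<bullet> \<xi> \<noteq> 0" "p - 1 \<noteq> 0" using \<xi> p by auto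
  define a where "a = (\<xi> \<bullet> v) / (\<xi> \<bullet> \<xi>)"
  define \<tau> where "\<tau> = v - a *\<^sub>R \<xi>"
  have \<tau>: "\<tau> \<in> V" "\<tau> \<bullet> \<xi> = 0"
    using v \<xi> V nz by (auto simp: \<tau>_def a_def subspace_diff subspace_scale inner_diff_left inner_commute[of v])
  have vz: "v = \<tau> + a *\<^sub>R \<xi>" by (simp add: \<tau>_def)
  have \<xi>\<xi>: "wint (\<lambda>z. (\<xi> \<bullet> z) * (\<xi> \<bullet> z)) = cross_moment * ((p - 1) * (\<xi> \<bullet> \<xi>))"
    using nz by (simp add: cross_moment_def)
  have \<tau>\<tau>: "wint (\<lambda>z. (\<tau> \<bullet> z) * (\<tau> \<bullet> z)) = cross_moment * (\<tau> \<bullet> \<tau>)"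
  proof (cases "\<tau> = 0")
    case True
    then show ?thesis using wint_mult[of 0 "\<lambda>_. 0"] by simp
  next
    case False
    \<comment> \<open>Rescales \<tau> to the length of \<xi>, as
      \<open>wint_orthogonal_square\<close> compares vectors of equal length.\<close>
    define c where "c = norm \<xi> / norm \<tau>"
    have c: "c * c * (\<tau> \<bullet> \<tau>) = \<xi> \<bullet> \<xi>"
      using False by (simp add: c_def power2_norm_eq_inner[symmetric] power2_eq_square)
    have "c \<noteq> 0" using False \<xi> by (simp add: c_def)
    have "(p - 1) * wint (\<lambda>z. ((c *\<^sub>R \<tau>) \<bullet> z) * ((c *\<^sub>R \<tau>) \<bullet> z)) = wint (\<lambda>z. (\<xi> \<bullet> z) * (\<xi> \<bullet> z))"
      using \<tau> c by (intro wint_orthogonal_square) (auto simp: subspace_scale[OF V] mult.assoc)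
    moreover have "(\<lambda>z. ((c *\<^sub>R \<tau>) \<bullet> z) * ((c *\<^sub>R \<tau>) \<bullet> z)) = (\<lambda>z. c * c * ((\<tau> \<bullet> z) * (\<tau> \<bullet> z)))"
      by (simp add: fun_eq_iff)
    ultimately have "(p - 1) * (c * c * wint (\<lambda>z. (\<tau> \<bullet> z) * (\<tau> \<bullet> z))) = cross_moment * ((p - 1) * (c * c * (\<tau> \<bullet> \<tau>)))"
      by (simp only: wint_mult \<xi>\<xi> c)
    then have "((p - 1) * (c * c)) * wint (\<lambda>z. (\<tau> \<bullet> z) * (\<tau> \<bullet> z)) = ((p - 1) * (c * c)) * (cross_moment * (\<tau> \<bullet> \<tau>))"
      by (simp only: mult_ac)
    then show ?thesis using nz \<open>c \<noteq> 0\<close> by simp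
  qed
  have "(\<lambda>z. (v \<bullet> z) * (v \<bullet> z)) = (\<lambda>z. (\<tau> \<bullet> z) * (\<tau> \<bullet> z) + (2 * a * ((\<xi> \<bullet> z) * (\<tau> \<bullet> z)) + a * a * ((\<xi> \<bullet> z) * (\<xi> \<bullet> z))))"
    by (simp add: vz inner_add_left algebra_simps)
  then have "wint (\<lambda>z. (v \<bullet> z) * (v \<bullet> z)) = cross_moment * (\<tau> \<bullet> \<tau>) + a * a * (cross_moment * ((p - 1) * (\<xi> \<bullet> \<xi>)))"
    by (simp add: wint_add continuous_intros wint_mult \<tau>\<tau> \<xi>\<xi> wint_cross_zero[OF \<tau>])
  also have "\<dots> = cross_moment * ((\<tau> \<bullet> \<tau> + a * a * (\<xi> \<bullet> \<xi>)) + (p - 2) * (a * a * (\<xi> \<bullet> \<xi>)))"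
    by (simp add: algebra_simps)
  also have "\<tau> \<bullet> \<tau> + a * a * (\<xi> \<bullet> \<xi>) = v \<bullet> v"
    using \<tau>(2) by (simp add: vz inner_add_left inner_add_right inner_commute)
  also have "a * a * (\<xi> \<bullet> \<xi>) = (\<xi> \<bullet> v)\<^sup>2 / (\<xi> \<bullet> \<xi>)"
    using nz by (simp add: a_def power2_eq_square)
  finally show ?thesis by simp
qed

text \<open>Polarization of \<open>wint_square\<close>; \<open>alg\<close> is the corresponding
  identity between the right-hand sides.\<close>

lemma wint_product:
  assumes v: "v \<in> V" and w: "w \<in> V"
  shows "wint (\<lambda>z. (v \<bullet> z) * (w \<bullet> z)) = cross_moment * (v \<bullet> w + (p - 2) * (\<xi> \<bullet> v) * (\<xi> \<bullet> w) / (\<xi> \<bullet> \<xi>))"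
proof -
  have "wint (\<lambda>z. ((v + w) \<bullet> z) * ((v + w) \<bullet> z)) =
      wint (\<lambda>z. (v \<bullet> z) * (v \<bullet> z) + (2 * ((v \<bullet> z) * (w \<bullet> z)) + (w \<bullet> z) * (w \<bullet> z)))"
    by (rule arg_cong[where f = wint]) (simp add: fun_eq_iff inner_add_left algebra_simps)
  also have "\<dots> = wint (\<lambda>z. (v \<bullet> z) * (v \<bullet> z)) + (2 * wint (\<lambda>z. (v \<bullet> z) * (w \<bullet> z)) + wint (\<lambda>z. (w \<bullet> z) * (w \<bullet> z)))"
    by (simp only: wint_add continuous_intros wint_mult)
  finally have eq: "2 * wint (\<lambda>z. (v \<bullet> z) * (w \<bullet> z)) = wint (\<lambda>z. ((v + w) \<bullet> z) * ((v + w) \<bullet> z))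
      - wint (\<lambda>z. (v \<bullet> z) * (v \<bullet> z)) - wint (\<lambda>z. (w \<bullet> z) * (w \<bullet> z))" by simp
  have alg: "cross_moment * ((a + 2 * b + c) + (p - 2) * (x + y)\<^sup>2 / s) - cross_moment * (a + (p - 2) * x\<^sup>2 / s) - cross_moment * (c + (p - 2) * y\<^sup>2 / s)
      = 2 * (cross_moment * (b + (p - 2) * x * y / s))" for a b c x y s :: real
  proof -
    have "(p - 2) * (x + y)\<^sup>2 / s = (p - 2) * x\<^sup>2 / s + (p - 2) * y\<^sup>2 / s + 2 * ((p - 2) * x * y / s)"
      by (simp add: power2_sum add_divide_distrib algebra_simps diff_divide_distrib)
    then show ?thesis by (simp only: distrib_left) simp
  qed
  have "(v + w) \<bullet> (v + w) = v \<bullet> v + 2 * (v \<bullet> w) + w \<bullet> w"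
    by (simp add: inner_add_left inner_add_right inner_commute[of w v])
  then show ?thesis
    using eq unfolding wint_square[OF subspace_add[OF V v w]] wint_square[OF v] wint_square[OF w]
      inner_add_right[of \<xi>] by (simp only: alg)
qed

text \<open>Expanding entrywise reduces to products of coordinates: an entry of \<open>H\<close> is
  zero or belongs to two coordinate vectors in \<open>V\<close>. The trace and the form at \<xi>
  combine to the expanded normalized p-Laplacian.\<close>

lemma wint_quadratic:
  fixes H :: "real^'n^'n"
  assumes H: "\<And>i j. H $ i $ j \<noteq> 0 \<Longrightarrow> axis i 1 \<in> V \<and> axis j 1 \<in> V"
    and \<eta>: "\<eta> \<bullet> \<xi> = 0" "\<And>z. z \<in> K \<Longrightarrow> hreflect \<eta> z \<in> K"
  shows "wint (\<lambda>z. \<eta> \<bullet> z + (H *v z) \<bullet> z / 2) =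
    cross_moment / 2 * ((\<Sum>i\<in>UNIV. H $ i $ i) + (p - 2) * ((H *v \<xi>) \<bullet> \<xi>) / (\<xi> \<bullet> \<xi>))"
proof -
  have quad: "(H *v z) \<bullet> w = (\<Sum>i\<in>UNIV. \<Sum>j\<in>UNIV. H $ i $ j * (z $ j * w $ i))" for z w
    by (simp add: inner_vec_def matrix_vector_mult_def sum_distrib_right mult.assoc)
  have ij: "wint (\<lambda>z. H $ i $ j * (z $ j * z $ i)) =
      cross_moment * (H $ i $ j * (if i = j then 1 else 0) + (p - 2) / (\<xi> \<bullet> \<xi>) * (H $ i $ j * (\<xi> $ j * \<xi> $ i)))" for i j
  proof (cases "H $ i $ j = 0")
    case False
    have "(\<lambda>z. z $ j * z $ i) = (\<lambda>z. (axis j 1 \<bullet> z) * (axis i 1 \<bullet> z))"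
      by (simp add: inner_axis' fun_eq_iff)
    moreover have "axis j 1 \<bullet> (axis i 1 :: real^'n) = (if i = j then 1 else 0)"
      by (simp add: inner_axis_axis)
    ultimately show ?thesis
      using wint_product[of "axis j 1" "axis i 1"] H[OF False] unfolding wint_mult
      by (simp add: inner_axis algebra_simps)
  qed (simp add: wint_mult[of 0 "\<lambda>_. 0", simplified])
  have "wint (\<lambda>z. \<eta> \<bullet> z + (H *v z) \<bullet> z / 2) = wint (\<lambda>z. \<eta> \<bullet> z) + wint (\<lambda>z. 1 / 2 * ((H *v z) \<bullet> z))"
    by (subst wint_add[symmetric]) (auto simp: quad intro!: continuous_intros)
  also have "\<dots> = 1 / 2 * wint (\<lambda>z. \<Sum>i\<in>UNIV. \<Sum>j\<in>UNIV. H $ i $ j * (z $ j * z $ i))"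
    unfolding wint_mult[of "1 / 2"] quad using wint_linear_zero[OF \<eta>] by simp
  also have "\<dots> = 1 / 2 * (\<Sum>i\<in>UNIV. \<Sum>j\<in>UNIV. wint (\<lambda>z. H $ i $ j * (z $ j * z $ i)))"
    by (simp add: wint_sum continuous_intros)
  also have "\<dots> = cross_moment / 2 * ((\<Sum>i\<in>UNIV. \<Sum>j\<in>UNIV. H $ i $ j * (if i = j then 1 else 0)) + (p - 2) * ((H *v \<xi>) \<bullet> \<xi>) / (\<xi> \<bullet> \<xi>))"
    unfolding ij quad
    by (simp only: sum.distrib sum_distrib_left[symmetric]) simp
  also have "(\<Sum>i\<in>UNIV. \<Sum>j\<in>UNIV. H $ i $ j * (if i = j then 1 else 0)) = (\<Sum>i\<in>UNIV. H $ i $ i)"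
    by (simp add: if_distrib[where f = "(*) _"] cong: if_cong)
  finally show ?thesis .
qed

lemma wint_one_pos: "0 < wint (\<lambda>_. 1)"
  by (rule wint_pos) auto

end

section \<open>Expansion of the best constant\<close>

context reflection_invariant
begin

text \<open>Since the integral of \<open>spow p (\<xi> \<bullet> z)\<close> vanishes, this is a
  difference quotient in \<epsilon>. Its limit is affine in \<open>a\<close> with zero at
  \<open>wint q / wint (\<lambda>_. 1)\<close>, so its sign tells on which side of that value
  \<open>a\<close> lies.\<close>

lemma spow_integral_sign:
  assumes r: "uniform_limit K r q (at_right 0)" and q: "continuous_on K q"
    and rc: "\<forall>\<^sub>F \<epsilon> in at_right 0. continuous_on K (r \<epsilon>)"
  shows "((\<lambda>\<epsilon>. (LINT z:K|lborel. spow p (\<xi> \<bullet> z + \<epsilon> * (r \<epsilon> z - a))) / \<epsilon>)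
    \<longlongrightarrow> (p - 1) * (wint q - a * wint (\<lambda>_. 1))) (at_right 0)"
proof -
  have sc0: "continuous_on K (\<lambda>z. spow p (\<xi> \<bullet> z))" using p by (intro continuous_intros)
  have "((\<lambda>\<epsilon>. (LINT z:K|lborel. 1 * (spow p (\<xi> \<bullet> z + \<epsilon> * (r \<epsilon> z - a)) - spow p (\<xi> \<bullet> z))) / \<epsilon>)
      \<longlongrightarrow> (p - 1) * wint (\<lambda>z. 1 * (q z - a))) (at_right 0)"
    unfolding wint_def
  proof (rule spow_difference_quotient_limit[OF p \<xi>(2) K(1)])
    show "uniform_limit K (\<lambda>\<epsilon> z. r \<epsilon> z - a) (\<lambda>z. q z - a) (at_right 0)"
      by (intro uniform_limit_intros r)
    show "\<forall>\<^sub>F \<epsilon> in at_right 0. continuous_on K (\<lambda>z. r \<epsilon> z - a)"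
      using rc by eventually_elim (intro continuous_intros)
  qed (intro continuous_intros q)+
  also have "wint (\<lambda>z. 1 * (q z - a)) = wint q - a * wint (\<lambda>_. 1)"
    using wint_add[OF q continuous_on_const[of _ "- a"]] wint_mult[of "- a" "\<lambda>_. 1"] by simp
  finally show ?thesis
  proof (rule Lim_transform_eventually)
    show "\<forall>\<^sub>F \<epsilon> in at_right 0. (LINT z:K|lborel. 1 * (spow p (\<xi> \<bullet> z + \<epsilon> * (r \<epsilon> z - a)) - spow p (\<xi> \<bullet> z))) / \<epsilon>
        = (LINT z:K|lborel. spow p (\<xi> \<bullet> z + \<epsilon> * (r \<epsilon> z - a))) / \<epsilon>"
      using rc
    proof eventually_elim
      case (elim \<epsilon>)
      have "continuous_on K (\<lambda>z. spow p (\<xi> \<bullet> z + \<epsilon> * (r \<epsilon> z - a)))"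
        using p elim by (intro continuous_intros)
      then show ?case
        using spow_integral_zero sc0
        by (simp add: set_integral_diff(2) set_integrable_compact[OF K(1)])
    qed
  qed
qed

text \<open>The trial constants \<open>\<phi>0 + \<epsilon>\<^sup>2 * (c - d)\<close> and
  \<open>\<phi>0 + \<epsilon>\<^sup>2 * (c + d)\<close> give integrals of opposite sign for small
  \<epsilon>, so they enclose the best constant. The Jacobian \<open>J\<close> is positive and
  leaves the signs as they are.\<close>

lemma p_mean_expansion:
  fixes S :: "real \<Rightarrow> 'a::euclidean_space set" and \<phi> :: "'a \<Rightarrow> real"
  assumes r: "uniform_limit K r q (at_right 0)" and q: "continuous_on K q"
    and S: "\<forall>\<^sub>F \<epsilon> in at_right 0. compact (S \<epsilon>) \<and> emeasure lborel (S \<epsilon>) \<noteq> 0 \<and> continuous_on (S \<epsilon>) \<phi> \<and>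
      continuous_on K (r \<epsilon>) \<and>
      (\<exists>J>0. \<forall>a. (LINT y:S \<epsilon>|lborel. spow p (\<phi> y - a)) =
        J * (LINT z:K|lborel. spow p (\<phi>0 + \<epsilon> * (\<xi> \<bullet> z + \<epsilon> * r \<epsilon> z) - a)))"
  shows "((\<lambda>\<epsilon>. (\<phi>0 - best_const (ereal p) (S \<epsilon>) \<phi>) / \<epsilon>\<^sup>2)
    \<longlongrightarrow> - (wint q / wint (\<lambda>_. 1))) (at_right 0)"
proof (rule tendstoI)
  fix e :: real assume "0 < e"
  define d where "d = e / 2"
  have d: "0 < d" using \<open>0 < e\<close> by (simp add: d_def)
  define c where "c = wint q / wint (\<lambda>_. 1)"
  have rc: "\<forall>\<^sub>F \<epsilon> in at_right 0. continuous_on K (r \<epsilon>)" using S by eventually_elim auto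
  have w: "wint q - a * wint (\<lambda>_. 1) = (c - a) * wint (\<lambda>_. 1)" for a
    using wint_one_pos by (simp add: c_def field_simps)
  note sgn = spow_integral_sign[OF r q rc, unfolded w]
  have "(p - 1) * ((c - (c + d)) * wint (\<lambda>_. 1)) < 0"
    using p d wint_one_pos by (simp add: mult_pos_pos)
  from order_tendstoD(2)[OF sgn this]
  have neg: "\<forall>\<^sub>F \<epsilon> in at_right 0. (LINT z:K|lborel. spow p (\<xi> \<bullet> z + \<epsilon> * (r \<epsilon> z - (c + d)))) / \<epsilon> < 0" .
  have "0 < (p - 1) * ((c - (c - d)) * wint (\<lambda>_. 1))"
    using p d wint_one_pos by (simp add: mult_pos_pos)
  from order_tendstoD(1)[OF sgn this]
  have pos: "\<forall>\<^sub>F \<epsilon> in at_right 0. 0 < (LINT z:K|lborel. spow p (\<xi> \<bullet> z + \<epsilon> * (r \<epsilon> z - (c - d)))) / \<epsilon>" .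
  have "\<forall>\<^sub>F \<epsilon> in at_right 0. (0::real) < \<epsilon>" by (auto simp: eventually_at_right_field intro: exI[of _ 1])
  with neg pos S
  show "\<forall>\<^sub>F \<epsilon> in at_right 0. dist ((\<phi>0 - best_const (ereal p) (S \<epsilon>) \<phi>) / \<epsilon>\<^sup>2)
      (- (wint q / wint (\<lambda>_. 1))) < e"
  proof eventually_elim
    case (elim \<epsilon>)
    then obtain J where J: "0 < J" "\<And>a. (LINT y:S \<epsilon>|lborel. spow p (\<phi> y - a)) =
        J * (LINT z:K|lborel. spow p (\<phi>0 + \<epsilon> * (\<xi> \<bullet> z + \<epsilon> * r \<epsilon> z) - a))" by blast
    \<comment> \<open>Once the trial constant is subtracted, every argument is a multiple of
      \<epsilon>, and homogeneity of \<open>spow p\<close> extracts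
      \<open>\<epsilon> powr (p - 1)\<close>.\<close>
    have tr: "(LINT y:S \<epsilon>|lborel. spow p (\<phi> y - (\<phi>0 + \<epsilon>\<^sup>2 * a))) =
        J * (\<epsilon> powr (p - 1) * (LINT z:K|lborel. spow p (\<xi> \<bullet> z + \<epsilon> * (r \<epsilon> z - a))))" for a
    proof -
      have "\<phi>0 + \<epsilon> * (\<xi> \<bullet> z + \<epsilon> * r \<epsilon> z) - (\<phi>0 + \<epsilon>\<^sup>2 * a) = \<epsilon> * (\<xi> \<bullet> z + \<epsilon> * (r \<epsilon> z - a))" for z
        by (simp add: algebra_simps power2_eq_square)
      then show ?thesis unfolding J by (simp add: spow_mult elim)
    qed
    define \<mu> where "\<mu> = best_const (ereal p) (S \<epsilon>) \<phi>"
    have "\<mu> \<in> {\<phi>0 + \<epsilon>\<^sup>2 * (c - d)..\<phi>0 + \<epsilon>\<^sup>2 * (c + d)}"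
      unfolding \<mu>_def
    proof (rule Lp_minimizer_bracket[OF p])
      show "0 \<le> (LINT y:S \<epsilon>|lborel. spow p (\<phi> y - (\<phi>0 + \<epsilon>\<^sup>2 * (c - d))))"
        unfolding tr using elim J(1) by (simp add: zero_less_divide_iff)
      show "(LINT y:S \<epsilon>|lborel. spow p (\<phi> y - (\<phi>0 + \<epsilon>\<^sup>2 * (c + d)))) \<le> 0"
        unfolding tr using elim J(1) by (simp add: divide_less_0_iff mult_nonneg_nonpos)
      show "\<phi>0 + \<epsilon>\<^sup>2 * (c - d) \<le> \<phi>0 + \<epsilon>\<^sup>2 * (c + d)" using d by (simp add: mult_left_mono)
    qed (use elim in auto)
    then have "\<bar>\<phi>0 - \<mu> + \<epsilon>\<^sup>2 * c\<bar> \<le> \<epsilon>\<^sup>2 * d" by (auto simp: algebra_simps abs_le_iff)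
    then have "\<bar>(\<phi>0 - \<mu> + \<epsilon>\<^sup>2 * c) / \<epsilon>\<^sup>2\<bar> \<le> d"
      using elim by (simp add: divide_le_eq mult.commute)
    moreover have "(\<phi>0 - \<mu> + \<epsilon>\<^sup>2 * c) / \<epsilon>\<^sup>2 = (\<phi>0 - \<mu>) / \<epsilon>\<^sup>2 + c" using elim by (simp add: add_divide_distrib)
    ultimately show ?case using d unfolding \<mu>_def[symmetric] c_def[symmetric] by (simp add: dist_real_def d_def)
  qed
qed

end

text \<open>\<open>S\<close> lies in the closure of its open subset \<open>U\<close>, so every
  nonempty relatively open part of \<open>S\<close> contains a nonempty open set and has positive
  measure. The essential supremum of a continuous function is then its maximum, which
  \<open>\<bar>f y - c\<bar>\<close> attains at an extremum of \<open>f\<close>.\<close>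

lemma Linf_norm_eq:
  fixes f :: "'a::euclidean_space \<Rightarrow> real"
  assumes S: "compact S" "S \<subseteq> closure U" "open U" "U \<subseteq> S" and f: "continuous_on S f"
    and M: "a \<in> S" "\<And>y. y \<in> S \<Longrightarrow> f y \<le> f a" and m: "b \<in> S" "\<And>y. y \<in> S \<Longrightarrow> f b \<le> f y"
  shows "Lp_norm \<infinity> S (\<lambda>y. f y - c) = max (f a - c) (c - f b)"
proof -
  define g where "g y = \<bar>f y - c\<bar>" for y
  define X where "X = max (f a - c) (c - f b)"
  have SL: "S \<in> sets lebesgue" using fmeasurableD[OF lmeasurable_compact[OF S(1)]] .
  have gc: "continuous_on S g" unfolding g_def by (intro continuous_intros f)
  have gm: "g \<in> borel_measurable (lebesgue_on S)"
    using gc SL by (rule continuous_imp_measurable_on_sets_lebesgue)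
  then have gm': "(\<lambda>y. ereal (g y)) \<in> borel_measurable (lebesgue_on S)" by simp
  have gX: "g y \<le> X" if "y \<in> S" for y
    using M(2)[OF that] m(2)[OF that] by (auto simp: g_def X_def)
  have le: "esssup (lebesgue_on S) (\<lambda>y. ereal (g y)) \<le> ereal X"
    using gX by (intro esssup_I gm') (auto intro!: AE_I2)
  have ge: "ereal X \<le> esssup (lebesgue_on S) (\<lambda>y. ereal (g y))"
  proof (rule ccontr)
    assume "\<not> ereal X \<le> esssup (lebesgue_on S) (\<lambda>y. ereal (g y))"
    then obtain t where t: "esssup (lebesgue_on S) (\<lambda>y. ereal (g y)) < ereal t" "t < X"
      by (metis ereal_dense2 not_le less_ereal.simps(1))
    obtain s where s: "s \<in> S" "t < g s"
      using t(2) M(1) m(1) by (auto simp: X_def g_def max_def split: if_splits)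
    obtain W where W: "open W" "W \<inter> S = g -` {t<..} \<inter> S"
      using continuous_on_open_invariant[of S g] gc open_greaterThan by (metis)
    have "s \<in> W" using s W(2) by auto
    then have "W \<inter> U \<noteq> {}"
      using s(1) S(2) open_Int_closure_eq_empty[OF W(1), of U] by auto
    moreover have "W \<inter> U \<in> null_sets lebesgue"
    proof -
      have "AE y in lebesgue_on S. ereal (g y) \<le> esssup (lebesgue_on S) (\<lambda>y. ereal (g y))"
        by (rule esssup_AE)
      then have "AE y in lebesgue_on S. y \<notin> W \<inter> U"
      proof eventually_elim
        case (elim y)
        then have "g y < t" using t(1) order_le_less_trans by fastforce
        show ?case
        proof
          assume "y \<in> W \<inter> U"
          then have "y \<in> g -` {t<..} \<inter> S" using W(2) S(4) by blast
          then show False using \<open>g y < t\<close> by simp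
        qed
      qed
      then have "AE y in lebesgue. y \<in> S \<longrightarrow> y \<notin> W \<inter> U"
        using SL by (simp add: AE_restrict_space_iff)
      then have "AE y in lebesgue. y \<notin> W \<inter> U" using S(4) by (auto elim!: eventually_mono)
      then show ?thesis using W(1) S(3) 
        by (subst (asm) AE_iff_null_sets[symmetric]) (auto intro: lebesgue_openin borel_open)
    qed
    then have "negligible (W \<inter> U)" by (simp add: negligible_iff_null_sets)
    ultimately show False using open_not_negligible[of "W \<inter> U"] W(1) S(3) by auto
  qed
  from le ge have "esssup (lebesgue_on S) (\<lambda>y. ereal (g y)) = ereal X" by (rule antisym)
  then show ?thesis by (simp add: Lp_norm_def g_def X_def max_def)
qed

text \<open>The norm is the maximum of a decreasing and an increasing affine function of the
  constant; they meet at the midrange only.\<close>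

lemma Linf_minimizer:
  fixes f :: "'a::euclidean_space \<Rightarrow> real"
  assumes "compact S" "S \<subseteq> closure U" "open U" "U \<subseteq> S" "continuous_on S f"
    and "a \<in> S" "\<And>y. y \<in> S \<Longrightarrow> f y \<le> f a" "b \<in> S" "\<And>y. y \<in> S \<Longrightarrow> f b \<le> f y"
  shows "best_const \<infinity> S f = (f a + f b) / 2"
proof -
  have eq: "Lp_norm \<infinity> S (\<lambda>y. f y - c) = max (f a - c) (c - f b)" for c
    by (rule Linf_norm_eq[OF assms(1-5)]) (use assms in auto)
  show ?thesis unfolding best_const_def
  proof (rule the_equality)
    fix \<mu> assume "\<forall>c. Lp_norm \<infinity> S (\<lambda>y. f y - \<mu>) \<le> Lp_norm \<infinity> S (\<lambda>y. f y - c)"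
    from this[rule_format, of "(f a + f b) / 2"] show "\<mu> = (f a + f b) / 2"
      unfolding eq by (auto simp: max_def field_simps split: if_splits)
  next
    show "\<forall>c. Lp_norm \<infinity> S (\<lambda>y. f y - (f a + f b) / 2) \<le> Lp_norm \<infinity> S (\<lambda>y. f y - c)"
      unfolding eq by (auto simp: max_def field_simps)
  qed
qed

text \<open>Away from a neighbourhood \<open>W\<close> of \<nu>, compactness makes \<open>l\<close>
  fall short of its maximum by a fixed \<gamma>, which outweighs a perturbation of order \<epsilon>.
  Inside \<open>W\<close>, \<open>l\<close> is at most \<open>l \<nu>\<close> and \<open>q\<close>
  stays below \<open>q \<nu> + d / 2\<close>.\<close>

lemma perturbed_maximum:
  fixes l :: "'a::metric_space \<Rightarrow> real"
  assumes K: "compact K" and r: "uniform_limit K r q (at_right 0)" and q: "continuous_on K q"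
    and l: "continuous_on K l" and \<nu>: "\<nu> \<in> K" "\<And>z. z \<in> K \<Longrightarrow> z \<noteq> \<nu> \<Longrightarrow> l z < l \<nu>" and d: "0 < d"
  shows "\<forall>\<^sub>F \<epsilon> in at_right 0. (\<forall>z\<in>K. l z + \<epsilon> * r \<epsilon> z \<le> l \<nu> + \<epsilon> * (q \<nu> + d)) \<and>
    l \<nu> + \<epsilon> * (q \<nu> - d) \<le> l \<nu> + \<epsilon> * r \<epsilon> \<nu>"
proof -
  obtain Q where Q: "\<And>z. z \<in> K \<Longrightarrow> \<bar>q z\<bar> \<le> Q"
    using compact_imp_bounded[OF compact_continuous_image[OF q K]] by (auto simp: bounded_iff)
  obtain W where W: "open W" "W \<inter> K = q -` {..<q \<nu> + d / 2} \<inter> K"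
    using q open_lessThan unfolding continuous_on_open_invariant by metis
  have \<nu>W: "\<nu> \<in> W" using W(2) \<nu>(1) d by auto
  have "\<exists>\<gamma>>0. \<forall>z\<in>K - W. l z \<le> l \<nu> - \<gamma>"
  proof (cases "K - W = {}")
    case False
    have "compact (K - W)" using K W(1) by (rule compact_diff)
    then obtain y where y: "y \<in> K - W" "\<And>z. z \<in> K - W \<Longrightarrow> l z \<le> l y"
      using continuous_attains_sup[of "K - W" l] False continuous_on_subset[OF l] by blast
    then have "l y < l \<nu>" using \<nu>W by (intro \<nu>(2)) auto
    then show ?thesis using y(2) by (intro exI[of _ "l \<nu> - l y"]) auto
  qed (auto intro: exI[of _ 1])
  then obtain \<gamma> where \<gamma>: "0 < \<gamma>" "\<And>z. z \<in> K - W \<Longrightarrow> l z \<le> l \<nu> - \<gamma>" by blast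
  have "\<forall>\<^sub>F \<epsilon> in at_right 0. \<forall>z\<in>K. dist (r \<epsilon> z) (q z) < d / 2"
    using uniform_limitD[OF r, of "d / 2"] d by simp
  moreover have "\<forall>\<^sub>F \<epsilon> in at_right 0. 0 < \<epsilon> \<and> \<epsilon> * (2 * \<bar>Q\<bar> + 1) < \<gamma>"
  proof -
    have "((\<lambda>\<epsilon>. \<epsilon> * (2 * \<bar>Q\<bar> + 1)) \<longlongrightarrow> 0 * (2 * \<bar>Q\<bar> + 1)) (at_right 0)"
      by (intro tendsto_intros)
    then have "\<forall>\<^sub>F \<epsilon> in at_right 0. \<epsilon> * (2 * \<bar>Q\<bar> + 1) < \<gamma>"
      using \<gamma>(1) by (intro order_tendstoD(2)) auto
    moreover have "\<forall>\<^sub>F \<epsilon> in at_right 0. (0::real) < \<epsilon>" by (auto simp: eventually_at_right_field intro: exI[of _ 1])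
    ultimately show ?thesis by eventually_elim auto
  qed
  ultimately show ?thesis
  proof eventually_elim
    case (elim \<epsilon>)
    have "l z + \<epsilon> * r \<epsilon> z \<le> l \<nu> + \<epsilon> * (q \<nu> + d)" if z: "z \<in> K" for z
    proof (cases "z \<in> W")
      case True
      then have "q z < q \<nu> + d / 2" using W(2) z by auto
      moreover have "dist (r \<epsilon> z) (q z) < d / 2" using elim z by blast
      then have "r \<epsilon> z < q z + d / 2" unfolding dist_real_def by linarith
      ultimately have "\<epsilon> * r \<epsilon> z \<le> \<epsilon> * (q \<nu> + d)" using elim by (intro mult_left_mono) auto
      moreover have "l z \<le> l \<nu>" using \<nu>(2)[OF z] by (cases "z = \<nu>") auto
      ultimately show ?thesis by simp
    next
      case False
      have "dist (r \<epsilon> z) (q z) < d / 2" using elim z by blast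
      then have "r \<epsilon> z < q z + d / 2" unfolding dist_real_def by linarith
      then have "r \<epsilon> z - (q \<nu> + d) \<le> 2 * \<bar>Q\<bar> + 1" using Q[OF z] Q[OF \<nu>(1)] d by linarith
      then have "\<epsilon> * (r \<epsilon> z - (q \<nu> + d)) \<le> \<epsilon> * (2 * \<bar>Q\<bar> + 1)" using elim by (intro mult_left_mono) auto
      then have "\<epsilon> * (r \<epsilon> z - (q \<nu> + d)) < \<gamma>" using elim by linarith
      then show ?thesis using \<gamma>(2)[of z] z False by (simp add: algebra_simps)
    qed
    moreover have "\<epsilon> * (q \<nu> - d) \<le> \<epsilon> * r \<epsilon> \<nu>"
    proof (intro mult_left_mono)
      have "dist (r \<epsilon> \<nu>) (q \<nu>) < d / 2" using elim \<nu>(1) by blast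
      then show "q \<nu> - d \<le> r \<epsilon> \<nu>" using d unfolding dist_real_def by linarith
    qed (use elim in auto)
    ultimately show ?case by simp
  qed
qed

text \<open>The best constant is the midrange. The extreme values are controlled through \<nu> and
  \<nu>' up to a small multiple of \<epsilon> squared; by \<open>sym\<close> their first-order terms
  cancel, and the mean of \<open>q\<close> at the two points remains.\<close>

lemma infinity_mean_expansion:
  fixes S :: "real \<Rightarrow> 'a::euclidean_space set" and \<phi> :: "'a \<Rightarrow> real" and T :: "real \<Rightarrow> 'b::metric_space \<Rightarrow> 'a"
  assumes K: "compact K" and r: "uniform_limit K r q (at_right 0)" and q: "continuous_on K q"
    and l: "continuous_on K l"
    and \<nu>: "\<nu> \<in> K" "\<And>z. z \<in> K \<Longrightarrow> z \<noteq> \<nu> \<Longrightarrow> l z < l \<nu>"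
    and \<nu>': "\<nu>' \<in> K" "\<And>z. z \<in> K \<Longrightarrow> z \<noteq> \<nu>' \<Longrightarrow> l \<nu>' < l z" and sym: "l \<nu>' = - l \<nu>"
    and S: "\<forall>\<^sub>F \<epsilon> in at_right 0. compact (S \<epsilon>) \<and> continuous_on (S \<epsilon>) \<phi> \<and> S \<epsilon> = T \<epsilon> ` K \<and>
      (\<exists>U. open U \<and> U \<subseteq> S \<epsilon> \<and> S \<epsilon> \<subseteq> closure U) \<and>
      (\<forall>z\<in>K. \<phi> (T \<epsilon> z) = \<phi>0 + \<epsilon> * (l z + \<epsilon> * r \<epsilon> z))"
  shows "((\<lambda>\<epsilon>. (\<phi>0 - best_const \<infinity> (S \<epsilon>) \<phi>) / \<epsilon>\<^sup>2)
    \<longlongrightarrow> - ((q \<nu> + q \<nu>') / 2)) (at_right 0)"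
proof (rule tendstoI)
  fix e :: real assume "0 < e"
  define d where "d = e / 2"
  have d: "0 < d" using \<open>0 < e\<close> by (simp add: d_def)
  have max: "\<forall>\<^sub>F \<epsilon> in at_right 0. (\<forall>z\<in>K. l z + \<epsilon> * r \<epsilon> z \<le> l \<nu> + \<epsilon> * (q \<nu> + d)) \<and>
    l \<nu> + \<epsilon> * (q \<nu> - d) \<le> l \<nu> + \<epsilon> * r \<epsilon> \<nu>"
    using \<nu> by (intro perturbed_maximum[OF K] q l d r) auto
  \<comment> \<open>A minimum is a maximum of the negated data, so \<open>perturbed_maximum\<close>
    applies again.\<close>
  have "\<forall>\<^sub>F \<epsilon> in at_right 0. (\<forall>z\<in>K. - l z + \<epsilon> * - r \<epsilon> z \<le> - l \<nu>' + \<epsilon> * (- q \<nu>' + d)) \<and>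
    - l \<nu>' + \<epsilon> * (- q \<nu>' - d) \<le> - l \<nu>' + \<epsilon> * - r \<epsilon> \<nu>'"
    using \<nu>' by (intro perturbed_maximum[OF K] continuous_on_minus q l d uniform_limit_uminus r) auto
  note min = this
  have "\<forall>\<^sub>F \<epsilon> in at_right 0. (0::real) < \<epsilon>" by (auto simp: eventually_at_right_field intro: exI[of _ 1])
  with max min S
  show "\<forall>\<^sub>F \<epsilon> in at_right 0. dist ((\<phi>0 - best_const \<infinity> (S \<epsilon>) \<phi>) / \<epsilon>\<^sup>2)
      (- ((q \<nu> + q \<nu>') / 2)) < e"
  proof eventually_elim
    case (elim \<epsilon>)
    then obtain U where U: "open U" "U \<subseteq> S \<epsilon>" "S \<epsilon> \<subseteq> closure U" by blast
    have SK: "S \<epsilon> = T \<epsilon> ` K" and \<epsilon>: "0 < \<epsilon>" using elim by auto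
    have val: "\<phi> (T \<epsilon> z) = \<phi>0 + \<epsilon> * (l z + \<epsilon> * r \<epsilon> z)" if "z \<in> K" for z using elim that by blast
    have ne: "S \<epsilon> \<noteq> {}" using SK \<nu>(1) by auto
    have cS: "compact (S \<epsilon>)" and c\<phi>: "continuous_on (S \<epsilon>) \<phi>" using elim by auto
    obtain a where a: "a \<in> S \<epsilon>" "\<And>y. y \<in> S \<epsilon> \<Longrightarrow> \<phi> y \<le> \<phi> a"
      using continuous_attains_sup[OF cS ne c\<phi>] by blast
    obtain b where b: "b \<in> S \<epsilon>" "\<And>y. y \<in> S \<epsilon> \<Longrightarrow> \<phi> b \<le> \<phi> y"
      using continuous_attains_inf[OF cS ne c\<phi>] by blast
    define \<mu> where "\<mu> = best_const \<infinity> (S \<epsilon>) \<phi>"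
    have \<mu>: "\<mu> = (\<phi> a + \<phi> b) / 2"
      unfolding \<mu>_def by (rule Linf_minimizer[OF cS U(3) U(1,2) c\<phi> a b])
    obtain za zb where za: "za \<in> K" "a = T \<epsilon> za" and zb: "zb \<in> K" "b = T \<epsilon> zb" using a b SK by auto
    have a1: "\<phi> a \<le> \<phi>0 + \<epsilon> * (l \<nu> + \<epsilon> * (q \<nu> + d))"
      unfolding za val[OF za(1)] using elim za(1) \<epsilon> by simp
    have "\<phi> (T \<epsilon> \<nu>) \<le> \<phi> a" using SK \<nu>(1) by (intro a) auto
    moreover have "\<epsilon> * (l \<nu> + \<epsilon> * (q \<nu> - d)) \<le> \<epsilon> * (l \<nu> + \<epsilon> * r \<epsilon> \<nu>)"
      using elim by (intro mult_left_mono) auto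
    ultimately have a2: "\<phi>0 + \<epsilon> * (l \<nu> + \<epsilon> * (q \<nu> - d)) \<le> \<phi> a"
      unfolding val[OF \<nu>(1)] by linarith
    have "\<epsilon> * (l \<nu>' + \<epsilon> * (q \<nu>' - d)) \<le> \<epsilon> * (l zb + \<epsilon> * r \<epsilon> zb)"
    proof (intro mult_left_mono)
      have "- l zb + \<epsilon> * - r \<epsilon> zb \<le> - l \<nu>' + \<epsilon> * (- q \<nu>' + d)" using elim zb(1) by blast
      then show "l \<nu>' + \<epsilon> * (q \<nu>' - d) \<le> l zb + \<epsilon> * r \<epsilon> zb" by (simp add: algebra_simps)
    qed (use \<epsilon> in simp)
    then have b1: "\<phi>0 + \<epsilon> * (l \<nu>' + \<epsilon> * (q \<nu>' - d)) \<le> \<phi> b"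
      unfolding zb val[OF zb(1)] by simp
    have "\<epsilon> * (l \<nu>' + \<epsilon> * r \<epsilon> \<nu>') \<le> \<epsilon> * (l \<nu>' + \<epsilon> * (q \<nu>' + d))"
    proof (intro mult_left_mono)
      have "- l \<nu>' + \<epsilon> * (- q \<nu>' - d) \<le> - l \<nu>' + \<epsilon> * - r \<epsilon> \<nu>'" using elim by blast
      then show "l \<nu>' + \<epsilon> * r \<epsilon> \<nu>' \<le> l \<nu>' + \<epsilon> * (q \<nu>' + d)" by (simp add: algebra_simps)
    qed (use \<epsilon> in simp)
    moreover have "\<phi> b \<le> \<phi> (T \<epsilon> \<nu>')" using SK \<nu>'(1) by (intro b) auto
    ultimately have b2: "\<phi> b \<le> \<phi>0 + \<epsilon> * (l \<nu>' + \<epsilon> * (q \<nu>' + d))"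
      unfolding val[OF \<nu>'(1)] by linarith
    have "\<bar>\<phi>0 - \<mu> + \<epsilon>\<^sup>2 * ((q \<nu> + q \<nu>') / 2)\<bar> \<le> \<epsilon>\<^sup>2 * d"
    proof -
      have "\<phi> a + \<phi> b \<le> 2 * \<phi>0 + \<epsilon>\<^sup>2 * (q \<nu> + q \<nu>') + 2 * (\<epsilon>\<^sup>2 * d)"
        using a1 b2 unfolding sym by (simp add: algebra_simps power2_eq_square)
      moreover have "2 * \<phi>0 + \<epsilon>\<^sup>2 * (q \<nu> + q \<nu>') - 2 * (\<epsilon>\<^sup>2 * d) \<le> \<phi> a + \<phi> b"
        using a2 b1 unfolding sym by (simp add: algebra_simps power2_eq_square)
      moreover have "\<bar>f - u / 2 + X / 2\<bar> \<le> D" if "u \<le> 2 * f + X + 2 * D" "2 * f + X - 2 * D \<le> u" for f u X D :: real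
        using that by linarith
      ultimately show ?thesis unfolding \<mu> times_divide_eq_right by blast
    qed
    then have "\<bar>(\<phi>0 - \<mu> + \<epsilon>\<^sup>2 * ((q \<nu> + q \<nu>') / 2)) / \<epsilon>\<^sup>2\<bar> \<le> d"
      using \<epsilon> by (simp add: divide_le_eq mult.commute)
    moreover have "(\<phi>0 - \<mu> + \<epsilon>\<^sup>2 * ((q \<nu> + q \<nu>') / 2)) / \<epsilon>\<^sup>2 = (\<phi>0 - \<mu>) / \<epsilon>\<^sup>2 + (q \<nu> + q \<nu>') / 2"
      using \<epsilon> by (simp only: add_divide_distrib) simp
    ultimately have "\<bar>(\<phi>0 - \<mu>) / \<epsilon>\<^sup>2 + (q \<nu> + q \<nu>') / 2\<bar> \<le> d" by (simp only:)
    then show ?case using d unfolding \<mu>_def[symmetric] by (simp add: dist_real_def d_def)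
  qed
qed

section \<open>The Baker--Campbell--Hausdorff product\<close>

text \<open>Each pair adds at least 1 to the total, which bounds both length and entries. Finiteness
  matters because a sum over an infinite set is 0 by convention.\<close>

lemma finite_bch_exponents: "finite (bch_exponents k)"
proof (rule finite_subset)
  show "bch_exponents k \<subseteq> {rs. set rs \<subseteq> {..k} \<times> {..k} \<and> length rs \<le> k}"
  proof
    fix rs :: "(nat \<times> nat) list" assume "rs \<in> bch_exponents k"
    then have pos: "\<forall>(r, s) \<in> set rs. 0 < r + s" and le: "(\<Sum>(r, s)\<leftarrow>rs. r + s) \<le> k"
      by (auto simp: bch_exponents_def)
    have "length rs \<le> (\<Sum>(r, s)\<leftarrow>rs. r + s)"
      using pos by (induction rs) (auto simp: Suc_le_eq add_mono)
    moreover have "r + s \<le> (\<Sum>(r, s)\<leftarrow>rs. r + s)" if "(r, s) \<in> set rs" for r s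
      using member_le_sum_list[of "r + s" "map (\<lambda>(r, s). r + s) rs"] that by force
    ultimately show "rs \<in> {rs. set rs \<subseteq> {..k} \<times> {..k} \<and> length rs \<le> k}"
      using le by fastforce
  qed
qed (intro finite_lists_length_le finite_cartesian_product finite_atMost)

definition bch_coeff :: "(nat \<times> nat) list \<Rightarrow> real" where
  "bch_coeff rs = (-1) ^ (length rs + 1) /
    (real (length rs) * real (\<Sum>(r, s)\<leftarrow>rs. r + s) * (\<Prod>(r, s)\<leftarrow>rs. fact r * fact s))"

definition bch_word :: "'a \<Rightarrow> 'a \<Rightarrow> (nat \<times> nat) list \<Rightarrow> 'a list" where
  "bch_word x y rs = concat (map (\<lambda>(r, s). replicate r x @ replicate s y) rs)"

lemma bch_eq: "bch k br x y = (\<Sum>rs\<in>bch_exponents k. bch_coeff rs *\<^sub>R iter_br br (bch_word x y rs))"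
  by (simp add: bch_def bch_coeff_def bch_word_def)

lemma length_bch_word: "length (bch_word x y rs) = (\<Sum>(r, s)\<leftarrow>rs. r + s)"
proof (induction rs)
  case (Cons a rs)
  then show ?case
    by (cases a) (simp only: bch_word_def list.map concat.simps length_append length_replicate sum_list.Cons prod.case)
qed (simp add: bch_word_def)

lemma set_bch_word: "set (bch_word x y rs) \<subseteq> {x, y}"
proof (induction rs)
  case (Cons a rs)
  then show ?case by (cases a) (auto simp: bch_word_def simp del: set_concat)
qed (simp add: bch_word_def)

lemma list_all2_bch_word:
  "R x x' \<Longrightarrow> R y y' \<Longrightarrow> list_all2 R (bch_word x y rs) (bch_word x' y' rs)"
proof (induction rs)
  case (Cons a rs)
  have "list_all2 R (replicate n u @ replicate m v) (replicate n u' @ replicate m v')"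
    if "R u u'" "R v v'" for n m u u' v v'
    using that by (intro list_all2_appendI) (auto simp: list_all2_conv_all_nth)
  note this[OF Cons.prems]
  moreover have "list_all2 R (bch_word x y rs) (bch_word x' y' rs)" using Cons by blast
  ultimately show ?case
    by (cases a) (simp add: bch_word_def list_all2_appendI del: append_assoc)
qed (simp add: bch_word_def)

text \<open>Only \<open>[(1, 0)]\<close> and \<open>[(0, 1)]\<close> have total 1, each with
  coefficient 1; every further word has at least two letters and so contains a bracket.\<close>

lemma bch_split:
  fixes x y :: "'a::real_vector"
  assumes "1 \<le> k"
  shows "bch k br x y = x + y +
    (\<Sum>rs\<in>{rs \<in> bch_exponents k. 2 \<le> (\<Sum>(r, s)\<leftarrow>rs. r + s)}. bch_coeff rs *\<^sub>R iter_br br (bch_word x y rs))"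
proof -
  let ?f = "\<lambda>rs. bch_coeff rs *\<^sub>R iter_br br (bch_word x y rs)"
  let ?B = "{rs \<in> bch_exponents k. 2 \<le> (\<Sum>(r, s)\<leftarrow>rs. r + s)}"
  have "rs \<in> {[(1, 0)], [(0, 1)]}" if "rs \<in> bch_exponents k" "\<not> 2 \<le> (\<Sum>(r, s)\<leftarrow>rs. r + s)" for rs
  proof -
    from that obtain r s rs' where rs: "rs = (r, s) # rs'" "0 < r + s"
      by (cases rs) (auto simp: bch_exponents_def)
    have "rs' = []"
      using that rs by (cases rs') (auto simp: bch_exponents_def)
    then show ?thesis using rs that by (auto simp: bch_exponents_def) 
  qed
  then have "bch_exponents k = {[(1, 0)], [(0, 1)]} \<union> ?B"
    using assms by (auto simp: bch_exponents_def)
  moreover have "sum ?f ({[(1, 0)], [(0, 1)]} \<union> ?B) = sum ?f {[(1, 0)], [(0, 1)]} + sum ?f ?B"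
    by (rule sum.union_disjoint) (auto intro: finite_subset[OF _ finite_bch_exponents[of k]])
  ultimately show ?thesis
    by (simp add: bch_eq) (simp add: bch_coeff_def bch_word_def)
qed

section \<open>The filtration of the Lie algebra by degree\<close>

context stratified_lie_algebra
begin

sublocale br: bounded_bilinear br
  using bilinear_br by (simp add: bilinear_conv_bounded_bilinear)

lemma br_antisym: "br x y = - br y x"
proof -
  have "br (x + y) (x + y) = 0" by (rule br_self)
  from this[unfolded br.add_left br.add_right] have "br x y + br y x = 0" by (simp add: br_self add.commute)
  then show ?thesis by (simp add: eq_neg_iff_add_eq_0)
qed

lemma k_pos: "1 \<le> k"
  using deg_range by (metis atLeastAtMost_iff le_trans)

text \<open>The sum of the layers from \<open>d\<close> on. Brackets of general layers are located
  in this filtration rather than in a single layer: that a bracket raises the degree is what the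
  determinant of a left translation rests on.\<close>

definition tail :: "nat \<Rightarrow> (real ^ 'n) set" where
  "tail d = {x. \<forall>i. x $ i \<noteq> 0 \<longrightarrow> d \<le> deg i}"

lemma subspace_layer: "subspace (layer deg j)"
  by (auto simp: subspace_def layer_def) (metis add.right_neutral)+

lemma subspace_tail: "subspace (tail d)"
  by (auto simp: subspace_def tail_def) (metis add.right_neutral)+

lemma tail_mono: "d \<le> e \<Longrightarrow> tail e \<subseteq> tail d"
  by (auto simp: tail_def)

lemma layer_subset_tail: "layer deg j \<subseteq> tail j"
  by (auto simp: tail_def layer_def)

lemma layer_proj_in_layer: "layer_proj deg j x \<in> layer deg j"
  by (auto simp: layer_proj_def layer_def)

lemma sum_layer_proj: "(\<Sum>j=1..k. layer_proj deg j x) = x"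
proof -
  have "(\<Sum>j=1..k. if deg i = j then x $ i else 0) = x $ i" for i
    using deg_range[of i] by simp
  then show ?thesis by (simp add: vec_eq_iff layer_proj_def)
qed

lemma br_layer_in: "1 \<le> j \<Longrightarrow> a \<in> layer deg 1 \<Longrightarrow> b \<in> layer deg j \<Longrightarrow> j \<le> k \<Longrightarrow> br a b \<in> tail (Suc j)"
proof (cases "j < k")
  case True
  assume "1 \<le> j" "a \<in> layer deg 1" "b \<in> layer deg j"
  then have "br a b \<in> layer deg (Suc j)"
    unfolding br_layer[OF \<open>1 \<le> j\<close> True, symmetric] by (intro span_base) blast
  then show ?thesis using layer_subset_tail by blast
next
  case False
  assume "a \<in> layer deg 1" "b \<in> layer deg j" "j \<le> k"
  with False have "br a b = 0" by (intro br_top) auto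
  then show ?thesis by (simp add: subspace_0 subspace_tail)
qed

lemma br_layer1_tail:
  assumes a: "a \<in> layer deg 1" and b: "b \<in> tail d"
  shows "br a b \<in> tail (Suc d)"
proof -
  have "br a b = (\<Sum>j=1..k. br a (layer_proj deg j b))"
    by (subst sum_layer_proj[of b, symmetric]) (simp add: br.sum_right)
  also have "\<dots> \<in> tail (Suc d)"
  proof (rule subspace_sum[OF subspace_tail])
    fix j assume j: "j \<in> {1..k}"
    show "br a (layer_proj deg j b) \<in> tail (Suc d)"
    proof (cases "d \<le> j")
      case True
      then show ?thesis
        using br_layer_in[OF _ a layer_proj_in_layer[of j b]] j tail_mono[of "Suc d" "Suc j"] by auto
    next
      case False
      then have "layer_proj deg j b = 0" using b by (auto simp: layer_proj_def tail_def vec_eq_iff)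
      then show ?thesis by (simp add: br.zero_right subspace_0 subspace_tail)
    qed
  qed
  finally show ?thesis .
qed

text \<open>Layers beyond the first are generated by brackets with the first one, so induction on
  the layer applies: the Jacobi identity turns a bracket with \<open>br x y\<close> into nested
  brackets with \<open>x\<close> and \<open>y\<close>.\<close>

lemma br_layer_tail:
  "j < k \<Longrightarrow> a \<in> layer deg (Suc j) \<Longrightarrow> b \<in> tail d \<Longrightarrow> br a b \<in> tail (Suc d)"
proof (induction j arbitrary: a b d)
  case 0
  then show ?case using br_layer1_tail by simp
next
  case (Suc j)
  have "a \<in> span {br x y |x y. x \<in> layer deg 1 \<and> y \<in> layer deg (Suc j)}"
    using Suc.prems br_layer[of "Suc j"] by simp
  then show ?case
  proof (induction rule: span_induct)
    case base
    show ?case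
      using subspace_tail[of "Suc d"] by (auto simp: subspace_def br.add_left br.scaleR_left br.zero_left)
  next
    case (step w)
    then obtain x y where w: "w = br x y" and x: "x \<in> layer deg 1" and y: "y \<in> layer deg (Suc j)" by blast
    have "br (br x y) b = br x (br y b) - br y (br x b)"
      using jacobi[of x y b] br_antisym[of "br x y" b] br_antisym[of b x] by (simp add: br.minus_right algebra_simps)
    moreover have "br x (br y b) \<in> tail (Suc (Suc d))"
      using Suc.IH[OF _ y Suc.prems(3)] Suc.prems(1) br_layer1_tail[OF x] by simp
    moreover have "br y (br x b) \<in> tail (Suc (Suc d))"
      using Suc.IH[OF _ y br_layer1_tail[OF x Suc.prems(3)]] Suc.prems(1) by simp
    ultimately have "br w b \<in> tail (Suc (Suc d))" unfolding w by (simp add: subspace_diff subspace_tail)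
    then show ?case using tail_mono[of "Suc d" "Suc (Suc d)"] by auto
  qed
qed

lemma br_tail_right: "b \<in> tail d \<Longrightarrow> br a b \<in> tail (Suc d)"
proof -
  assume b: "b \<in> tail d"
  have "br a b = (\<Sum>j=1..k. br (layer_proj deg j a) b)"
    by (subst sum_layer_proj[of a, symmetric]) (simp add: br.sum_left)
  also have "\<dots> \<in> tail (Suc d)"
  proof (rule subspace_sum[OF subspace_tail])
    fix j assume "j \<in> {1..k}"
    then show "br (layer_proj deg j a) b \<in> tail (Suc d)"
      using br_layer_tail[of "j - 1" "layer_proj deg j a" b d] layer_proj_in_layer[of j a] b by auto
  qed
  finally show ?thesis .
qed

lemma br_tail_left: "b \<in> tail d \<Longrightarrow> br b a \<in> tail (Suc d)"
  using br_tail_right[of b d a] br_antisym[of b a] subspace_neg[OF subspace_tail] by simp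

text \<open>Differences telescope through bilinearity, and each bracket raises their degree. A
  single letter gains nothing, whence the bound on the length.\<close>

lemma iter_br_tail_cong:
  assumes "list_all2 (\<lambda>a b. a - b \<in> tail d) xs ys" "2 \<le> length xs"
  shows "iter_br br xs - iter_br br ys \<in> tail (Suc d)"
proof -
  have step: "br a b - br a' b' \<in> tail (Suc d)" if "a - a' \<in> tail d" "b - b' \<in> tail d" for a a' b b'
  proof -
    have "br a b - br a' b' = br (a - a') b + br a' (b - b')"
      by (simp add: br.diff_left br.diff_right)
    then show ?thesis using br_tail_left[OF that(1)] br_tail_right[OF that(2)] subspace_add[OF subspace_tail] by simp
  qed
  have base: "iter_br br xs - iter_br br ys \<in> tail d" if "list_all2 (\<lambda>a b. a - b \<in> tail d) xs ys" "xs \<noteq> []" for xs ys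
    using that
  proof (induction xs arbitrary: ys rule: induct_list012)
    case (2 x)
    then show ?case by (auto simp: list_all2_Cons1)
  next
    case (3 x x' xs)
    then obtain y y' zs where ys: "ys = y # y' # zs" by (auto simp: list_all2_Cons1)
    have "iter_br br (x' # xs) - iter_br br (y' # zs) \<in> tail d" using 3 ys by auto
    then have "iter_br br (x # x' # xs) - iter_br br ys \<in> tail (Suc d)"
      using step[of x y] 3(3) ys by simp
    then show ?case using tail_mono[of d "Suc d"] by auto
  qed simp
  obtain x x' xs' where xs: "xs = x # x' # xs'"
    using assms(2) by (cases xs; cases "tl xs") auto
  then obtain y y' ys' where ys: "ys = y # y' # ys'" using assms(1) by (auto simp: list_all2_Cons1)
  have "iter_br br (x' # xs') - iter_br br (y' # ys') \<in> tail d"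
    using base assms(1) xs ys by auto
  then show ?thesis using step assms(1) xs ys by simp
qed

text \<open>The linear part of the product changes by exactly \<open>h\<close>; all other terms
  contain a bracket and change only in higher degree. This yields the unitriangular derivative of
  left translations.\<close>

lemma bch_tail_increment:
  assumes "h \<in> tail d"
  shows "bch k br x (y + h) - bch k br x y - h \<in> tail (Suc d)"
proof -
  let ?B = "{rs \<in> bch_exponents k. 2 \<le> (\<Sum>(r, s)\<leftarrow>rs. r + s)}"
  have "bch k br x (y + h) - bch k br x y - h =
      (\<Sum>rs\<in>?B. bch_coeff rs *\<^sub>R (iter_br br (bch_word x (y + h) rs) - iter_br br (bch_word x y rs)))"
    by (simp add: bch_split[OF k_pos] scaleR_diff_right sum_subtractf)
  also have "\<dots> \<in> tail (Suc d)"
    using assms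
    by (intro subspace_sum[OF subspace_tail] subspace_scale[OF subspace_tail] iter_br_tail_cong list_all2_bch_word)
      (auto simp: length_bch_word subspace_0 subspace_tail)
  finally show ?thesis .
qed

lemma iter_br_multiples: "2 \<le> length xs \<Longrightarrow> set xs \<subseteq> range (\<lambda>c. c *\<^sub>R v) \<Longrightarrow> iter_br br xs = 0"
proof (induction xs rule: induct_list012)
  case (3 x y zs)
  show ?case
  proof (cases zs)
    case Nil
    then show ?thesis using 3 by (auto simp: br.scaleR_left br.scaleR_right br_self)
  next
    case (Cons a list)
    then show ?thesis using 3 by (simp add: br.zero_right)
  qed
qed auto

text \<open>Every bracket of multiples of one vector vanishes, so lines through 0 are one-parameter
  subgroups in these coordinates.\<close>

lemma bch_multiples: "bch k br (s *\<^sub>R v) (t *\<^sub>R v) = (s + t) *\<^sub>R v"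
proof -
  have "iter_br br (bch_word (s *\<^sub>R v) (t *\<^sub>R v) rs) = 0"
    if "2 \<le> (\<Sum>(r, s)\<leftarrow>rs. r + s)" for rs
    using that set_bch_word[of "s *\<^sub>R v" "t *\<^sub>R v" rs]
    by (intro iter_br_multiples[of _ v]) (auto simp: length_bch_word)
  then show ?thesis by (simp add: bch_split[OF k_pos] scaleR_add_left)
qed

end

text \<open>Directional derivatives of polynomials are again polynomials, so the lemma applies anew
  to the derivative of the group law.\<close>

lemma real_polynomial_function_derivative:
  fixes f :: "'a::real_normed_vector \<Rightarrow> real"
  assumes "real_polynomial_function f"
  shows "\<exists>f'. (\<forall>x. (f has_derivative f' x) (at x)) \<and> (\<forall>v. real_polynomial_function (\<lambda>x. f' x v))"
  using assms
proof induction
  case (linear f)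
  then show ?case by (intro exI[of _ "\<lambda>_. f"]) (auto intro: bounded_linear_imp_has_derivative)
next
  case (const c)
  then show ?case by (intro exI[of _ "\<lambda>_ _. 0"]) auto
next
  case (add f g)
  then obtain f' g' where "\<forall>x. (f has_derivative f' x) (at x)" "\<forall>v. real_polynomial_function (\<lambda>x. f' x v)"
    "\<forall>x. (g has_derivative g' x) (at x)" "\<forall>v. real_polynomial_function (\<lambda>x. g' x v)" by blast
  then show ?case by (intro exI[of _ "\<lambda>x v. f' x v + g' x v"]) (auto intro!: derivative_eq_intros)
next
  case (mult f g)
  then obtain f' g' where "\<forall>x. (f has_derivative f' x) (at x)" "\<forall>v. real_polynomial_function (\<lambda>x. f' x v)"
    "\<forall>x. (g has_derivative g' x) (at x)" "\<forall>v. real_polynomial_function (\<lambda>x. g' x v)" by blast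
  note d = this
  have "real_polynomial_function (\<lambda>x. f x * g' x v + f' x v * g x)" for v
    using d mult.hyps by (intro real_polynomial_function.intros(3,4)) auto
  moreover have "((\<lambda>x. f x * g x) has_derivative (\<lambda>v. f x * g' x v + f' x v * g x)) (at x)" for x
    using d by (auto intro!: derivative_eq_intros)
  ultimately show ?case by (intro exI[of _ "\<lambda>x v. f x * g' x v + f' x v * g x"]) blast
qed

section \<open>The polynomial group law and its left translations\<close>

context carnot_group
begin

lemma iter_br_polynomial:
  fixes hs :: "('b::real_normed_vector \<Rightarrow> real^'n) list"
  assumes "\<And>h i. h \<in> set hs \<Longrightarrow> real_polynomial_function (\<lambda>w. h w $ i)"
  shows "real_polynomial_function (\<lambda>w. iter_br br (map (\<lambda>h. h w) hs) $ i)"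
  using assms
proof (induction hs arbitrary: i rule: induct_list012)
  case (3 g h hs)
  define F where "F w = iter_br br (map (\<lambda>h. h w) (h # hs))" for w
  have F: "real_polynomial_function (\<lambda>w. F w $ i)" for i
    unfolding F_def by (rule 3(2)) (use 3(3) in auto)
  have G: "real_polynomial_function (\<lambda>w. g w $ i)" for i by (rule 3(3)) simp
  have "br (g w) (F w) $ i = (\<Sum>a\<in>UNIV. \<Sum>b\<in>UNIV. (g w $ a * F w $ b) * br (axis a 1) (axis b 1) $ i)" for w
  proof -
    have "br (g w) (F w) = br (\<Sum>a\<in>UNIV. g w $ a *\<^sub>R axis a 1) (\<Sum>b\<in>UNIV. F w $ b *\<^sub>R axis b 1)"
      by (simp add: basis_expansion scalar_mult_eq_scaleR[symmetric])
    also have "\<dots> = (\<Sum>a\<in>UNIV. \<Sum>b\<in>UNIV. (g w $ a * F w $ b) *\<^sub>R br (axis a 1) (axis b 1))"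
      by (simp add: br.sum_left br.sum_right br.scaleR_left br.scaleR_right scaleR_sum_right mult.commute)
        (rule sum.swap)
    finally show ?thesis by simp
  qed
  then have eq: "iter_br br (map (\<lambda>h. h w) (g # h # hs)) $ i =
      (\<Sum>a\<in>UNIV. \<Sum>b\<in>UNIV. (g w $ a * F w $ b) * br (axis a 1) (axis b 1) $ i)" for w
    by (simp add: F_def)
  show ?case unfolding eq
    by (intro real_polynomial_function_sum real_polynomial_function.intros(4) F G real_polynomial_function.intros(2) finite)
qed auto

lemma mul_polynomial: "real_polynomial_function (\<lambda>w. mul (fst w) (snd w) $ i)"
proof -
  \<comment> \<open>The word is first formed with the two projections as letters and evaluated
    afterwards, which makes it a list of functions of the pair.\<close>
  have word: "bch_word (fst w) (snd w) rs = map (\<lambda>h. h w) (bch_word fst snd rs)" for w :: "(real^'n) \<times> (real^'n)" and rs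
    by (induction rs) (auto simp: bch_word_def)
  have lin: "real_polynomial_function (\<lambda>w. fst w $ i)" "real_polynomial_function (\<lambda>w. snd w $ i)" for i
    by (rule real_polynomial_function.intros(1)[OF bounded_linear_compose[OF bounded_linear_vec_nth bounded_linear_fst]],
      rule real_polynomial_function.intros(1)[OF bounded_linear_compose[OF bounded_linear_vec_nth bounded_linear_snd]])
  have "real_polynomial_function (\<lambda>w. iter_br br (bch_word (fst w) (snd w) rs) $ i)" for rs
    unfolding word
  proof (rule iter_br_polynomial)
    fix h :: "(real^'n) \<times> (real^'n) \<Rightarrow> real^'n" and i assume "h \<in> set (bch_word fst snd rs)"
    then have "h = fst \<or> h = snd" using set_bch_word[of fst snd rs] by auto
    then show "real_polynomial_function (\<lambda>w. h w $ i)" using lin by auto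
  qed
  then show ?thesis
    unfolding mul_eq_bch bch_eq sum_component vector_scaleR_component real_scaleR_def
    by (intro real_polynomial_function_sum finite_bch_exponents real_polynomial_function.intros(4)
        real_polynomial_function.intros(2))
qed

definition dmul :: "real^'n \<Rightarrow> real^'n \<Rightarrow> real^'n \<Rightarrow> real^'n" where
  "dmul x z = frechet_derivative (mul x) (at z)"

text \<open>The joint polynomial in both factors is differentiated componentwise; restricting to
  increments \<open>(0, v)\<close> gives the derivative of a left translation, with polynomial
  dependence on both points.\<close>

lemma dmul_exists:
  "\<exists>D. (\<forall>x z. (mul x has_derivative D x z) (at z)) \<and> (\<forall>v i. real_polynomial_function (\<lambda>w. D (fst w) (snd w) v $ i))"
proof -
  have "\<forall>i. \<exists>f'. (\<forall>w. ((\<lambda>w. mul (fst w) (snd w) $ i) has_derivative f' w) (at w)) \<and> (\<forall>v. real_polynomial_function (\<lambda>w. f' w v))"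
    by (intro allI real_polynomial_function_derivative[OF mul_polynomial])
  from choice[OF this] obtain G where "\<forall>i. (\<forall>w. ((\<lambda>w. mul (fst w) (snd w) $ i) has_derivative G i w) (at w)) \<and>
      (\<forall>v. real_polynomial_function (\<lambda>w. G i w v))" by blast
  then have G: "\<And>i w. ((\<lambda>w. mul (fst w) (snd w) $ i) has_derivative G i w) (at w)"
    "\<And>i v. real_polynomial_function (\<lambda>w. G i w v)" by blast+
  define D where "D x z v = (\<chi> i. G i (x, z) (0, v))" for x z v
  have "((\<lambda>z. mul x z $ i) has_derivative (\<lambda>v. G i (x, z) (0, v))) (at z)" for x z i
  proof -
    have "((\<lambda>z. (x, z)) has_derivative (\<lambda>v. (0, v))) (at z)"
      by (intro has_derivative_Pair has_derivative_const has_derivative_ident)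
    from has_derivative_compose[OF this G(1)] show ?thesis by simp
  qed
  then have "(mul x has_derivative D x z) (at z)" for x z
    unfolding D_def by (subst has_derivative_componentwise_within) (auto simp: Basis_vec_def inner_axis)
  moreover have "real_polynomial_function (\<lambda>w. D (fst w) (snd w) v $ i)" for v i
    using G(2) by (simp add: D_def)
  ultimately show ?thesis by blast
qed

lemma mul_has_derivative: "(mul x has_derivative dmul x z) (at z)"
  and dmul_polynomial: "real_polynomial_function (\<lambda>w. dmul (fst w) (snd w) v $ i)"
proof -
  obtain D where D: "\<And>x z. (mul x has_derivative D x z) (at z)"
    "\<And>v i. real_polynomial_function (\<lambda>w. D (fst w) (snd w) v $ i)"
    using dmul_exists by blast
  have "dmul x z = D x z" for x z
    unfolding dmul_def by (rule frechet_derivative_at[OF D(1), symmetric])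
  with D show "(mul x has_derivative dmul x z) (at z)"
    "real_polynomial_function (\<lambda>w. dmul (fst w) (snd w) v $ i)" by simp_all
qed

lemma jac_field_eq: "jac_field mul j x = dmul x 0 (axis j 1)"
  by (simp add: jac_field_def dmul_def)

lemma continuous_on_mul: "continuous_on S (mul x)"
  using has_derivative_continuous[OF mul_has_derivative] by (auto intro: continuous_at_imp_continuous_on)

text \<open>For an increment along \<open>axis j 1\<close>, of degree \<open>deg j\<close>, the
  nonlinear change lies in strictly higher degree; coordinate \<open>i\<close> is therefore affine
  in the increment.\<close>

lemma dmul_unitriangular:
  assumes "\<not> deg j < deg i"
  shows "dmul x z (axis j 1) $ i = (if i = j then 1 else 0)"
proof -
  have inc: "mul x (z + t *\<^sub>R axis j 1) $ i = mul x z $ i + t * (if i = j then 1 else 0)" for t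
  proof -
    have "t *\<^sub>R axis j 1 \<in> tail (deg j)" by (auto simp: tail_def axis_def)
    from bch_tail_increment[OF this, of x z]
    have "(mul x (z + t *\<^sub>R axis j 1) - mul x z - t *\<^sub>R axis j 1) $ i = 0"
      using assms by (auto simp: tail_def mul_eq_bch)
    then show ?thesis by (simp add: axis_def)
  qed
  have "((\<lambda>t. z + t *\<^sub>R axis j 1) has_derivative (\<lambda>t. t *\<^sub>R axis j 1)) (at 0)"
    by (auto intro!: derivative_eq_intros)
  moreover have "(mul x has_derivative dmul x z) (at (z + 0 *\<^sub>R axis j 1))"
    using mul_has_derivative by simp
  ultimately have "((\<lambda>t. mul x (z + t *\<^sub>R axis j 1)) has_derivative (\<lambda>t. dmul x z (t *\<^sub>R axis j 1))) (at 0)"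
    by (rule has_derivative_compose)
  from bounded_linear.has_derivative[OF bounded_linear_vec_nth this, of i]
  have "((\<lambda>t. mul x z $ i + t * (if i = j then 1 else 0)) has_derivative (\<lambda>t. dmul x z (t *\<^sub>R axis j 1) $ i)) (at 0)"
    unfolding inc .
  moreover have "((\<lambda>t. mul x z $ i + t * (if i = j then 1 else 0)) has_derivative (\<lambda>t. t * (if i = j then 1 else 0))) (at 0)"
    by (auto intro!: derivative_eq_intros)
  ultimately have "(\<lambda>t. dmul x z (t *\<^sub>R axis j 1) $ i) = (\<lambda>t. t * (if i = j then 1 else 0))"
    by (rule has_derivative_unique)
  from fun_cong[OF this, of 1] show ?thesis by simp
qed

lemma mul_minus_left [simp]: "mul (- x) (mul x y) = y"
  by (metis assoc group_left_neutral left_inverse)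

lemma mul_minus_right [simp]: "mul x (mul (- x) y) = y"
  using mul_minus_left[of "- x"] by simp

text \<open>Left invariance of Lebesgue measure: the inverse of a left translation is another one,
  with unitriangular derivative.\<close>

lemma preserves_lborel_mul: "preserves_lborel (mul x)"
  by (rule preserves_lborel_unitriangular[where g = "mul (- x)" and g' = "dmul (- x)" and d = deg])
    (simp_all add: continuous_on_mul mul_has_derivative dmul_unitriangular)

lemma mul_multiples: "mul (mul x (s *\<^sub>R v)) (t *\<^sub>R v) = mul x ((s + t) *\<^sub>R v)"
  by (simp add: assoc mul_eq_bch[of "s *\<^sub>R v"] bch_multiples)

section \<open>Dilations and the balls of the pseudonorm\<close>

definition dil :: "real \<Rightarrow> real^'n \<Rightarrow> real^'n" where
  "dil \<epsilon> z = (\<chi> i. \<epsilon> ^ deg i * z $ i)"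

text \<open>\<open>gnorm\<close> raised to the power \<open>2 * fact k\<close>, so that comparisons
  and limits avoid the root.\<close>

definition gpow :: "real^'n \<Rightarrow> real" where
  "gpow z = (\<Sum>j = 1..k. norm (layer_proj deg j z) ^ (2 * fact k div j))"

lemma dil_dil: "dil a (dil b z) = dil (a * b) z"
  by (simp add: dil_def vec_eq_iff power_mult_distrib)

lemma dil_one [simp]: "dil 1 z = z"
  by (simp add: dil_def vec_eq_iff)

lemma dil_inverse: "\<epsilon> \<noteq> 0 \<Longrightarrow> dil \<epsilon> (dil (1 / \<epsilon>) z) = z" "\<epsilon> \<noteq> 0 \<Longrightarrow> dil (1 / \<epsilon>) (dil \<epsilon> z) = z"
  by (simp_all add: dil_dil)

lemma linear_dil: "linear (dil \<epsilon>)"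
  by (rule linearI) (auto simp: dil_def vec_eq_iff algebra_simps)

lemma exponent_eq: "j \<in> {1..k} \<Longrightarrow> j * (2 * fact k div j) = 2 * fact k"
  using dvd_fact[of j k] by (intro dvd_mult_div_cancel) auto

lemma exponent_pos: "j \<in> {1..k} \<Longrightarrow> 0 < 2 * fact k div (j :: nat)"
  using exponent_eq[of j] by (metis fact_gt_zero mult_0_right mult_pos_pos neq0_conv pos2)

lemma gpow_dil: "0 \<le> \<epsilon> \<Longrightarrow> gpow (dil \<epsilon> z) = \<epsilon> ^ (2 * fact k) * gpow z"
proof -
  assume \<epsilon>: "0 \<le> \<epsilon>"
  have "layer_proj deg j (dil \<epsilon> z) = \<epsilon> ^ j *\<^sub>R layer_proj deg j z" for j
    by (auto simp: layer_proj_def dil_def vec_eq_iff)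
  then have "gpow (dil \<epsilon> z) = (\<Sum>j = 1..k. (\<epsilon> ^ (j * (2 * fact k div j))) * norm (layer_proj deg j z) ^ (2 * fact k div j))"
    using \<epsilon> by (simp add: gpow_def power_mult_distrib power_mult)
  also have "\<dots> = (\<Sum>j = 1..k. \<epsilon> ^ (2 * fact k) * norm (layer_proj deg j z) ^ (2 * fact k div j))"
    by (intro sum.cong refl) (simp only: exponent_eq)
  finally show ?thesis by (simp add: gpow_def sum_distrib_left)
qed

lemma gpow_minus: "gpow (- z) = gpow z"
proof -
  have "layer_proj deg j (- z) = - layer_proj deg j z" for j
    by (auto simp: layer_proj_def vec_eq_iff)
  then show ?thesis by (simp add: gpow_def)
qed

lemma linear_layer_proj: "linear (layer_proj deg j)"
  by (rule linearI) (auto simp: layer_proj_def vec_eq_iff)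

lemma continuous_on_gpow: "continuous_on S gpow"
  unfolding gpow_def[abs_def]
  by (intro continuous_on_sum continuous_on_power continuous_on_norm linear_continuous_on
      linear_conv_bounded_linear[THEN iffD1] linear_layer_proj)

definition Kset :: "(real^'n) set" where "Kset = {z. gpow z \<le> 1}"
definition Uset :: "(real^'n) set" where "Uset = {z. gpow z < 1}"

lemma layer_proj_zero [simp]: "layer_proj deg j 0 = 0"
  by (simp add: layer_proj_def vec_eq_iff)

lemma gpow_zero: "gpow 0 = 0"
  unfolding gpow_def by (intro sum.neutral ballI) (use exponent_pos in \<open>simp add: power_0_left\<close>)

lemma zero_in_Uset: "0 \<in> Uset"
  by (simp add: Uset_def gpow_zero)

lemma open_Uset: "open Uset"
  unfolding Uset_def by (intro open_Collect_less continuous_on_gpow continuous_intros)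

lemma norm_layer_proj_le:
  assumes "z \<in> Kset" "j \<in> {1..k}" shows "norm (layer_proj deg j z) \<le> 1"
proof (rule ccontr)
  assume "\<not> norm (layer_proj deg j z) \<le> 1"
  then have "1 < norm (layer_proj deg j z) ^ (2 * fact k div j)"
    using exponent_pos[OF assms(2)] by (intro one_less_power) auto
  also have "\<dots> \<le> gpow z"
    unfolding gpow_def using assms(2) by (intro member_le_sum) auto
  finally show False using assms(1) by (simp add: Kset_def)
qed

lemma compact_Kset: "compact Kset"
proof -
  have "closed Kset"
    unfolding Kset_def by (intro closed_Collect_le continuous_on_gpow continuous_intros)
  moreover have "bounded Kset"
    unfolding bounded_iff
  proof (intro exI[of _ "real k"] ballI)
    fix z assume z: "z \<in> Kset"
    have "norm z \<le> (\<Sum>j = 1..k. norm (layer_proj deg j z))"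
      by (subst sum_layer_proj[of z, symmetric]) (rule norm_sum)
    also have "\<dots> \<le> (\<Sum>j = 1..k. 1)"
      by (intro sum_mono norm_layer_proj_le z) auto
    finally show "norm z \<le> real k" by simp
  qed
  ultimately show ?thesis by (simp add: compact_eq_bounded_closed)
qed

text \<open>A point of the closed ball is the limit of \<open>dil t z\<close> as t increases to 1,
  and these points have \<open>gpow\<close> below 1 by homogeneity.\<close>

lemma closure_Uset: "closure Uset = Kset"
proof
  show "closure Uset \<subseteq> Kset"
    using compact_imp_closed[OF compact_Kset] by (intro closure_minimal) (auto simp: Uset_def Kset_def)
  show "Kset \<subseteq> closure Uset"
  proof
    fix z assume z: "z \<in> Kset"
    have "((\<lambda>t. dil t z) \<longlongrightarrow> dil 1 z) (at_left 1)"
      unfolding dil_def by (intro tendsto_intros)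
    moreover have "\<forall>\<^sub>F t in at_left 1. dil t z \<in> closure Uset"
      unfolding eventually_at_left_field
    proof (intro exI[of _ 0] conjI allI impI)
      fix t :: real assume t: "0 < t" "t < 1"
      have "t ^ (2 * fact k) * gpow z \<le> t ^ (2 * fact k) * 1"
        using z t by (intro mult_left_mono) (auto simp: Kset_def)
      also have "\<dots> < 1" using t by (simp add: power_less_one_iff)
      finally show "dil t z \<in> closure Uset"
        using t gpow_dil[of t z] closure_subset[of Uset] by (auto simp: Uset_def)
    qed simp
    ultimately show "z \<in> closure Uset"
      using Lim_in_closed_set[OF closed_closure, of "\<lambda>t. dil t z" Uset "at_left (1::real)" "dil 1 z"] by simp
  qed
qed

text \<open>Carries the unit ball onto the ball of radius \<epsilon> at \<open>x\<close>, so that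
  all integrals and extrema live on the fixed set \<open>Kset\<close>. The dilation comes before the
  translation, so homogeneity of \<open>gpow\<close> identifies the image.\<close>

definition Tmap :: "real^'n \<Rightarrow> real \<Rightarrow> real^'n \<Rightarrow> real^'n" where
  "Tmap x \<epsilon> z = mul x (dil \<epsilon> z)"

lemma continuous_on_Tmap: "continuous_on S (Tmap x \<epsilon>)"
  unfolding Tmap_def
  by (rule continuous_on_compose2[OF continuous_on_mul[of UNIV]])
    (auto intro: linear_continuous_on linear_conv_bounded_linear[THEN iffD1] linear_dil)

lemma gball_eq:
  assumes "0 < \<epsilon>"
  shows "gball k deg mul x \<epsilon> = Tmap x \<epsilon> ` Uset"
proof -
  have iff: "gnorm k deg w < \<epsilon> \<longleftrightarrow> gpow w < \<epsilon> ^ (2 * fact k)" for w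
  proof -
    have "gnorm k deg w = root (2 * fact k) (gpow w)" by (simp add: gnorm_def gpow_def)
    moreover have "root (2 * fact k) (gpow w) < root (2 * fact k) (\<epsilon> ^ (2 * fact k)) \<longleftrightarrow> gpow w < \<epsilon> ^ (2 * fact k)"
      by (intro real_root_less_iff) simp
    moreover have "root (2 * fact k) (\<epsilon> ^ (2 * fact k)) = \<epsilon>"
      using assms by (intro real_root_power_cancel) auto
    ultimately show ?thesis by simp
  qed
  have "y \<in> gball k deg mul x \<epsilon> \<longleftrightarrow> gpow (mul (- x) y) < \<epsilon> ^ (2 * fact k)" for y
  proof -
    \<comment> \<open>The ball is defined by \<open>mul (- y) x\<close>, the group inverse of
      \<open>mul (- x) y\<close>; inversion is negation, under which \<open>gpow\<close> is
      even.\<close>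
    have "mul (- y) x = - mul (- x) y" by (simp add: inverse_distrib_swap)
    then show ?thesis by (simp add: gball_def iff gpow_minus)
  qed
  moreover have "y \<in> Tmap x \<epsilon> ` Uset \<longleftrightarrow> gpow (mul (- x) y) < \<epsilon> ^ (2 * fact k)" for y
  proof
    assume "y \<in> Tmap x \<epsilon> ` Uset"
    then obtain z where "z \<in> Uset" "y = Tmap x \<epsilon> z" by blast
    then show "gpow (mul (- x) y) < \<epsilon> ^ (2 * fact k)"
      using assms by (simp add: Tmap_def gpow_dil Uset_def)
  next
    assume "gpow (mul (- x) y) < \<epsilon> ^ (2 * fact k)"
    then have "dil (1 / \<epsilon>) (mul (- x) y) \<in> Uset"
      using assms by (simp add: Uset_def gpow_dil power_divide)
    moreover have "y = Tmap x \<epsilon> (dil (1 / \<epsilon>) (mul (- x) y))"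
      using assms by (simp add: Tmap_def dil_inverse)
    ultimately show "y \<in> Tmap x \<epsilon> ` Uset" by blast
  qed
  ultimately show ?thesis by blast
qed

lemma Tmap_inverse:
  "0 < \<epsilon> \<Longrightarrow> dil (1 / \<epsilon>) (mul (- x) (Tmap x \<epsilon> z)) = z"
  "0 < \<epsilon> \<Longrightarrow> Tmap x \<epsilon> (dil (1 / \<epsilon>) (mul (- x) y)) = y"
  by (simp_all add: Tmap_def dil_inverse)

lemma continuous_on_Tmap_inverse: "continuous_on S (\<lambda>y. dil c (mul (- x) y))"
  by (rule continuous_on_compose2[OF linear_continuous_on[of "dil c" UNIV] continuous_on_mul])
    (auto intro: linear_conv_bounded_linear[THEN iffD1] linear_dil)

lemma Tmap_image_eq: "0 < \<epsilon> \<Longrightarrow> Tmap x \<epsilon> ` A = (\<lambda>y. dil (1 / \<epsilon>) (mul (- x) y)) -` A"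
proof (intro equalityI subsetI)
  fix y assume \<epsilon>: "0 < \<epsilon>" and "y \<in> (\<lambda>y. dil (1 / \<epsilon>) (mul (- x) y)) -` A"
  then show "y \<in> Tmap x \<epsilon> ` A" using Tmap_inverse(2)[OF \<epsilon>, of x y] by (metis image_eqI vimageE)
qed (auto simp: Tmap_inverse(1))

lemma open_Tmap_Uset: "0 < \<epsilon> \<Longrightarrow> open (Tmap x \<epsilon> ` Uset)"
  unfolding Tmap_image_eq by (intro open_vimage open_Uset continuous_on_Tmap_inverse)

text \<open>The image of the compact \<open>Kset\<close> is closed, which gives one inclusion;
  continuity of \<open>Tmap\<close> gives the other.\<close>

lemma closure_gball:
  assumes "0 < \<epsilon>"
  shows "closure (gball k deg mul x \<epsilon>) = Tmap x \<epsilon> ` Kset"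
proof
  have "compact (Tmap x \<epsilon> ` Kset)"
    by (intro compact_continuous_image continuous_on_Tmap compact_Kset)
  then show "closure (gball k deg mul x \<epsilon>) \<subseteq> Tmap x \<epsilon> ` Kset"
    unfolding gball_eq[OF assms] using closure_subset closure_Uset
    by (intro closure_minimal image_mono) (auto intro: compact_imp_closed)
  show "Tmap x \<epsilon> ` Kset \<subseteq> closure (gball k deg mul x \<epsilon>)"
    unfolding gball_eq[OF assms] closure_Uset[symmetric]
    by (rule image_closure_subset) (auto intro: continuous_on_Tmap closure_subset[THEN subsetD])
qed

lemma emeasure_nonzero: "open W \<Longrightarrow> W \<noteq> {} \<Longrightarrow> W \<subseteq> S \<Longrightarrow> compact S \<Longrightarrow> emeasure lborel (S :: (real^'n) set) \<noteq> 0"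
proof
  assume W: "open W" "W \<noteq> {}" "W \<subseteq> S" "compact S" and 0: "emeasure lborel S = 0"
  then have "S \<in> null_sets lborel" by (auto simp: borel_compact)
  then have "negligible S" by (simp add: negligible_iff_null_sets null_sets_completionI)
  then have "negligible W" using W(3) negligible_subset by blast
  then show False using W open_not_negligible by blast
qed

lemma norm_dil_le:
  assumes "0 < \<epsilon>" "\<epsilon> < 1"
  shows "norm (dil \<epsilon> z) \<le> \<epsilon> * norm z"
proof -
  have "\<epsilon> ^ deg i \<le> \<epsilon>" for i
    using power_decreasing[of 1 "deg i" \<epsilon>] deg_range[of i] assms by simp
  then have "norm (dil \<epsilon> z) \<le> norm (\<epsilon> *\<^sub>R z)"
    using assms by (intro norm_le_componentwise_cart) (simp add: dil_def abs_mult mult_right_mono)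
  then show ?thesis using assms by simp
qed

lemma dil_integral:
  assumes \<epsilon>: "0 < \<epsilon>"
  shows "\<exists>J>0. \<forall>g::real^'n \<Rightarrow> real. g \<in> borel_measurable borel \<longrightarrow> (LINT y|lborel. g y) = J * (LINT z|lborel. g (dil \<epsilon> z))"
proof -
  \<comment> \<open>A linear functional whose values on the coordinate vectors are the scaling
    factors, because the affine change of variables for \<open>lborel\<close> is indexed by
    \<open>Basis\<close> rather than by coordinates.\<close>
  define c where "c b = (\<Sum>i\<in>UNIV. \<epsilon> ^ deg i * b $ i)" for b :: "real^'n"
  have c: "c (axis i 1) = \<epsilon> ^ deg i" for i
    by (simp add: c_def axis_def if_distrib[where f = "(*) _"] cong: if_cong)
  have cB: "0 < c b" if "b \<in> Basis" for b
    using that \<epsilon> by (auto simp: Basis_vec_def c)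
  define J where "J = (\<Prod>b\<in>(Basis :: (real^'n) set). \<bar>c b\<bar>)"
  have J: "0 < J" unfolding J_def using cB less_imp_neq[OF cB] by (intro prod_pos) fastforce
  have T: "0 + (\<Sum>b\<in>Basis. (c b * (z \<bullet> b)) *\<^sub>R b) = dil \<epsilon> z" for z
  proof -
    have "(\<Sum>b\<in>Basis. (c b * (z \<bullet> b)) *\<^sub>R b) \<bullet> axis i 1 = dil \<epsilon> z \<bullet> axis i 1" for i
      by (subst inner_sum_left_Basis) (auto simp: Basis_vec_def c dil_def inner_axis)
    then show ?thesis by (simp add: vec_eq_iff inner_axis)
  qed
  have eq: "lborel = density (distr lborel borel (dil \<epsilon>)) (\<lambda>_. ennreal J)"
    using lborel_affine_euclidean[of c 0] cB unfolding T J_def by (force simp: less_imp_neq[symmetric])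
  have m[measurable]: "dil \<epsilon> \<in> borel_measurable borel"
    by (intro borel_measurable_continuous_onI linear_continuous_on linear_conv_bounded_linear[THEN iffD1] linear_dil)
  have "(LINT y|lborel. g y) = J * (LINT z|lborel. g (dil \<epsilon> z))" if [measurable]: "g \<in> borel_measurable borel" for g :: "real^'n \<Rightarrow> real"
  proof -
    have "(LINT y|lborel. g y) = (LINT y|density (distr lborel borel (dil \<epsilon>)) (\<lambda>_. ennreal J). g y)"
      using eq by simp
    also have "\<dots> = (LINT y|distr lborel borel (dil \<epsilon>). J *\<^sub>R g y)"
      using J by (subst integral_density) auto
    also have "\<dots> = (LINT z|lborel. J *\<^sub>R g (dil \<epsilon> z))"
      by (subst integral_distr) auto
    finally show ?thesis by simp
  qed
  with J show ?thesis by blast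
qed

lemma Tmap_integral:
  assumes \<epsilon>: "0 < \<epsilon>"
  shows "\<exists>J>0. \<forall>g::real^'n \<Rightarrow> real. continuous_on (Tmap x \<epsilon> ` Kset) g \<longrightarrow>
    (LINT y:Tmap x \<epsilon> ` Kset|lborel. g y) = J * (LINT z:Kset|lborel. g (Tmap x \<epsilon> z))"
proof -
  obtain J where J: "0 < J" "\<And>g::real^'n \<Rightarrow> real. g \<in> borel_measurable borel \<Longrightarrow> (LINT y|lborel. g y) = J * (LINT z|lborel. g (dil \<epsilon> z))"
    using dil_integral[OF \<epsilon>] by blast
  have "(LINT y:Tmap x \<epsilon> ` Kset|lborel. g y) = J * (LINT z:Kset|lborel. g (Tmap x \<epsilon> z))"
    if g: "continuous_on (Tmap x \<epsilon> ` Kset) g" for g :: "real^'n \<Rightarrow> real"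
  proof -
    define G where "G y = indicator (Tmap x \<epsilon> ` Kset) y *\<^sub>R g y" for y
    have cK: "compact (Tmap x \<epsilon> ` Kset)" by (intro compact_continuous_image continuous_on_Tmap compact_Kset)
    have G: "G \<in> borel_measurable borel"
      using borel_integrable_compact[OF cK g] unfolding G_def[abs_def] by auto
    have "mul x \<in> borel_measurable borel"
      by (intro borel_measurable_continuous_onI continuous_on_mul)
    then have G': "(\<lambda>z. G (mul x z)) \<in> borel_measurable borel" using G by measurable
    have "(LINT y|lborel. G y) = (LINT z|lborel. G (mul x z))"
      by (rule preserves_lborel_integral[OF preserves_lborel_mul G, symmetric])
    also have "\<dots> = J * (LINT z|lborel. G (mul x (dil \<epsilon> z)))" by (rule J(2)[OF G'])
    also have "(\<lambda>z. G (mul x (dil \<epsilon> z))) = (\<lambda>z. indicator Kset z *\<^sub>R g (Tmap x \<epsilon> z))"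
    proof
      fix z
      have "Tmap x \<epsilon> z \<in> Tmap x \<epsilon> ` Kset \<longleftrightarrow> z \<in> Kset"
        using inj_image_mem_iff[of "Tmap x \<epsilon>"]
          inj_on_inverseI[where f = "Tmap x \<epsilon>" and g = "\<lambda>y. dil (1 / \<epsilon>) (mul (- x) y)" and A = UNIV]
        by (simp add: Tmap_inverse(1)[OF \<epsilon>])
      then show "G (mul x (dil \<epsilon> z)) = indicator Kset z *\<^sub>R g (Tmap x \<epsilon> z)"
        unfolding G_def Tmap_def[symmetric] by (auto simp: indicator_def)
    qed
    finally show ?thesis by (simp add: G_def set_lebesgue_integral_def)
  qed
  with J(1) show ?thesis by blast
qed

text \<open>The reflection acts as an isometry within the layer of \<omega> and trivially on all
  others, so no layer norm changes.\<close>

lemma hreflect_Kset: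
  assumes \<omega>: "\<omega> \<in> layer deg l" and z: "z \<in> Kset"
  shows "hreflect \<omega> z \<in> Kset"
proof -
  have "norm (layer_proj deg j (hreflect \<omega> z)) = norm (layer_proj deg j z)" for j
  proof (cases "j = l")
    case True
    have "layer_proj deg j \<omega> = \<omega>" using \<omega> True by (auto simp: layer_proj_def layer_def vec_eq_iff)
    moreover have in1: "\<omega> \<bullet> layer_proj deg j z = \<omega> \<bullet> z"
      using \<omega> True unfolding inner_vec_def by (intro sum.cong) (auto simp: layer_proj_def layer_def)
    ultimately have "layer_proj deg j (hreflect \<omega> z) = hreflect \<omega> (layer_proj deg j z)"
      by (simp add: hreflect_def linear_diff[OF linear_layer_proj] linear_scale[OF linear_layer_proj])
    moreover have "norm (hreflect \<omega> w) = norm w" for w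
    proof -
      have "hreflect \<omega> w \<bullet> hreflect \<omega> w = w \<bullet> w"
        by (cases "\<omega> = 0") (simp_all add: hreflect_def inner_diff_left inner_diff_right inner_commute field_simps)
      then show ?thesis by (simp add: norm_eq_sqrt_inner)
    qed
    ultimately show ?thesis by simp
  next
    case False
    have "layer_proj deg j \<omega> = 0" using \<omega> False by (auto simp: layer_proj_def layer_def vec_eq_iff)
    then show ?thesis
      by (simp add: hreflect_def linear_diff[OF linear_layer_proj] linear_scale[OF linear_layer_proj])
  qed
  then show ?thesis using z by (simp add: Kset_def gpow_def)
qed

text \<open>Cauchy-Schwarz bounds \<open>\<xi> \<bullet> z\<close> through the first-layer part, of
  norm at most 1. Equality forces that part to be the normalized \<xi>, and then
  \<open>gpow z \<le> 1\<close> leaves nothing for the other layers.\<close>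

lemma Kset_inner_max:
  assumes \<xi>: "\<xi> \<in> layer deg 1" "\<xi> \<noteq> 0"
  shows "\<xi> /\<^sub>R norm \<xi> \<in> Kset" and "z \<in> Kset \<Longrightarrow> z \<noteq> \<xi> /\<^sub>R norm \<xi> \<Longrightarrow> \<xi> \<bullet> z < \<xi> \<bullet> (\<xi> /\<^sub>R norm \<xi>)"
proof -
  define \<nu> where "\<nu> = \<xi> /\<^sub>R norm \<xi>"
  have \<nu>: "\<nu> \<in> layer deg 1" "norm \<nu> = 1"
    using \<xi> subspace_scale[OF subspace_layer] by (auto simp: \<nu>_def)
  have proj: "layer_proj deg j \<nu> = (if j = 1 then \<nu> else 0)" for j
    using \<nu>(1) by (auto simp: layer_proj_def layer_def vec_eq_iff)
  have "gpow \<nu> = (\<Sum>j = 1..k. if j = 1 then 1 else 0)"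
    unfolding gpow_def proj
  proof (intro sum.cong refl)
    fix j assume "j \<in> {1..k}"
    then show "norm (if j = 1 then \<nu> else 0) ^ (2 * fact k div j) = (if j = 1 then 1 else 0)"
      using exponent_pos[of j] \<nu>(2) by (cases "j = 1") (simp_all only: if_True if_False power_one norm_zero zero_power simp_thms)
  qed
  also have "\<dots> = 1" using k_pos by simp
  finally show "\<xi> /\<^sub>R norm \<xi> \<in> Kset" by (simp add: Kset_def \<nu>_def)
  assume z: "z \<in> Kset" "z \<noteq> \<xi> /\<^sub>R norm \<xi>"
  have \<xi>\<nu>: "\<xi> \<bullet> (\<xi> /\<^sub>R norm \<xi>) = norm \<xi>" using \<xi> by (simp add: power2_norm_eq_inner[symmetric] power2_eq_square)
  have in1: "\<xi> \<bullet> layer_proj deg 1 z = \<xi> \<bullet> z"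
    using \<xi> unfolding inner_vec_def by (intro sum.cong) (auto simp: layer_proj_def layer_def)
  have one: "1 \<in> {1..k}" using k_pos by simp
  have le1: "norm (layer_proj deg 1 z) \<le> 1" by (rule norm_layer_proj_le[OF z(1) one])
  have CS: "\<xi> \<bullet> layer_proj deg 1 z \<le> norm \<xi> * norm (layer_proj deg 1 z)" by (rule norm_cauchy_schwarz)
  show "\<xi> \<bullet> z < \<xi> \<bullet> (\<xi> /\<^sub>R norm \<xi>)"
  proof (rule ccontr)
    assume "\<not> \<xi> \<bullet> z < \<xi> \<bullet> (\<xi> /\<^sub>R norm \<xi>)"
    then have ge: "norm \<xi> \<le> \<xi> \<bullet> layer_proj deg 1 z" unfolding \<xi>\<nu> in1 by simp
    with CS have "norm \<xi> * 1 \<le> norm \<xi> * norm (layer_proj deg 1 z)" by simp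
    then have n1: "norm (layer_proj deg 1 z) = 1" using le1 \<xi> by simp
    have "\<xi> \<bullet> layer_proj deg 1 z = norm \<xi> * norm (layer_proj deg 1 z)" using ge CS n1 by simp
    then have "norm \<xi> *\<^sub>R layer_proj deg 1 z = norm (layer_proj deg 1 z) *\<^sub>R \<xi>" by (simp add: norm_cauchy_schwarz_eq)
    then have "layer_proj deg 1 z = \<xi> /\<^sub>R norm \<xi>" using n1 \<xi> by (simp add: eq_vector_fraction_iff divideR_right)
    moreover have "layer_proj deg j z = 0" if j: "j \<in> {1..k}" "j \<noteq> 1" for j
    proof (rule ccontr)
      assume "layer_proj deg j z \<noteq> 0"
      then have "0 < norm (layer_proj deg j z) ^ (2 * fact k div j)" by simp
      then have "1 < (\<Sum>i\<in>{1, j}. norm (layer_proj deg i z) ^ (2 * fact k div i))"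
        using n1 j by simp
      also have "\<dots> \<le> gpow z" unfolding gpow_def using j one by (intro sum_mono2) auto
      finally show False using z(1) by (simp add: Kset_def)
    qed
    then have "(\<Sum>j = 1..k. layer_proj deg j z) = (\<Sum>j = 1..k. if j = 1 then layer_proj deg 1 z else 0)"
      by (intro sum.cong) auto
    then have "z = layer_proj deg 1 z" using one sum_layer_proj[of z] by simp
    ultimately show False using z(2) by simp
  qed
qed

end

section \<open>Second-order expansion along left translations\<close>

text \<open>Taylor's formula with Peano remainder. The gradient is assumed differentiable at 0 only,
  so the quadratic polynomial is subtracted along each ray and the derivative of the difference is
  estimated.\<close>

lemma second_order_peano:
  fixes \<psi> :: "real^'n \<Rightarrow> real"
  assumes \<psi>: "open W" "0 \<in> W" "\<And>w. w \<in> W \<Longrightarrow> (\<psi> has_derivative (\<lambda>h. \<Sum>j\<in>UNIV. g j w * h $ j)) (at w)"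
    and g: "\<And>j. (g j has_derivative B j) (at 0)" and \<eta>: "0 < \<eta>"
  shows "\<exists>s>0. \<forall>w. norm w < s \<longrightarrow>
    \<bar>\<psi> w - \<psi> 0 - (\<Sum>j\<in>UNIV. g j 0 * w $ j) - (\<Sum>j\<in>UNIV. B j w * w $ j) / 2\<bar> \<le> \<eta> * (norm w)\<^sup>2"
proof -
  \<comment> \<open>The tolerance is shared among the partial derivatives, whose errors are added up
    below.\<close>
  define \<eta>' where "\<eta>' = \<eta> / CARD('n)"
  have \<eta>': "0 < \<eta>'" using \<eta> by (simp add: \<eta>'_def)
  have lin: "linear (B j)" for j using g has_derivative_bounded_linear bounded_linear.linear by blast
  have "\<forall>\<^sub>F w in nhds 0. \<bar>g j w - g j 0 - B j w\<bar> \<le> \<eta>' * norm w" for j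
    using g[of j] \<eta>' unfolding has_derivative_at_alt eventually_nhds_metric by (auto simp: dist_norm)
  then have "\<forall>\<^sub>F w in nhds 0. \<forall>j\<in>UNIV. \<bar>g j w - g j 0 - B j w\<bar> \<le> \<eta>' * norm w"
    by (intro eventually_ball_finite) auto
  moreover have "\<forall>\<^sub>F w in nhds 0. w \<in> W" using \<psi> by (intro eventually_nhds_in_open)
  ultimately have "\<forall>\<^sub>F w in nhds 0. w \<in> W \<and> (\<forall>j. \<bar>g j w - g j 0 - B j w\<bar> \<le> \<eta>' * norm w)"
    by eventually_elim auto
  then obtain s where s: "0 < s" "\<And>w. norm w < s \<Longrightarrow> w \<in> W \<and> (\<forall>j. \<bar>g j w - g j 0 - B j w\<bar> \<le> \<eta>' * norm w)"
    unfolding eventually_nhds_metric by (auto simp: dist_norm)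
  have "\<bar>\<psi> w - \<psi> 0 - (\<Sum>j\<in>UNIV. g j 0 * w $ j) - (\<Sum>j\<in>UNIV. B j w * w $ j) / 2\<bar> \<le> \<eta> * (norm w)\<^sup>2"
    if w: "norm w < s" for w
  proof -
    \<comment> \<open>By linearity of \<open>B j\<close>, the derivative of \<open>h\<close> is
      \<open>h'\<close>, a combination of the first-order errors of the partial derivatives
      \<open>g j\<close>.\<close>
    define h where "h t = \<psi> (t *\<^sub>R w) - t * (\<Sum>j\<in>UNIV. g j 0 * w $ j) - t\<^sup>2 * ((\<Sum>j\<in>UNIV. B j w * w $ j) / 2)" for t :: real
    define h' where "h' t = (\<Sum>j\<in>UNIV. (g j (t *\<^sub>R w) - g j 0 - B j (t *\<^sub>R w)) * w $ j)" for t
    have small: "norm (t *\<^sub>R w) < s" if "t \<in> {0..1}" for t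
      using that w mult_left_le_one_le[of "norm w" t] by auto
    have d: "(h has_field_derivative h' t) (at t within {0..1})" if t: "t \<in> {0..1}" for t
    proof -
      have "((\<lambda>t. t *\<^sub>R w) has_derivative (\<lambda>t. t *\<^sub>R w)) (at t)"
        by (auto intro!: derivative_eq_intros)
      from has_derivative_compose[OF this \<psi>(3)] small[OF t] s(2)
      have "((\<lambda>t. \<psi> (t *\<^sub>R w)) has_derivative (\<lambda>c. \<Sum>j\<in>UNIV. g j (t *\<^sub>R w) * (c *\<^sub>R w) $ j)) (at t)" by blast
      moreover have "(\<lambda>c. \<Sum>j\<in>UNIV. g j (t *\<^sub>R w) * (c *\<^sub>R w) $ j) = (*) (\<Sum>j\<in>UNIV. g j (t *\<^sub>R w) * w $ j)"
        by (simp add: fun_eq_iff sum_distrib_right sum_distrib_left algebra_simps)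
      ultimately have 1: "((\<lambda>t. \<psi> (t *\<^sub>R w)) has_real_derivative (\<Sum>j\<in>UNIV. g j (t *\<^sub>R w) * w $ j)) (at t)"
        by (simp add: has_field_derivative_def)
      have "(h has_real_derivative (\<Sum>j\<in>UNIV. g j (t *\<^sub>R w) * w $ j) - (\<Sum>j\<in>UNIV. g j 0 * w $ j) - 2 * t * ((\<Sum>j\<in>UNIV. B j w * w $ j) / 2)) (at t)"
        unfolding h_def by (rule derivative_eq_intros 1 refl | simp)+
      also have "(\<Sum>j\<in>UNIV. g j (t *\<^sub>R w) * w $ j) - (\<Sum>j\<in>UNIV. g j 0 * w $ j) - 2 * t * ((\<Sum>j\<in>UNIV. B j w * w $ j) / 2) = h' t"
      proof -
        have "(\<Sum>j\<in>UNIV. B j (t *\<^sub>R w) * w $ j) = t * (\<Sum>j\<in>UNIV. B j w * w $ j)"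
          unfolding linear_scale[OF lin] sum_distrib_left by (simp add: mult.assoc)
        then show ?thesis unfolding h'_def left_diff_distrib sum_subtractf by simp
      qed
      finally show ?thesis by (rule has_field_derivative_at_within)
    qed
    have b: "norm (h' t) \<le> \<eta> * (norm w)\<^sup>2" if t: "t \<in> {0..1}" for t
    proof -
      have "norm (h' t) \<le> (\<Sum>j\<in>UNIV. \<bar>(g j (t *\<^sub>R w) - g j 0 - B j (t *\<^sub>R w)) * w $ j\<bar>)"
        unfolding h'_def real_norm_def by (rule sum_abs)
      also have "\<dots> \<le> (\<Sum>j\<in>(UNIV::'n set). \<eta>' * norm w * norm w)"
      proof (rule sum_mono)
        fix j
        have "\<bar>g j (t *\<^sub>R w) - g j 0 - B j (t *\<^sub>R w)\<bar> \<le> \<eta>' * norm (t *\<^sub>R w)" using s(2)[OF small[OF t]] by blast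
        also have "\<dots> \<le> \<eta>' * norm w" using t \<eta>' by (simp add: mult_left_le_one_le)
        finally show "\<bar>(g j (t *\<^sub>R w) - g j 0 - B j (t *\<^sub>R w)) * w $ j\<bar> \<le> \<eta>' * norm w * norm w"
          unfolding abs_mult using \<eta>' by (intro mult_mono component_le_norm_cart) auto
      qed
      also have "\<dots> = \<eta> * (norm w)\<^sup>2" by (simp add: \<eta>'_def power2_eq_square)
      finally show ?thesis .
    qed
    have "norm (h 1 - h 0) \<le> \<eta> * (norm w)\<^sup>2 * norm (1 - 0 :: real)"
      by (rule field_differentiable_bound[of "{0..1}" h h' _ 1 0, OF _ d b]) auto
    then show ?thesis by (simp add: h_def)
  qed
  with s(1) show ?thesis by blast
qed

lemma uniform_limit_sum:
  fixes f :: "'i \<Rightarrow> 'b \<Rightarrow> 'c \<Rightarrow> real"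
  shows "finite I \<Longrightarrow> (\<And>i. i \<in> I \<Longrightarrow> uniform_limit S (f i) (l i) F) \<Longrightarrow>
    uniform_limit S (\<lambda>\<epsilon> z. \<Sum>i\<in>I. f i \<epsilon> z) (\<lambda>z. \<Sum>i\<in>I. l i z) F"
  by (induction I rule: finite_induct) (auto intro: uniform_limit_const uniform_limit_add)

text \<open>Sorts the terms of an expansion in \<epsilon>: only exponent 0 survives, and boundedness
  of the coefficients makes the limit uniform.\<close>

lemma uniform_limit_power_mult:
  assumes "\<And>z. z \<in> S \<Longrightarrow> \<bar>f z\<bar> \<le> M"
  shows "uniform_limit S (\<lambda>\<epsilon> z. \<epsilon> ^ m * f z) (\<lambda>z. if m = 0 then f z else 0 :: real) (at_right 0)"
proof (cases "m = 0")
  case True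
  then show ?thesis by (simp add: uniform_limit_const)
next
  case False
  have "((\<lambda>\<epsilon>::real. \<bar>\<epsilon>\<bar> ^ m * \<bar>M\<bar>) \<longlongrightarrow> \<bar>0\<bar> ^ m * \<bar>M\<bar>) (at_right 0)"
    by (intro tendsto_intros)
  then have lim: "((\<lambda>\<epsilon>::real. \<bar>\<epsilon>\<bar> ^ m * \<bar>M\<bar>) \<longlongrightarrow> 0) (at_right 0)" using False by (simp add: power_0_left)
  show ?thesis
  proof (rule uniform_limitI)
    fix e :: real assume "0 < e"
    with lim have "\<forall>\<^sub>F \<epsilon> in at_right 0. \<bar>\<epsilon>\<bar> ^ m * \<bar>M\<bar> < e" by (rule order_tendstoD(2))
    then show "\<forall>\<^sub>F \<epsilon> in at_right 0. \<forall>z\<in>S. dist (\<epsilon> ^ m * f z) (if m = 0 then f z else 0) < e"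
    proof eventually_elim
      case (elim \<epsilon>)
      show ?case
      proof
        fix z assume "z \<in> S"
        have "\<bar>f z\<bar> \<le> \<bar>M\<bar>" using assms[OF \<open>z \<in> S\<close>] by linarith
        then have "\<bar>\<epsilon>\<bar> ^ m * \<bar>f z\<bar> \<le> \<bar>\<epsilon>\<bar> ^ m * \<bar>M\<bar>" by (intro mult_left_mono) auto
        then show "dist (\<epsilon> ^ m * f z) (if m = 0 then f z else 0) < e"
          using elim False by (simp add: abs_mult power_abs)
      qed
    qed
  qed
qed

lemma C2_onD:
  assumes "C2_on U f"
  obtains D E where "\<And>y. y \<in> U \<Longrightarrow> (f has_derivative D y) (at y)" "\<And>y. linear (D y)"
    "\<And>y v. y \<in> U \<Longrightarrow> ((\<lambda>y. D y v) has_derivative E y v) (at y)"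
proof -
  obtain f' :: "'a \<Rightarrow> 'a \<Rightarrow>\<^sub>L real" and f'' :: "'a \<Rightarrow> 'a \<Rightarrow>\<^sub>L 'a \<Rightarrow>\<^sub>L real"
    where f: "\<forall>x\<in>U. (f has_derivative blinfun_apply (f' x)) (at x)" "\<forall>x\<in>U. (f' has_derivative blinfun_apply (f'' x)) (at x)"
    using assms unfolding C2_on_def by blast
  show ?thesis
  proof (rule that[of "\<lambda>y. blinfun_apply (f' y)" "\<lambda>y v h. blinfun_apply (blinfun_apply (f'' y) h) v"])
    fix y v assume "y \<in> U"
    then show "(f has_derivative blinfun_apply (f' y)) (at y)" using f(1) by blast
    show "((\<lambda>y. blinfun_apply (f' y) v) has_derivative (\<lambda>h. blinfun_apply (blinfun_apply (f'' y) h) v)) (at y)"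
      using bounded_linear.has_derivative[OF blinfun.bounded_linear_left f(2)[rule_format, OF \<open>y \<in> U\<close>]] .
  next
    show "linear (blinfun_apply (f' y))" for y
      by (intro bounded_linear.linear blinfun.bounded_linear_right)
  qed
qed

lemma linear_component_sum:
  fixes L :: "real^'n \<Rightarrow> real"
  assumes "linear L" shows "L v = (\<Sum>i\<in>UNIV. L (axis i 1) * v $ i)"
proof -
  have "L v = L (\<Sum>i\<in>UNIV. v $ i *\<^sub>R axis i 1)" by (simp add: basis_expansion scalar_mult_eq_scaleR[symmetric])
  also have "\<dots> = (\<Sum>i\<in>UNIV. L (axis i 1) * v $ i)"
    using assms by (simp add: linear_sum linear_scale mult.commute)
  finally show ?thesis .
qed

section \<open>Taylor expansion in left-invariant derivatives\<close>

context carnot_group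
begin

lemma dmul_differentiable:
  "(\<lambda>w. dmul x w v $ i) differentiable (at z)" "(\<lambda>y. dmul y 0 v $ i) differentiable (at y)"
proof -
  obtain G where G: "\<And>w. ((\<lambda>w. dmul (fst w) (snd w) v $ i) has_derivative G w) (at w)"
    using real_polynomial_function_derivative[OF dmul_polynomial] by blast
  have "((\<lambda>w. (x, w)) has_derivative (\<lambda>h. (0, h))) (at z)"
    by (intro has_derivative_Pair has_derivative_const has_derivative_ident)
  from has_derivative_compose[OF this G] show "(\<lambda>w. dmul x w v $ i) differentiable (at z)"
    by (auto simp: differentiable_def)
  have "((\<lambda>y. (y, 0)) has_derivative (\<lambda>h. (h, 0))) (at y)"
    by (intro has_derivative_Pair has_derivative_const has_derivative_ident)
  from has_derivative_compose[OF this G] show "(\<lambda>y. dmul y 0 v $ i) differentiable (at y)"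
    by (auto simp: differentiable_def)
qed

lemma linear_dmul: "linear (dmul x z)"
  using mul_has_derivative has_derivative_bounded_linear bounded_linear.linear by blast

text \<open>By \<open>mul_multiples\<close>, moving on from \<open>mul x (s *\<^sub>R v)\<close> in
  direction \<open>v\<close> is left translation from that point; the velocity of this curve is thus
  the left-invariant field of \<open>v\<close>.\<close>

lemma dmul_shift: "dmul x (s *\<^sub>R v) v = dmul (mul x (s *\<^sub>R v)) 0 v"
proof -
  have d: "((\<lambda>t. mul a (c + t *\<^sub>R v)) has_derivative (\<lambda>t. dmul a c (t *\<^sub>R v))) (at 0)" for a c
  proof -
    have "((\<lambda>t. c + t *\<^sub>R v) has_derivative (\<lambda>t. t *\<^sub>R v)) (at 0)"
      by (auto intro!: derivative_eq_intros)
    moreover have "(mul a has_derivative dmul a c) (at (c + 0 *\<^sub>R v))" using mul_has_derivative by simp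
    ultimately show ?thesis by (rule has_derivative_compose)
  qed
  have "(\<lambda>t. mul x (s *\<^sub>R v + t *\<^sub>R v)) = (\<lambda>t. mul (mul x (s *\<^sub>R v)) (0 + t *\<^sub>R v))"
    by (simp add: mul_multiples scaleR_add_left)
  with d[of x "s *\<^sub>R v"] d[of "mul x (s *\<^sub>R v)" 0]
  have "(\<lambda>t. dmul x (s *\<^sub>R v) (t *\<^sub>R v)) = (\<lambda>t. dmul (mul x (s *\<^sub>R v)) 0 (t *\<^sub>R v))"
    by (metis has_derivative_unique)
  from fun_cong[OF this, of 1] show ?thesis by simp
qed

lemma dmul_zero_eq: "dmul y 0 v = (\<Sum>j\<in>UNIV. v $ j *\<^sub>R jac_field mul j y)"
proof -
  have "dmul y 0 v = dmul y 0 (\<Sum>j\<in>UNIV. v $ j *\<^sub>R axis j 1)"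
    by (simp add: basis_expansion scalar_mult_eq_scaleR[symmetric])
  also have "\<dots> = (\<Sum>j\<in>UNIV. v $ j *\<^sub>R jac_field mul j y)"
    by (simp add: linear_sum[OF linear_dmul] linear_scale[OF linear_dmul] jac_field_eq)
  finally show ?thesis .
qed

text \<open>In coordinates an invariant derivative is a sum of partial derivatives with polynomial
  coefficients, hence differentiable once more when \<phi> is of class C2.\<close>

lemma C2_jac_deriv:
  assumes N: "open N" "C2_on N \<phi>"
  obtains D where "\<And>y. y \<in> N \<Longrightarrow> (\<phi> has_derivative D y) (at y)" "\<And>y. linear (D y)"
    "\<And>y v. y \<in> N \<Longrightarrow> (\<lambda>y. D y v) differentiable (at y)"
    "\<And>y j. y \<in> N \<Longrightarrow> jac_deriv mul j \<phi> y = D y (jac_field mul j y)"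
    "\<And>y j. y \<in> N \<Longrightarrow> jac_deriv mul j \<phi> differentiable (at y)"
proof -
  obtain D E where D: "\<And>y. y \<in> N \<Longrightarrow> (\<phi> has_derivative D y) (at y)" "\<And>y. linear (D y)"
    "\<And>y v. y \<in> N \<Longrightarrow> ((\<lambda>y. D y v) has_derivative E y v) (at y)"
    using C2_onD[OF N(2)] by blast
  have jd: "jac_deriv mul j \<phi> y = D y (jac_field mul j y)" if "y \<in> N" for y j
    unfolding jac_deriv_def using frechet_derivative_at[OF D(1)[OF that]] by simp
  have "jac_deriv mul j \<phi> differentiable (at y)" if y: "y \<in> N" for y j
  proof -
    have "(\<lambda>y. \<Sum>i\<in>UNIV. D y (axis i 1) * dmul y 0 (axis j 1) $ i) differentiable (at y)"
      using D(3)[OF y] by (intro differentiable_sum ballI differentiable_mult dmul_differentiable) (auto simp: differentiable_def)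
    then obtain L where "((\<lambda>y. \<Sum>i\<in>UNIV. D y (axis i 1) * dmul y 0 (axis j 1) $ i) has_derivative L) (at y)"
      by (auto simp: differentiable_def)
    then have "(jac_deriv mul j \<phi> has_derivative L) (at y)"
    proof (rule has_derivative_transform_within_open[OF _ N(1) y])
      fix w assume "w \<in> N"
      show "(\<Sum>i\<in>UNIV. D w (axis i 1) * dmul w 0 (axis j 1) $ i) = jac_deriv mul j \<phi> w"
        unfolding jd[OF \<open>w \<in> N\<close>] jac_field_eq by (rule linear_component_sum[OF D(2), symmetric])
    qed
    then show ?thesis by (auto simp: differentiable_def)
  qed
  moreover have "\<And>y v. y \<in> N \<Longrightarrow> (\<lambda>y. D y v) differentiable (at y)"
    using D(3) by (auto simp: differentiable_def)
  ultimately show ?thesis using that[of D] D jd by blast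
qed

text \<open>Unsymmetrized and over all layers: the Taylor expansion along a left translation
  involves every pair of fields, and passing to its quadratic form symmetrizes anyway.\<close>

definition hder2 :: "(real^'n \<Rightarrow> real) \<Rightarrow> real^'n \<Rightarrow> 'n \<Rightarrow> 'n \<Rightarrow> real" where
  "hder2 \<phi> x i j = jac_deriv mul i (jac_deriv mul j \<phi>) x"

text \<open>A quadratic form sees only the symmetric part of its matrix, so averaging over the two
  orders leaves it unchanged.\<close>

lemma hhess_inner:
  "(hhess deg mul \<phi> x *v z) \<bullet> z =
    (\<Sum>i\<in>UNIV. \<Sum>j\<in>UNIV. if deg i = 1 \<and> deg j = 1 then hder2 \<phi> x i j * (z $ i * z $ j) else 0)"
proof -
  define a where "a i j = (if deg i = 1 \<and> deg j = 1 then hder2 \<phi> x i j * (z $ i * z $ j) else 0)" for i j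
  have "(hhess deg mul \<phi> x *v z) \<bullet> z = (\<Sum>i\<in>UNIV. \<Sum>j\<in>UNIV. hhess deg mul \<phi> x $ i $ j * z $ j * z $ i)"
    by (simp add: inner_vec_def matrix_vector_mult_def sum_distrib_right)
  also have "\<dots> = (\<Sum>i\<in>UNIV. \<Sum>j\<in>UNIV. (a i j + a j i) / 2)"
    by (intro sum.cong refl) (simp add: hhess_def a_def hder2_def algebra_simps)
  also have "\<dots> = ((\<Sum>i\<in>UNIV. \<Sum>j\<in>UNIV. a i j) + (\<Sum>i\<in>UNIV. \<Sum>j\<in>UNIV. a j i)) / 2"
    by (simp add: sum.distrib sum_divide_distrib add_divide_distrib)
  also have "(\<Sum>i\<in>UNIV. \<Sum>j\<in>UNIV. a j i) = (\<Sum>i\<in>UNIV. \<Sum>j\<in>UNIV. a i j)" by (rule sum.swap)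
  finally show ?thesis by (simp add: a_def)
qed

lemma hgrad_in_layer: "hgrad deg mul \<phi> x \<in> layer deg 1"
  by (simp add: layer_def hgrad_def)

text \<open>Since \<open>t \<mapsto> x \<cdot> t v\<close> is a one-parameter group, the second derivative of \<open>\<phi>\<close> along it is the
  quadratic form of the iterated invariant derivatives.\<close>

lemma left_translate_expansion:
  assumes N: "open N" "x \<in> N" "C2_on N \<phi>" and \<eta>: "0 < \<eta>"
  shows "\<exists>s>0. \<forall>w. norm w < s \<longrightarrow>
    \<bar>\<phi> (mul x w) - \<phi> x - (\<Sum>j\<in>UNIV. jac_deriv mul j \<phi> x * w $ j)
      - (\<Sum>i\<in>UNIV. \<Sum>j\<in>UNIV. hder2 \<phi> x i j * (w $ i * w $ j)) / 2\<bar> \<le> \<eta> * (norm w)\<^sup>2"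
proof -
  obtain D where D: "\<And>y. y \<in> N \<Longrightarrow> (\<phi> has_derivative D y) (at y)" "\<And>y. linear (D y)"
    "\<And>y v. y \<in> N \<Longrightarrow> (\<lambda>y. D y v) differentiable (at y)"
    "\<And>y j. y \<in> N \<Longrightarrow> jac_deriv mul j \<phi> y = D y (jac_field mul j y)"
    "\<And>y j. y \<in> N \<Longrightarrow> jac_deriv mul j \<phi> differentiable (at y)"
    using C2_jac_deriv[OF N(1,3)] by blast
  define W where "W = mul x -` N"
  have W: "open W" "0 \<in> W"
    using N by (auto simp: W_def intro!: open_vimage continuous_on_mul)
  \<comment> \<open>The partial derivatives of \<open>\<lambda>w. \<phi> (mul x w)\<close>; at 0
    they are the invariant derivatives of \<phi> at \<open>x\<close>.\<close>
  define g where "g j w = D (mul x w) (dmul x w (axis j 1))" for j w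
  have \<psi>: "((\<lambda>w. \<phi> (mul x w)) has_derivative (\<lambda>h. \<Sum>j\<in>UNIV. g j w * h $ j)) (at w)" if "w \<in> W" for w
  proof -
    have "mul x w \<in> N" using that by (simp add: W_def)
    from has_derivative_compose[OF mul_has_derivative D(1)[OF this]]
    have "((\<lambda>w. \<phi> (mul x w)) has_derivative (\<lambda>h. D (mul x w) (dmul x w h))) (at w)" .
    moreover have lin: "linear (\<lambda>h. D (mul x w) (dmul x w h))"
      using linear_compose[OF linear_dmul D(2)] by (simp add: o_def)
    have "(\<lambda>h. D (mul x w) (dmul x w h)) = (\<lambda>h. \<Sum>j\<in>UNIV. g j w * h $ j)"
      unfolding g_def by (rule ext, rule linear_component_sum[OF lin])
    ultimately show ?thesis by (simp only:)
  qed
  have "g j differentiable (at 0)" for j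
  proof -
    have "g j = (\<lambda>w. \<Sum>i\<in>UNIV. D (mul x w) (axis i 1) * dmul x w (axis j 1) $ i)"
      unfolding g_def by (intro ext linear_component_sum D(2))
    moreover have "(\<lambda>w. D (mul x w) (axis i 1)) differentiable (at 0)" for i
    proof -
      have "(\<lambda>y. D y (axis i 1)) differentiable (at (mul x 0))" using D(3)[OF N(2)] by simp
      then obtain E where "((\<lambda>y. D y (axis i 1)) has_derivative E) (at (mul x 0))" by (auto simp: differentiable_def)
      from has_derivative_compose[OF mul_has_derivative this] show ?thesis by (auto simp: differentiable_def)
    qed
    ultimately show ?thesis
      by (simp only:) (intro differentiable_sum ballI differentiable_mult dmul_differentiable finite)
  qed
  then have "\<forall>j. \<exists>B. (g j has_derivative B) (at 0)" by (simp add: differentiable_def)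
  from choice[OF this] obtain B where B: "\<And>j. (g j has_derivative B j) (at 0)" by blast
  have linB: "linear (B j)" for j using B has_derivative_bounded_linear bounded_linear.linear by blast
  have g0: "g j 0 = jac_deriv mul j \<phi> x" for j
    using N(2) by (simp add: g_def D(4) jac_field_eq)
  \<comment> \<open>Only the quadratic forms are identified. The Euclidean second derivatives
    \<open>B j\<close> and the iterated invariant ones differ entrywise in general, as the fields do
    not commute, but they agree along each ray.\<close>
  have quad: "(\<Sum>j\<in>UNIV. B j v * v $ j) = (\<Sum>i\<in>UNIV. \<Sum>j\<in>UNIV. hder2 \<phi> x i j * (v $ i * v $ j))" for v
  proof -
    have line: "((\<lambda>s. s *\<^sub>R v) has_derivative (\<lambda>s. s *\<^sub>R v)) (at 0)" by (auto intro!: derivative_eq_intros)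
    define L where "L j = frechet_derivative (jac_deriv mul j \<phi>) (at x)" for j
    have L: "(jac_deriv mul j \<phi> has_derivative L j) (at x)" for j
      unfolding L_def using D(5)[OF N(2)] by (simp add: frechet_derivative_works)
    have linL: "linear (L j)" for j using L has_derivative_bounded_linear bounded_linear.linear by blast
    have 1: "((\<lambda>s. \<Sum>j\<in>UNIV. g j (s *\<^sub>R v) * v $ j) has_derivative (\<lambda>s. \<Sum>j\<in>UNIV. B j (s *\<^sub>R v) * v $ j)) (at 0)"
    proof (intro has_derivative_sum has_derivative_mult_left)
      fix j
      have "(g j has_derivative B j) (at (0 *\<^sub>R v))" using B by simp
      from has_derivative_compose[OF line this] show "((\<lambda>s. g j (s *\<^sub>R v)) has_derivative (\<lambda>s. B j (s *\<^sub>R v))) (at 0)" .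
    qed
    have 2: "((\<lambda>s. \<Sum>j\<in>UNIV. jac_deriv mul j \<phi> (mul x (s *\<^sub>R v)) * v $ j) has_derivative
        (\<lambda>s. \<Sum>j\<in>UNIV. L j (dmul x 0 (s *\<^sub>R v)) * v $ j)) (at 0)"
    proof (intro has_derivative_sum has_derivative_mult_left)
      fix j
      have "(mul x has_derivative dmul x 0) (at (0 *\<^sub>R v))" using mul_has_derivative[of x 0] by simp
      note m = has_derivative_compose[OF line this]
      have "(jac_deriv mul j \<phi> has_derivative L j) (at (mul x (0 *\<^sub>R v)))" using L by simp
      from has_derivative_compose[OF m this]
      show "((\<lambda>s. jac_deriv mul j \<phi> (mul x (s *\<^sub>R v))) has_derivative (\<lambda>s. L j (dmul x 0 (s *\<^sub>R v)))) (at 0)" .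
    qed
    \<comment> \<open>Two expressions for the velocity of \<phi> along the one-parameter curve,
      equal near s = 0; differentiating both there gives the two quadratic forms.\<close>
    have eq: "(\<Sum>j\<in>UNIV. g j (s *\<^sub>R v) * v $ j) = (\<Sum>j\<in>UNIV. jac_deriv mul j \<phi> (mul x (s *\<^sub>R v)) * v $ j)"
      if "s *\<^sub>R v \<in> W" for s
    proof -
      define y where "y = mul x (s *\<^sub>R v)"
      have y: "y \<in> N" using that by (simp add: W_def y_def)
      have lin: "linear (\<lambda>h. D y (dmul x (s *\<^sub>R v) h))"
        using linear_compose[OF linear_dmul D(2)] by (simp add: o_def)
      have "(\<Sum>j\<in>UNIV. g j (s *\<^sub>R v) * v $ j) = D y (dmul x (s *\<^sub>R v) v)"
        unfolding g_def y_def[symmetric] by (rule linear_component_sum[OF lin, symmetric])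
      also have "\<dots> = D y (\<Sum>j\<in>UNIV. v $ j *\<^sub>R jac_field mul j y)"
        by (simp add: dmul_shift y_def[symmetric] dmul_zero_eq)
      also have "\<dots> = (\<Sum>j\<in>UNIV. jac_deriv mul j \<phi> y * v $ j)"
        using y by (simp add: linear_sum[OF D(2)] linear_scale[OF D(2)] D(4) mult.commute)
      finally show ?thesis by (simp add: y_def)
    qed
    have "open ((\<lambda>s. s *\<^sub>R v) -` W)" by (intro open_vimage W(1) continuous_intros)
    moreover have "0 \<in> (\<lambda>s. s *\<^sub>R v) -` W" using W(2) by simp
    ultimately have "((\<lambda>s. \<Sum>j\<in>UNIV. jac_deriv mul j \<phi> (mul x (s *\<^sub>R v)) * v $ j) has_derivative (\<lambda>s. \<Sum>j\<in>UNIV. B j (s *\<^sub>R v) * v $ j)) (at 0)"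
      by (rule has_derivative_transform_within_open[OF 1]) (use eq in auto)
    from fun_cong[OF has_derivative_unique[OF this 2], of 1]
    have "(\<Sum>j\<in>UNIV. B j v * v $ j) = (\<Sum>j\<in>UNIV. L j (dmul x 0 v) * v $ j)" by simp
    also have "\<dots> = (\<Sum>j\<in>UNIV. \<Sum>i\<in>UNIV. hder2 \<phi> x i j * (v $ i * v $ j))"
      by (intro sum.cong refl)
        (simp add: dmul_zero_eq linear_sum[OF linL] linear_scale[OF linL] hder2_def jac_deriv_def[of mul _ "jac_deriv mul _ \<phi>"]
          L_def[symmetric] sum_distrib_left sum_distrib_right mult_ac)
    also have "\<dots> = (\<Sum>i\<in>UNIV. \<Sum>j\<in>UNIV. hder2 \<phi> x i j * (v $ i * v $ j))" by (rule sum.swap)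
    finally show ?thesis .
  qed
  show ?thesis using second_order_peano[OF W \<psi> B \<eta>] by (simp add: g0 quad)
qed

text \<open>Under \<open>dil \<epsilon>\<close> a coordinate of degree j is multiplied by \<epsilon>
  to the j. At order \<epsilon> squared there remain the linear terms of degree 2 and the products
  of two first-layer coordinates; beyond the subtracted gradient term, all others carry a higher
  power of \<epsilon>.\<close>

lemma expansion:
  assumes N: "open N" "x \<in> N" "C2_on N \<phi>"
  defines "\<eta> \<equiv> (\<chi> i. if deg i = 2 then jac_deriv mul i \<phi> x else 0)"
  shows "uniform_limit Kset (\<lambda>\<epsilon> z. (\<phi> (Tmap x \<epsilon> z) - \<phi> x - \<epsilon> * (hgrad deg mul \<phi> x \<bullet> z)) / \<epsilon>\<^sup>2)
    (\<lambda>z. \<eta> \<bullet> z + (hhess deg mul \<phi> x *v z) \<bullet> z / 2) (at_right 0)"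
proof -
  define B where "B = hder2 \<phi> x"
  obtain M where M: "\<And>z. z \<in> Kset \<Longrightarrow> norm z \<le> M" "0 < M"
    using compact_imp_bounded[OF compact_Kset] bounded_pos by blast
  have zM: "\<bar>z $ i\<bar> \<le> M" if "z \<in> Kset" for z i
    using component_le_norm_cart[of z i] M(1)[OF that] by linarith
  define G where "G j = jac_deriv mul j \<phi> x" for j
  define R where "R w = \<phi> (mul x w) - \<phi> x - (\<Sum>j\<in>UNIV. G j * w $ j) - (\<Sum>i\<in>UNIV. \<Sum>j\<in>UNIV. B i j * (w $ i * w $ j)) / 2" for w
  have Rlim: "uniform_limit Kset (\<lambda>\<epsilon> z. R (dil \<epsilon> z) / \<epsilon>\<^sup>2) (\<lambda>_. 0) (at_right 0)"
  proof (rule uniform_limitI)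
    fix e :: real assume e: "0 < e"
    \<comment> \<open>Chosen so that the bound \<open>\<epsilon> * M\<close> on
      \<open>norm (dil \<epsilon> z)\<close> turns the remainder into \<open>e / 2\<close> after
      division by \<open>\<epsilon>\<^sup>2\<close>.\<close>
    define e' where "e' = e / (2 * M\<^sup>2)"
    have e': "0 < e'" using e M(2) by (simp add: e'_def)
    obtain s where s: "0 < s" "\<And>w. norm w < s \<Longrightarrow> \<bar>R w\<bar> \<le> e' * (norm w)\<^sup>2"
      using left_translate_expansion[OF N e'] unfolding R_def G_def B_def by blast
    have "\<forall>\<^sub>F \<epsilon>::real in at_right 0. 0 < \<epsilon> \<and> \<epsilon> < min 1 (s / M)"
      using s(1) M(2) by (auto simp: eventually_at_right_field intro!: exI[of _ "min 1 (s / M)"])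
    then show "\<forall>\<^sub>F \<epsilon> in at_right 0. \<forall>z\<in>Kset. dist (R (dil \<epsilon> z) / \<epsilon>\<^sup>2) 0 < e"
    proof eventually_elim
      case (elim \<epsilon>)
      show ?case
      proof
        fix z assume z: "z \<in> Kset"
        have "norm (dil \<epsilon> z) \<le> \<epsilon> * M"
          using norm_dil_le[of \<epsilon> z] elim M(1)[OF z] by (meson mult_left_mono less_imp_le min_less_iff_conj order_trans)
        moreover have "\<epsilon> * M < s" using elim M(2) by (simp add: pos_less_divide_eq)
        ultimately have "\<bar>R (dil \<epsilon> z)\<bar> \<le> e' * (norm (dil \<epsilon> z))\<^sup>2" by (intro s) auto
        also have "\<dots> \<le> e' * (\<epsilon> * M)\<^sup>2"
          using e' \<open>norm (dil \<epsilon> z) \<le> \<epsilon> * M\<close> by (intro mult_left_mono power_mono) auto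
        also have "\<dots> = (e / 2) * \<epsilon>\<^sup>2" using M(2) by (simp add: e'_def power_mult_distrib)
        finally have "\<bar>R (dil \<epsilon> z)\<bar> / \<epsilon>\<^sup>2 \<le> e / 2" using elim by (simp add: divide_le_eq)
        then have "\<bar>R (dil \<epsilon> z)\<bar> / \<epsilon>\<^sup>2 < e" using e by linarith
        then show "dist (R (dil \<epsilon> z) / \<epsilon>\<^sup>2) 0 < e" by simp
      qed
    qed
  qed
  \<comment> \<open>Degree 1 is excluded because it forms the subtracted gradient term, and because
    truncated subtraction would confuse it with degree 2.\<close>
  have lin: "uniform_limit Kset (\<lambda>\<epsilon> z. \<Sum>j\<in>{j. 2 \<le> deg j}. \<epsilon> ^ (deg j - 2) * (G j * z $ j))
      (\<lambda>z. \<Sum>j\<in>{j. 2 \<le> deg j}. if deg j - 2 = 0 then G j * z $ j else 0) (at_right 0)"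
  proof (intro uniform_limit_sum)
    fix j show "uniform_limit Kset (\<lambda>\<epsilon> z. \<epsilon> ^ (deg j - 2) * (G j * z $ j)) (\<lambda>z. if deg j - 2 = 0 then G j * z $ j else 0) (at_right 0)"
      by (rule uniform_limit_power_mult[where M = "\<bar>G j\<bar> * M"]) (auto simp: abs_mult intro!: mult_left_mono zM)
  qed simp
  have quad: "uniform_limit Kset (\<lambda>\<epsilon> z. \<Sum>i\<in>UNIV. \<Sum>j\<in>UNIV. \<epsilon> ^ (deg i + deg j - 2) * (B i j * (z $ i * z $ j) / 2))
      (\<lambda>z. \<Sum>i\<in>UNIV. \<Sum>j\<in>UNIV. if deg i + deg j - 2 = 0 then B i j * (z $ i * z $ j) / 2 else 0) (at_right 0)"
  proof (intro uniform_limit_sum)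
    fix i j
    show "uniform_limit Kset (\<lambda>\<epsilon> z. \<epsilon> ^ (deg i + deg j - 2) * (B i j * (z $ i * z $ j) / 2))
      (\<lambda>z. if deg i + deg j - 2 = 0 then B i j * (z $ i * z $ j) / 2 else 0) (at_right 0)"
      by (rule uniform_limit_power_mult[where M = "\<bar>B i j\<bar> * (M * M) / 2"])
        (auto simp: abs_mult intro!: mult_left_mono mult_mono zM order_less_imp_le[OF M(2)] divide_right_mono)
  qed simp_all
  have deg1: "1 \<le> deg i" for i using deg_range[of i] by simp
  have "uniform_limit Kset (\<lambda>\<epsilon> z. R (dil \<epsilon> z) / \<epsilon>\<^sup>2 + ((\<Sum>j\<in>{j. 2 \<le> deg j}. \<epsilon> ^ (deg j - 2) * (G j * z $ j)) +
       (\<Sum>i\<in>UNIV. \<Sum>j\<in>UNIV. \<epsilon> ^ (deg i + deg j - 2) * (B i j * (z $ i * z $ j) / 2))))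
     (\<lambda>z. 0 + ((\<Sum>j\<in>{j. 2 \<le> deg j}. if deg j - 2 = 0 then G j * z $ j else 0) +
       (\<Sum>i\<in>UNIV. \<Sum>j\<in>UNIV. if deg i + deg j - 2 = 0 then B i j * (z $ i * z $ j) / 2 else 0))) (at_right 0)"
    by (intro uniform_limit_add Rlim lin quad)
  moreover have "\<forall>\<^sub>F \<epsilon> in at_right 0. \<forall>z\<in>Kset.
     R (dil \<epsilon> z) / \<epsilon>\<^sup>2 + ((\<Sum>j\<in>{j. 2 \<le> deg j}. \<epsilon> ^ (deg j - 2) * (G j * z $ j)) +
       (\<Sum>i\<in>UNIV. \<Sum>j\<in>UNIV. \<epsilon> ^ (deg i + deg j - 2) * (B i j * (z $ i * z $ j) / 2))) =
     (\<phi> (Tmap x \<epsilon> z) - \<phi> x - \<epsilon> * (hgrad deg mul \<phi> x \<bullet> z)) / \<epsilon>\<^sup>2"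
    unfolding eventually_at_right_field
  proof (intro exI[of _ 1] conjI allI impI ballI)
    fix \<epsilon> :: real and z assume \<epsilon>: "0 < \<epsilon>"
    have s: "(\<Sum>j\<in>UNIV. G j * dil \<epsilon> z $ j) = (\<Sum>j\<in>{j. deg j = 1}. G j * dil \<epsilon> z $ j) + (\<Sum>j\<in>{j. 2 \<le> deg j}. G j * dil \<epsilon> z $ j)"
    proof (subst sum.union_disjoint[symmetric])
      have "i \<in> {j. deg j = 1} \<union> {j. 2 \<le> deg j}" for i using deg1[of i] by auto
      then show "(\<Sum>j\<in>UNIV. G j * dil \<epsilon> z $ j) = (\<Sum>j\<in>{j. deg j = 1} \<union> {j. 2 \<le> deg j}. G j * dil \<epsilon> z $ j)"
        by (intro sum.cong) auto
    qed auto
    have s1: "(\<Sum>j\<in>{j. deg j = 1}. G j * dil \<epsilon> z $ j) = \<epsilon> * (hgrad deg mul \<phi> x \<bullet> z)"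
      unfolding inner_vec_def hgrad_def sum_distrib_left
      by (intro sum.mono_neutral_cong_left) (auto simp: dil_def G_def)
    have s2: "(\<Sum>j\<in>{j. 2 \<le> deg j}. G j * dil \<epsilon> z $ j) = \<epsilon>\<^sup>2 * (\<Sum>j\<in>{j. 2 \<le> deg j}. \<epsilon> ^ (deg j - 2) * (G j * z $ j))"
      unfolding sum_distrib_left
    proof (intro sum.cong refl)
      fix j assume "j \<in> {j. 2 \<le> deg j}"
      then have "\<epsilon>\<^sup>2 * \<epsilon> ^ (deg j - 2) = \<epsilon> ^ deg j"
        by (simp only: power_add[symmetric] le_add_diff_inverse mem_Collect_eq)
      then show "G j * dil \<epsilon> z $ j = \<epsilon>\<^sup>2 * (\<epsilon> ^ (deg j - 2) * (G j * z $ j))"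
        unfolding mult.assoc[symmetric] by (simp add: dil_def mult_ac)
    qed
    have s3: "(\<Sum>i\<in>UNIV. \<Sum>j\<in>UNIV. B i j * (dil \<epsilon> z $ i * dil \<epsilon> z $ j)) / 2 =
        \<epsilon>\<^sup>2 * (\<Sum>i\<in>UNIV. \<Sum>j\<in>UNIV. \<epsilon> ^ (deg i + deg j - 2) * (B i j * (z $ i * z $ j) / 2))"
      unfolding sum_distrib_left sum_divide_distrib
    proof (intro sum.cong refl)
      fix i j
      have "\<epsilon>\<^sup>2 * \<epsilon> ^ (deg i + deg j - 2) = \<epsilon> ^ deg i * \<epsilon> ^ deg j"
        using add_mono[OF deg1[of i] deg1[of j]]
        by (simp only: power_add[symmetric] le_add_diff_inverse one_add_one)
      then show "B i j * (dil \<epsilon> z $ i * dil \<epsilon> z $ j) / 2 = \<epsilon>\<^sup>2 * (\<epsilon> ^ (deg i + deg j - 2) * (B i j * (z $ i * z $ j) / 2))"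
        unfolding mult.assoc[symmetric] by (simp add: dil_def mult_ac)
    qed
    have alg: "a - b - e = (a - b - (e + c * X) - c * Y) + c * (X + Y)" for a b c e X Y :: real
      by (simp add: algebra_simps)
    have "\<phi> (Tmap x \<epsilon> z) - \<phi> x - \<epsilon> * (hgrad deg mul \<phi> x \<bullet> z) = R (dil \<epsilon> z) +
       \<epsilon>\<^sup>2 * ((\<Sum>j\<in>{j. 2 \<le> deg j}. \<epsilon> ^ (deg j - 2) * (G j * z $ j)) +
       (\<Sum>i\<in>UNIV. \<Sum>j\<in>UNIV. \<epsilon> ^ (deg i + deg j - 2) * (B i j * (z $ i * z $ j) / 2)))"
      unfolding R_def Tmap_def s s1 s2 s3 by (rule alg)
    then show "R (dil \<epsilon> z) / \<epsilon>\<^sup>2 + ((\<Sum>j\<in>{j. 2 \<le> deg j}. \<epsilon> ^ (deg j - 2) * (G j * z $ j)) +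
       (\<Sum>i\<in>UNIV. \<Sum>j\<in>UNIV. \<epsilon> ^ (deg i + deg j - 2) * (B i j * (z $ i * z $ j) / 2))) =
     (\<phi> (Tmap x \<epsilon> z) - \<phi> x - \<epsilon> * (hgrad deg mul \<phi> x \<bullet> z)) / \<epsilon>\<^sup>2"
      using \<epsilon> by (simp only: add_divide_distrib) simp
  qed simp
  moreover have "0 + ((\<Sum>j\<in>{j. 2 \<le> deg j}. if deg j - 2 = 0 then G j * z $ j else 0) +
       (\<Sum>i\<in>UNIV. \<Sum>j\<in>UNIV. if deg i + deg j - 2 = 0 then B i j * (z $ i * z $ j) / 2 else 0)) =
     \<eta> \<bullet> z + (hhess deg mul \<phi> x *v z) \<bullet> z / 2" for z
  proof -
    have "(\<Sum>j\<in>{j. 2 \<le> deg j}. if deg j - 2 = 0 then G j * z $ j else 0) = \<eta> \<bullet> z"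
      unfolding inner_vec_def \<eta>_def by (intro sum.mono_neutral_cong_left) (auto simp: G_def)
    moreover have "(\<Sum>i\<in>UNIV. \<Sum>j\<in>UNIV. if deg i + deg j - 2 = 0 then B i j * (z $ i * z $ j) / 2 else 0) =
       (hhess deg mul \<phi> x *v z) \<bullet> z / 2"
    proof -
      have iff: "deg i + deg j - 2 = 0 \<longleftrightarrow> deg i = 1 \<and> deg j = 1" for i j using deg1[of i] deg1[of j] by linarith
      define v where "v = layer_proj deg 1 z"
      have "(\<Sum>i\<in>UNIV. \<Sum>j\<in>UNIV. if deg i + deg j - 2 = 0 then B i j * (z $ i * z $ j) / 2 else 0) =
          (\<Sum>i\<in>UNIV. \<Sum>j\<in>UNIV. B i j * (v $ i * v $ j)) / 2"
        unfolding iff sum_divide_distrib v_def by (intro sum.cong refl) (auto simp: layer_proj_def)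
      also have "(\<Sum>i\<in>UNIV. \<Sum>j\<in>UNIV. B i j * (v $ i * v $ j)) = (hhess deg mul \<phi> x *v z) \<bullet> z"
        unfolding B_def hhess_inner v_def by (intro sum.cong refl) (auto simp: layer_proj_def)
      finally show ?thesis .
    qed
    ultimately show ?thesis by simp
  qed
  ultimately show ?thesis
    by (subst (asm) uniform_limit_cong) auto
qed

text \<open>Product and chain rule for a power of the squared length \<open>s\<close>, which is
  positive at \<open>x\<close>. Dividing by that power of the norm leaves the trace plus p - 2 times
  the second derivative in the direction of the gradient.\<close>

lemma normalized_plap_finite:
  assumes N: "open N" "x \<in> N" "C2_on N \<phi>" and G0: "hgrad deg mul \<phi> x \<noteq> 0"
  shows "normalized_plap deg mul (ereal p) \<phi> x = (\<Sum>i\<in>UNIV. hhess deg mul \<phi> x $ i $ i) +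
    (p - 2) * ((hhess deg mul \<phi> x *v hgrad deg mul \<phi> x) \<bullet> hgrad deg mul \<phi> x) / (hgrad deg mul \<phi> x \<bullet> hgrad deg mul \<phi> x)"
proof -
  define q where "q = p - 2"
  define L where "L j = frechet_derivative (jac_deriv mul j \<phi>) (at x)" for j
  have L: "(jac_deriv mul j \<phi> has_derivative L j) (at x)" for j
    using C2_jac_deriv[OF N(1,3)] N(2) unfolding L_def frechet_derivative_works[symmetric] by metis
  define G where "G y i = hgrad deg mul \<phi> y $ i" for y i
  \<comment> \<open>Components outside the first layer are identically zero in \<open>hgrad\<close>,
    so their derivative is the zero map.\<close>
  define L' where "L' i = (if deg i = 1 then L i else (\<lambda>_. 0))" for i
  have G: "((\<lambda>y. G y i) has_derivative L' i) (at x)" for i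
    using L[of i] by (simp add: G_def hgrad_def L'_def eta_contract_eq)
  define s where "s y = (\<Sum>j\<in>UNIV. G y j * G y j)" for y
  have snorm: "norm (hgrad deg mul \<phi> y) = sqrt (s y)" for y
    by (simp add: norm_eq_sqrt_inner s_def inner_vec_def G_def)
  have s: "(s has_derivative (\<lambda>h. 2 * (\<Sum>j\<in>UNIV. G x j * L' j h))) (at x)"
  proof -
    have "(s has_derivative (\<lambda>h. \<Sum>j\<in>UNIV. G x j * L' j h + L' j h * G x j)) (at x)"
      unfolding s_def by (intro has_derivative_sum has_derivative_mult G)
    then show ?thesis by (simp add: sum_distrib_left mult.commute)
  qed
  have s0: "0 < s x" using G0 snorm[of x] by (metis real_sqrt_gt_0_iff zero_less_norm_iff)
  have pw: "sqrt t powr q = t powr (q / 2)" if "0 \<le> t" for t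
    using that by (simp add: powr_half_sqrt[symmetric] powr_powr)
  have snn: "0 \<le> s y" for y unfolding s_def by (intro sum_nonneg) auto
  define F where "F i y = s y powr (q / 2) * G y i" for i y
  have F: "(\<lambda>y. ((norm (hgrad deg mul \<phi> y) powr q) *\<^sub>R hgrad deg mul \<phi> y) $ i) = F i" for i
    by (simp add: F_def snorm pw[OF snn] G_def fun_eq_iff)
  have P: "((\<lambda>y. s y powr (q / 2)) has_derivative (\<lambda>h. q / 2 * s x powr (q / 2 - 1) * (2 * (\<Sum>j\<in>UNIV. G x j * L' j h)))) (at x)"
  proof -
    have "((\<lambda>t. t powr (q / 2)) has_derivative (*) (q / 2 * s x powr (q / 2 - 1))) (at (s x))"
      using has_real_derivative_powr[OF s0, of "q / 2"] by (simp add: has_field_derivative_def)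
    from has_derivative_compose[OF s this] show ?thesis .
  qed
  have dF: "jac_deriv mul i (F i) x = s x powr (q / 2) * (L' i (jac_field mul i x)) +
      q * s x powr (q / 2 - 1) * (\<Sum>j\<in>UNIV. G x j * L' j (jac_field mul i x)) * G x i" for i
  proof -
    have "(F i has_derivative (\<lambda>h. s x powr (q / 2) * L' i h +
        q / 2 * s x powr (q / 2 - 1) * (2 * (\<Sum>j\<in>UNIV. G x j * L' j h)) * G x i)) (at x)"
      unfolding F_def by (intro has_derivative_mult P G)
    from frechet_derivative_at[OF this, symmetric] show ?thesis by (simp add: jac_deriv_def)
  qed
  have hd: "L j (jac_field mul i x) = hder2 \<phi> x i j" for i j
    by (simp add: hder2_def jac_deriv_def[of mul i] L_def)
  have q1: "s x powr (q / 2 - 1) = s x powr (q / 2) / s x"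
    using s0 by (simp add: powr_diff)
  have "hdiv deg mul (\<lambda>y. (norm (hgrad deg mul \<phi> y) powr q) *\<^sub>R hgrad deg mul \<phi> y) x =
      (\<Sum>i | deg i = 1. s x powr (q / 2) * (hder2 \<phi> x i i + q / s x * (\<Sum>j\<in>UNIV. G x j * L' j (jac_field mul i x)) * G x i))"
    unfolding hdiv_def F dF
    by (intro sum.cong refl) (simp add: q1 L'_def hd algebra_simps)
  also have "\<dots> = s x powr (q / 2) * ((\<Sum>i | deg i = 1. hder2 \<phi> x i i) +
      q / s x * (\<Sum>i | deg i = 1. (\<Sum>j\<in>UNIV. G x j * L' j (jac_field mul i x)) * G x i))"
    by (simp only: sum_distrib_left[symmetric] sum.distrib mult.assoc)
  also have "(\<Sum>i | deg i = 1. hder2 \<phi> x i i) = (\<Sum>i\<in>UNIV. hhess deg mul \<phi> x $ i $ i)"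
    by (intro sum.mono_neutral_cong_left) (auto simp: hhess_def hder2_def)
  also have "(\<Sum>i | deg i = 1. (\<Sum>j\<in>UNIV. G x j * L' j (jac_field mul i x)) * G x i) =
      (hhess deg mul \<phi> x *v hgrad deg mul \<phi> x) \<bullet> hgrad deg mul \<phi> x"
    unfolding hhess_inner sum_distrib_right
    by (intro sum.mono_neutral_cong_left) (auto simp: L'_def hd G_def intro!: sum.cong)
  also have "s x = hgrad deg mul \<phi> x \<bullet> hgrad deg mul \<phi> x"
    by (simp add: s_def inner_vec_def G_def)
  finally have H: "hdiv deg mul (\<lambda>y. (norm (hgrad deg mul \<phi> y) powr q) *\<^sub>R hgrad deg mul \<phi> y) x =
    s x powr (q / 2) * ((\<Sum>i\<in>UNIV. hhess deg mul \<phi> x $ i $ i) + q / (hgrad deg mul \<phi> x \<bullet> hgrad deg mul \<phi> x) *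
      ((hhess deg mul \<phi> x *v hgrad deg mul \<phi> x) \<bullet> hgrad deg mul \<phi> x))"
    by (simp add: s_def inner_vec_def G_def)
  show ?thesis
    using s0 H by (simp add: normalized_plap_def q_def[symmetric] snorm pw[OF snn])
qed

lemma normalized_plap_infinity:
  "normalized_plap deg mul \<infinity> \<phi> x =
    (hhess deg mul \<phi> x *v (hgrad deg mul \<phi> x /\<^sub>R norm (hgrad deg mul \<phi> x))) \<bullet> (hgrad deg mul \<phi> x /\<^sub>R norm (hgrad deg mul \<phi> x))"
  by (simp add: normalized_plap_def Let_def)

text \<open>Joins the expansion on the unit ball to the two descriptions of the best constant. The
  proof produces \<open>cross_moment / 2 / wint (\<lambda>_. 1)\<close> as \<kappa> for finite p and
  1/2 for infinite p.\<close>

lemma mu_p_expansion: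
  assumes N: "open N" "x \<in> N" "C2_on N \<phi>" and G0: "hgrad deg mul \<phi> x \<noteq> 0" and p: "1 < p" "p \<le> (\<infinity>::ereal)"
  shows "\<exists>\<kappa>>0. ((\<lambda>\<epsilon>. (\<phi> x - mu_p k deg mul p \<epsilon> \<phi> x) / \<epsilon>\<^sup>2) \<longlongrightarrow> - (\<kappa> * normalized_plap deg mul p \<phi> x)) (at_right 0)"
proof -
  define \<xi> where "\<xi> = hgrad deg mul \<phi> x"
  define H where "H = hhess deg mul \<phi> x"
  define \<eta> :: "real^'n" where "\<eta> = (\<chi> i. if deg i = 2 then jac_deriv mul i \<phi> x else 0)"
  define q where "q z = \<eta> \<bullet> z + (H *v z) \<bullet> z / 2" for z
  define r where "r \<epsilon> z = (\<phi> (Tmap x \<epsilon> z) - \<phi> x - \<epsilon> * (\<xi> \<bullet> z)) / \<epsilon>\<^sup>2" for \<epsilon> z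
  have r: "uniform_limit Kset r q (at_right 0)"
    using expansion[OF N] unfolding r_def[abs_def] q_def[abs_def] \<xi>_def H_def \<eta>_def .
  have qc: "continuous_on Kset q"
    unfolding q_def by (intro continuous_intros linear_continuous_on linear_conv_bounded_linear[THEN iffD1] matrix_vector_mul_linear) auto
  have \<xi>: "\<xi> \<in> layer deg 1" "\<xi> \<noteq> 0" using hgrad_in_layer G0 by (auto simp: \<xi>_def)
  have \<eta>: "\<eta> \<in> layer deg 2" by (simp add: layer_def \<eta>_def)
  have orth: "\<eta> \<bullet> v = 0" if "v \<in> layer deg 1" for v
    unfolding inner_vec_def using that by (intro sum.neutral) (auto simp: \<eta>_def layer_def)
  have \<phi>c: "continuous_on N \<phi>"
    using C2_onD[OF N(3)] by (metis continuous_at_imp_continuous_on has_derivative_continuous)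
  have inN: "\<forall>\<^sub>F \<epsilon> in at_right 0. Tmap x \<epsilon> ` Kset \<subseteq> N"
  proof -
    obtain M where M: "\<And>z. z \<in> Kset \<Longrightarrow> norm z \<le> M" "0 < M"
      using compact_imp_bounded[OF compact_Kset] bounded_pos by blast
    have "open (mul x -` N)" "0 \<in> mul x -` N" using N by (auto intro!: open_vimage continuous_on_mul)
    then obtain s where s: "0 < s" "ball 0 s \<subseteq> mul x -` N" by (meson open_contains_ball)
    show ?thesis unfolding eventually_at_right_field
    proof (intro exI[of _ "min 1 (s / M)"] conjI allI impI image_subsetI)
      fix \<epsilon> z assume \<epsilon>: "0 < \<epsilon>" "\<epsilon> < min 1 (s / M)" and z: "z \<in> Kset"
      have "norm (dil \<epsilon> z) \<le> \<epsilon> * norm z" using \<epsilon> by (intro norm_dil_le) auto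
      also have "\<dots> \<le> \<epsilon> * M" using \<epsilon> M(1)[OF z] by simp
      also have "\<dots> < s" using \<epsilon> M(2) by (simp add: pos_less_divide_eq)
      finally have "dil \<epsilon> z \<in> mul x -` N" using s(2) by auto
      then show "Tmap x \<epsilon> z \<in> N" by (simp add: Tmap_def)
    qed (use s M in auto)
  qed
  have pos: "\<forall>\<^sub>F \<epsilon> in at_right 0. (0::real) < \<epsilon>" by (auto simp: eventually_at_right_field intro: exI[of _ 1])
  have rc: "continuous_on Kset (r \<epsilon>)" if "Tmap x \<epsilon> ` Kset \<subseteq> N" "0 < \<epsilon>" for \<epsilon>
    unfolding r_def using that
    by (intro continuous_intros continuous_on_compose2[OF \<phi>c continuous_on_Tmap]) auto
  have val: "\<phi> (Tmap x \<epsilon> z) = \<phi> x + \<epsilon> * (\<xi> \<bullet> z + \<epsilon> * r \<epsilon> z)" if "0 < \<epsilon>" for \<epsilon> z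
    using that by (simp add: r_def field_simps power2_eq_square)
  have cpt: "compact (Tmap x \<epsilon> ` Kset)" for \<epsilon>
    by (intro compact_continuous_image continuous_on_Tmap compact_Kset)
  have sub: "Tmap x \<epsilon> ` Uset \<subseteq> Tmap x \<epsilon> ` Kset" for \<epsilon> by (intro image_mono) (auto simp: Uset_def Kset_def)
  have mu: "\<forall>\<^sub>F \<epsilon> in at_right 0. (\<phi> x - best_const p (Tmap x \<epsilon> ` Kset) \<phi>) / \<epsilon>\<^sup>2 = (\<phi> x - mu_p k deg mul p \<epsilon> \<phi> x) / \<epsilon>\<^sup>2"
    using pos by eventually_elim (simp add: mu_p_def best_const_def closure_gball)
  show ?thesis
  proof (cases p)
    case (real p')
    then have p': "1 < p'" using p by simp
    interpret reflection_invariant Kset "layer deg 1" \<xi> p'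
    proof
      show "emeasure lborel Kset \<noteq> 0"
        by (rule emeasure_nonzero[OF open_Uset _ _ compact_Kset]) (use zero_in_Uset in \<open>auto simp: Uset_def Kset_def\<close>)
    qed (use p' compact_Kset subspace_layer hreflect_Kset \<xi> in auto)
    have "\<forall>\<^sub>F \<epsilon> in at_right 0. compact (Tmap x \<epsilon> ` Kset) \<and> emeasure lborel (Tmap x \<epsilon> ` Kset) \<noteq> 0 \<and>
      continuous_on (Tmap x \<epsilon> ` Kset) \<phi> \<and> continuous_on Kset (r \<epsilon>) \<and>
      (\<exists>J>0. \<forall>a. (LINT y:Tmap x \<epsilon> ` Kset|lborel. spow p' (\<phi> y - a)) =
        J * (LINT z:Kset|lborel. spow p' (\<phi> x + \<epsilon> * (\<xi> \<bullet> z + \<epsilon> * r \<epsilon> z) - a)))"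
      using inN pos
    proof eventually_elim
      case (elim \<epsilon>)
      have c: "continuous_on (Tmap x \<epsilon> ` Kset) \<phi>" using \<phi>c elim(1) by (rule continuous_on_subset)
      obtain J where J: "0 < J" "\<And>g::real^'n \<Rightarrow> real. continuous_on (Tmap x \<epsilon> ` Kset) g \<Longrightarrow>
        (LINT y:Tmap x \<epsilon> ` Kset|lborel. g y) = J * (LINT z:Kset|lborel. g (Tmap x \<epsilon> z))"
        using Tmap_integral[OF elim(2), of x] by blast
      have "(LINT y:Tmap x \<epsilon> ` Kset|lborel. spow p' (\<phi> y - a)) =
        J * (LINT z:Kset|lborel. spow p' (\<phi> x + \<epsilon> * (\<xi> \<bullet> z + \<epsilon> * r \<epsilon> z) - a))" for a
        unfolding val[OF elim(2), symmetric] by (intro J continuous_intros p' c)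
      moreover have "emeasure lborel (Tmap x \<epsilon> ` Kset) \<noteq> 0"
        by (rule emeasure_nonzero[OF open_Tmap_Uset[OF elim(2)] _ sub cpt]) (use zero_in_Uset in auto)
      ultimately show ?case using J(1) c cpt rc elim by blast
    qed
    from p_mean_expansion[OF r qc this] 
    have lim: "((\<lambda>\<epsilon>. (\<phi> x - mu_p k deg mul p \<epsilon> \<phi> x) / \<epsilon>\<^sup>2) \<longlongrightarrow> - (wint q / wint (\<lambda>_. 1))) (at_right 0)"
      unfolding real[symmetric] by (rule Lim_transform_eventually) (rule mu)
    have "wint q = cross_moment / 2 * normalized_plap deg mul p \<phi> x"
      unfolding q_def[abs_def] real normalized_plap_finite[OF N G0] \<xi>_def[symmetric] H_def[symmetric]
    proof (rule wint_quadratic)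
      show "axis i 1 \<in> layer deg 1 \<and> axis j 1 \<in> layer deg 1" if "H $ i $ j \<noteq> 0" for i j
        using that by (auto simp: H_def hhess_def layer_def axis_def split: if_splits)
    qed (use \<eta> orth \<xi> hreflect_Kset in auto)
    then have "wint q / wint (\<lambda>_. 1) = cross_moment / 2 / wint (\<lambda>_. 1) * normalized_plap deg mul p \<phi> x"
      by (simp only:) simp
    with lim show ?thesis
      using cross_moment_pos wint_one_pos by (intro exI[of _ "cross_moment / 2 / wint (\<lambda>_. 1)"]) (simp only: zero_less_divide_iff zero_less_numeral simp_thms)
  next
    case PInf
    define \<nu> where "\<nu> = \<xi> /\<^sub>R norm \<xi>"
    have m\<xi>: "- \<xi> \<in> layer deg 1" "- \<xi> \<noteq> 0" using \<xi> subspace_neg[OF subspace_layer] by auto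
    have \<nu>: "\<nu> \<in> Kset" "\<And>z. z \<in> Kset \<Longrightarrow> z \<noteq> \<nu> \<Longrightarrow> \<xi> \<bullet> z < \<xi> \<bullet> \<nu>"
      using Kset_inner_max[OF \<xi>] unfolding \<nu>_def by blast+
    have \<nu>'1: "- \<nu> \<in> Kset"
      using Kset_inner_max(1)[OF m\<xi>] by (simp add: \<nu>_def)
    have \<nu>'2: "\<xi> \<bullet> - \<nu> < \<xi> \<bullet> z" if "z \<in> Kset" "z \<noteq> - \<nu>" for z
    proof -
      have "- (\<xi> \<bullet> z) < \<xi> \<bullet> \<nu>"
        using Kset_inner_max(2)[OF m\<xi> that(1)] that(2) by (simp add: \<nu>_def)
      then show ?thesis by simp
    qed
    have "\<forall>\<^sub>F \<epsilon> in at_right 0. compact (Tmap x \<epsilon> ` Kset) \<and> continuous_on (Tmap x \<epsilon> ` Kset) \<phi> \<and>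
      Tmap x \<epsilon> ` Kset = Tmap x \<epsilon> ` Kset \<and>
      (\<exists>U. open U \<and> U \<subseteq> Tmap x \<epsilon> ` Kset \<and> Tmap x \<epsilon> ` Kset \<subseteq> closure U) \<and>
      (\<forall>z\<in>Kset. \<phi> (Tmap x \<epsilon> z) = \<phi> x + \<epsilon> * (\<xi> \<bullet> z + \<epsilon> * r \<epsilon> z))"
      using inN pos
    proof eventually_elim
      case (elim \<epsilon>)
      have c: "continuous_on (Tmap x \<epsilon> ` Kset) \<phi>" using \<phi>c elim(1) by (rule continuous_on_subset)
      have "Tmap x \<epsilon> ` Kset \<subseteq> closure (Tmap x \<epsilon> ` Uset)"
        unfolding closure_gball[OF elim(2), symmetric] gball_eq[OF elim(2)] by (rule order_refl)
      then show ?case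
        by (intro conjI exI[of _ "Tmap x \<epsilon> ` Uset"] ballI cpt c refl sub open_Tmap_Uset val elim(2))
    qed
    from infinity_mean_expansion[OF compact_Kset r qc _ \<nu> \<nu>'1 \<nu>'2 _ this]
    have "((\<lambda>\<epsilon>. (\<phi> x - best_const \<infinity> (Tmap x \<epsilon> ` Kset) \<phi>) / \<epsilon>\<^sup>2) \<longlongrightarrow> - ((q \<nu> + q (- \<nu>)) / 2)) (at_right 0)"
      by (simp add: continuous_intros)
    then have lim: "((\<lambda>\<epsilon>. (\<phi> x - mu_p k deg mul p \<epsilon> \<phi> x) / \<epsilon>\<^sup>2) \<longlongrightarrow> - ((q \<nu> + q (- \<nu>)) / 2)) (at_right 0)"
      unfolding PInf[symmetric] by (rule Lim_transform_eventually) (rule mu)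
    have "\<nu> \<in> layer deg 1" using \<xi> subspace_scale[OF subspace_layer] by (auto simp: \<nu>_def)
    \<comment> \<open>The linear form cancels between the antipodal points and the quadratic form
      takes the same value at both, so half the second derivative in direction \<nu> is
      left.\<close>
    then have "(q \<nu> + q (- \<nu>)) / 2 = 1 / 2 * ((H *v \<nu>) \<bullet> \<nu>)"
      using orth linear_neg[OF matrix_vector_mul_linear[of H]] by (simp add: q_def)
    also have "(H *v \<nu>) \<bullet> \<nu> = normalized_plap deg mul p \<phi> x"
      by (simp add: PInf normalized_plap_infinity H_def \<nu>_def \<xi>_def)
    finally have "((\<lambda>\<epsilon>. (\<phi> x - mu_p k deg mul p \<epsilon> \<phi> x) / \<epsilon>\<^sup>2) \<longlongrightarrow> - (1 / 2 * normalized_plap deg mul p \<phi> x)) (at_right 0)"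
      using lim by (simp only:)
    then show ?thesis by (intro exI[of _ "1 / 2"]) simp
  qed (use p in simp)
qed

end

section \<open>Twice continuously differentiable test functions\<close>

lemma C2_on_subset: "C2_on U f \<Longrightarrow> V \<subseteq> U \<Longrightarrow> C2_on V f"
  unfolding C2_on_def by (meson continuous_on_subset subset_iff)

lemma C2_on_cong:
  assumes "open U" "C2_on U f" "\<And>x. x \<in> U \<Longrightarrow> g x = f x"
  shows "C2_on U g"
proof -
  obtain f' f'' where f: "\<And>x. x \<in> U \<Longrightarrow> (f has_derivative blinfun_apply (f' x)) (at x)"
    "\<forall>x\<in>U. (f' has_derivative blinfun_apply (f'' x)) (at x)" "continuous_on U f''"
    using assms(2) unfolding C2_on_def by blast
  have "(g has_derivative blinfun_apply (f' x)) (at x)" if "x \<in> U" for x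
    using has_derivative_transform_within_open[OF f(1)[OF that] assms(1) that] assms(3) by metis
  with f show ?thesis unfolding C2_on_def by blast
qed

text \<open>Derivatives are unique, so \<open>frechet_derivative\<close> selects one global pair of
  derivative fields that agrees with every local choice.\<close>

lemma C2_on_local:
  assumes U: "open U" and loc: "\<And>x. x \<in> U \<Longrightarrow> \<exists>V. open V \<and> x \<in> V \<and> C2_on V f"
  shows "C2_on U f"
proof -
  define f' where "f' x = Blinfun (frechet_derivative f (at x))" for x
  define f'' where "f'' x = Blinfun (frechet_derivative f' (at x))" for x
  have *: "(f has_derivative blinfun_apply (f' x)) (at x) \<and> (f' has_derivative blinfun_apply (f'' x)) (at x) \<and> isCont f'' x"
    if x: "x \<in> U" for x
  proof -
    obtain V where V: "open V" "x \<in> V" "C2_on V f" using loc[OF x] by blast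
    obtain g' g'' where g: "\<And>x. x \<in> V \<Longrightarrow> (f has_derivative blinfun_apply (g' x)) (at x)"
      "\<And>x. x \<in> V \<Longrightarrow> (g' has_derivative blinfun_apply (g'' x)) (at x)" "continuous_on V g''"
      using V(3) unfolding C2_on_def by blast
    have 1: "f' y = g' y" if "y \<in> V" for y
      unfolding f'_def frechet_derivative_at[OF g(1)[OF that], symmetric] by (simp add: blinfun_apply_inverse)
    have 2: "(f' has_derivative blinfun_apply (g'' y)) (at y)" if "y \<in> V" for y
      using has_derivative_transform_within_open[OF g(2)[OF that] V(1) that] 1 by metis
    have 3: "f'' y = g'' y" if "y \<in> V" for y
      unfolding f''_def frechet_derivative_at[OF 2[OF that], symmetric] by (simp add: blinfun_apply_inverse)
    have "continuous_on V f''" using g(3) 3 by (simp cong: continuous_on_cong)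
    then have "isCont f'' x" using V by (simp add: continuous_on_eq_continuous_at)
    then show ?thesis using g(1) 1 2 3 V(2) by auto
  qed
  then show ?thesis unfolding C2_on_def
    by (intro exI[of _ f'] exI[of _ f'']) (auto intro: continuous_at_imp_continuous_on)
qed

lemma C2_on_const: "C2_on U (\<lambda>_. c)"
  unfolding C2_on_def by (intro exI[of _ "\<lambda>_. 0"]) (auto simp: zero_blinfun.rep_eq)

lemma C2_on_add:
  assumes "C2_on U f" "C2_on U g" shows "C2_on U (\<lambda>x. f x + g x)"
proof -
  obtain f' f'' g' g'' where "\<forall>x\<in>U. (f has_derivative blinfun_apply (f' x)) (at x)"
    "\<forall>x\<in>U. (f' has_derivative blinfun_apply (f'' x)) (at x)" "continuous_on U f''"
    "\<forall>x\<in>U. (g has_derivative blinfun_apply (g' x)) (at x)"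
    "\<forall>x\<in>U. (g' has_derivative blinfun_apply (g'' x)) (at x)" "continuous_on U g''"
    using assms unfolding C2_on_def by blast
  then show ?thesis unfolding C2_on_def
    by (intro exI[of _ "\<lambda>x. f' x + g' x"] exI[of _ "\<lambda>x. f'' x + g'' x"])
      (auto intro!: derivative_eq_intros continuous_intros simp: blinfun.add_left)
qed

lemma C2_on_sum: "finite I \<Longrightarrow> (\<And>i. i \<in> I \<Longrightarrow> C2_on U (f i)) \<Longrightarrow> C2_on U (\<lambda>x. \<Sum>i\<in>I. f i x)"
  by (induction I rule: finite_induct) (auto intro: C2_on_add C2_on_const)

text \<open>The rank-one bilinear form built from two functionals, for the cross terms of the
  product rule for second derivatives.\<close>

definition bl_outer :: "('a::real_normed_vector \<Rightarrow>\<^sub>L real) \<Rightarrow> ('a \<Rightarrow>\<^sub>L real) \<Rightarrow> 'a \<Rightarrow>\<^sub>L 'a \<Rightarrow>\<^sub>L real" where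
  "bl_outer a b = blinfun_scaleR_left b o\<^sub>L a"

lemma bl_outer_apply: "blinfun_apply (bl_outer a b) h = blinfun_apply a h *\<^sub>R b"
  by (simp add: bl_outer_def)

lemma C2_on_mult:
  assumes "C2_on U f" "C2_on U g" shows "C2_on U (\<lambda>x. f x * g x)"
proof -
  obtain f' f'' g' g'' where f: "\<And>x. x \<in> U \<Longrightarrow> (f has_derivative blinfun_apply (f' x)) (at x)"
    "\<And>x. x \<in> U \<Longrightarrow> (f' has_derivative blinfun_apply (f'' x)) (at x)" "continuous_on U f''"
    and g: "\<And>x. x \<in> U \<Longrightarrow> (g has_derivative blinfun_apply (g' x)) (at x)"
    "\<And>x. x \<in> U \<Longrightarrow> (g' has_derivative blinfun_apply (g'' x)) (at x)" "continuous_on U g''"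
    using assms unfolding C2_on_def by blast
  define D where "D x = f x *\<^sub>R g' x + g x *\<^sub>R f' x" for x
  define E where "E x = f x *\<^sub>R g'' x + bl_outer (f' x) (g' x) + g x *\<^sub>R f'' x + bl_outer (g' x) (f' x)" for x
  have 1: "((\<lambda>x. f x * g x) has_derivative blinfun_apply (D x)) (at x)" if "x \<in> U" for x
    by (rule has_derivative_eq_rhs[OF has_derivative_mult[OF f(1)[OF that] g(1)[OF that]]])
      (simp add: D_def fun_eq_iff blinfun.add_left blinfun.scaleR_left)
  have 2: "(D has_derivative blinfun_apply (E x)) (at x)" if "x \<in> U" for x
    unfolding D_def
    by (rule has_derivative_eq_rhs[OF has_derivative_add[OF has_derivative_scaleR[OF f(1)[OF that] g(2)[OF that]] has_derivative_scaleR[OF g(1)[OF that] f(2)[OF that]]]])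
      (simp add: E_def fun_eq_iff blinfun.add_left blinfun.scaleR_left bl_outer_apply)
  have cont: "continuous_on U f" "continuous_on U g" "continuous_on U f'" "continuous_on U g'"
    using f(1,2) g(1,2) has_derivative_continuous by (blast intro: continuous_at_imp_continuous_on)+
  have "continuous_on U (\<lambda>x. bl_outer (a x) (b x))" if "continuous_on U a" "continuous_on U b" for a b :: "'a \<Rightarrow> 'a \<Rightarrow>\<^sub>L real"
    unfolding bl_outer_def using that
    by (intro bounded_bilinear.continuous_on[OF bounded_bilinear_blinfun_compose]
        bounded_linear.continuous_on[OF bounded_linear_blinfun_scaleR_left])
  then have "continuous_on U E" unfolding E_def using cont f(3) g(3) by (intro continuous_intros)
  with 1 2 show ?thesis unfolding C2_on_def by blast
qed

lemma C2_on_compose: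
  assumes f: "C2_on U f" and b: "\<And>t. (b has_real_derivative b' t) (at t)" "\<And>t. (b' has_real_derivative b'' t) (at t)"
    "continuous_on UNIV b''"
  shows "C2_on U (\<lambda>x. b (f x))"
proof -
  obtain f' f'' where f: "\<And>x. x \<in> U \<Longrightarrow> (f has_derivative blinfun_apply (f' x)) (at x)"
    "\<And>x. x \<in> U \<Longrightarrow> (f' has_derivative blinfun_apply (f'' x)) (at x)" "continuous_on U f''"
    using assms(1) unfolding C2_on_def by blast
  define D where "D x = b' (f x) *\<^sub>R f' x" for x
  define E where "E x = b' (f x) *\<^sub>R f'' x + bl_outer (b'' (f x) *\<^sub>R f' x) (f' x)" for x
  have 1: "((\<lambda>x. b (f x)) has_derivative blinfun_apply (D x)) (at x)" if "x \<in> U" for x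
    by (rule has_derivative_eq_rhs[OF has_derivative_compose[OF f(1)[OF that] b(1)[of "f x", unfolded has_field_derivative_def]]])
      (simp add: D_def fun_eq_iff blinfun.scaleR_left)
  have "((\<lambda>x. b' (f x)) has_derivative (\<lambda>h. b'' (f x) * blinfun_apply (f' x) h)) (at x)" if "x \<in> U" for x
    using has_derivative_compose[OF f(1)[OF that] b(2)[of "f x", unfolded has_field_derivative_def]] .
  note b'f = this
  have 2: "(D has_derivative blinfun_apply (E x)) (at x)" if "x \<in> U" for x
    unfolding D_def
    by (rule has_derivative_eq_rhs[OF has_derivative_scaleR[OF b'f[OF that] f(2)[OF that]]])
      (simp add: E_def fun_eq_iff blinfun.add_left blinfun.scaleR_left bl_outer_apply)
  have cont: "continuous_on U f" "continuous_on U f'"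
    using f(1,2) has_derivative_continuous by (blast intro: continuous_at_imp_continuous_on)+
  have b'c: "continuous_on UNIV b'" using b(2) DERIV_isCont by (blast intro: continuous_at_imp_continuous_on)
  have o: "continuous_on U (\<lambda>x. bl_outer (a x) (b x))" if "continuous_on U a" "continuous_on U b" for a b :: "'a \<Rightarrow> 'a \<Rightarrow>\<^sub>L real"
    unfolding bl_outer_def using that
    by (intro bounded_bilinear.continuous_on[OF bounded_bilinear_blinfun_compose]
        bounded_linear.continuous_on[OF bounded_linear_blinfun_scaleR_left])
  have "continuous_on U E" unfolding E_def using cont f(3)
    by (intro continuous_intros o continuous_on_compose2[OF b'c] continuous_on_compose2[OF b(3)]) auto
  with 1 2 show ?thesis unfolding C2_on_def by blast
qed

lemma C2_on_inner:
  fixes a :: "'a::real_inner"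
  shows "C2_on U (\<lambda>x. (x - a) \<bullet> (x - a))"
proof -
  define D where "D x = 2 *\<^sub>R blinfun_inner_left (x - a)" for x :: 'a
  have "((\<lambda>x. (x - a) \<bullet> (x - a)) has_derivative blinfun_apply (D x)) (at x)" for x
    by (rule has_derivative_eq_rhs[OF has_derivative_inner[OF has_derivative_diff[OF has_derivative_ident has_derivative_const] has_derivative_diff[OF has_derivative_ident has_derivative_const]]])
      (simp add: D_def fun_eq_iff blinfun.scaleR_left inner_commute)
  moreover have bl: "bounded_linear (\<lambda>x :: 'a. 2 *\<^sub>R blinfun_inner_left x)"
    by (intro bounded_linear_compose[OF bounded_linear_scaleR_right bounded_linear_blinfun_inner_left])
  have "(D has_derivative blinfun_apply (Blinfun (\<lambda>x. 2 *\<^sub>R blinfun_inner_left x))) (at x)" for x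
    unfolding D_def bounded_linear_Blinfun_apply[OF bl]
    by (rule has_derivative_eq_rhs[OF bounded_linear.has_derivative[OF bl has_derivative_diff[OF has_derivative_ident has_derivative_const]]]) simp
  ultimately show ?thesis unfolding C2_on_def
    by (intro exI[of _ D] exI[of _ "\<lambda>_. Blinfun (\<lambda>x. 2 *\<^sub>R blinfun_inner_left x)"]) auto
qed

section \<open>Cut-offs, majorants and the extension of test functions\<close>

definition cutoff :: "real \<Rightarrow> real" where "cutoff t = (max 0 t) ^ 3"

lemma C2_on_cutoff:
  assumes "C2_on U f" shows "C2_on U (\<lambda>x. cutoff (f x))"
proof (rule C2_on_compose[OF assms])
  \<comment> \<open>The exponent \<open>Suc (Suc n)\<close> covers both differentiations of the
    cube, with n = 1 and n = 0. The cube is the lowest integer power of the positive part that is of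
    class C2; at 0 the difference quotient is the next lower power.\<close>
  have d: "((\<lambda>t. (max 0 t) ^ Suc (Suc n)) has_real_derivative real (Suc (Suc n)) * (max 0 t) ^ Suc n) (at t)" for n t
  proof -
    consider "t < 0" | "0 < t" | "t = 0" by linarith
    then show ?thesis
    proof cases
      case 1
      have "((\<lambda>t. 0) has_real_derivative 0) (at t)" by simp
      moreover have "\<forall>\<^sub>F s in nhds t. 0 = (max 0 s) ^ Suc (Suc n)"
        using eventually_nhds_in_open[of "{..<0}" t] 1 by (auto elim!: eventually_mono simp: max_def)
      ultimately show ?thesis using 1 DERIV_cong_ev[OF refl, of "\<lambda>_. 0" "\<lambda>s. (max 0 s) ^ Suc (Suc n)" t 0 0] by (simp add: max_def)
    next
      case 2
      have "((\<lambda>t. t ^ Suc (Suc n)) has_real_derivative real (Suc (Suc n)) * t ^ Suc n) (at t)"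
        using DERIV_pow[of "Suc (Suc n)" t] by simp
      moreover have "\<forall>\<^sub>F s in nhds t. s ^ Suc (Suc n) = (max 0 s) ^ Suc (Suc n)"
        using eventually_nhds_in_open[of "{0<..}" t] 2 by (auto elim!: eventually_mono simp: max_def)
      ultimately show ?thesis
        using 2 DERIV_cong_ev[OF refl, of "\<lambda>s. s ^ Suc (Suc n)" "\<lambda>s. (max 0 s) ^ Suc (Suc n)" t _ "real (Suc (Suc n)) * t ^ Suc n"]
        by (simp add: max_def)
    next
      case 3
      have "((\<lambda>h. ((max 0 (0 + h)) ^ Suc (Suc n) - (max 0 0) ^ Suc (Suc n)) / h) \<longlongrightarrow> 0) (at (0::real))"
      proof (rule Lim_transform_eventually)
        have "((\<lambda>h. (max 0 h) ^ Suc n) \<longlongrightarrow> (max 0 0) ^ Suc n) (at (0::real))" by (intro tendsto_intros)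
        then show "((\<lambda>h. (max 0 h) ^ Suc n) \<longlongrightarrow> 0) (at (0::real))" by simp
        show "\<forall>\<^sub>F h in at 0. (max 0 h) ^ Suc n = ((max 0 (0 + h)) ^ Suc (Suc n) - (max 0 0) ^ Suc (Suc n)) / (h::real)"
          by (auto simp: eventually_at max_def intro!: exI[of _ 1])
      qed
      then show ?thesis using 3 by (simp add: DERIV_def)
    qed
  qed
  show "(cutoff has_real_derivative 3 * (max 0 t) ^ 2) (at t)" for t
    using d[of 1 t] by (simp add: cutoff_def[abs_def] numeral_3_eq_3 numeral_2_eq_2)
  show "((\<lambda>t. 3 * (max 0 t) ^ 2) has_real_derivative 3 * (2 * max 0 t)) (at t)" for t :: real
    using DERIV_cmult[OF d[of 0 t], of 3] by (simp add: numeral_2_eq_2)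
  show "continuous_on UNIV (\<lambda>t::real. 3 * (2 * max 0 t))" by (intro continuous_intros)
qed

lemma C2_on_minus: "C2_on U f \<Longrightarrow> C2_on U (\<lambda>x. - f x)"
  using C2_on_mult[OF C2_on_const[of U "-1"]] by simp

lemma cutoff_nonneg: "0 \<le> cutoff t"
  by (simp add: cutoff_def)

lemma cutoff_eq_0_iff: "cutoff t = 0 \<longleftrightarrow> t \<le> 0"
  by (simp add: cutoff_def max_def)

lemma cutoff_le_1: "t \<le> 1 \<Longrightarrow> cutoff t \<le> 1"
  by (simp add: cutoff_def power_le_one)

text \<open>Finitely many half-radius balls cover \<open>D\<close>, and the sum of their bumps is at
  least 1 there. A lower bound is what a majorant asks for, so the sum is not normalized.\<close>

lemma compact_bump:
  fixes D :: "'a::euclidean_space set"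
  assumes D: "compact D" and W: "open W" "D \<subseteq> W"
  shows "\<exists>\<beta>. C2_on UNIV \<beta> \<and> (\<forall>x. 0 \<le> \<beta> x) \<and> (\<forall>x\<in>D. 1 \<le> \<beta> x) \<and> (\<forall>x. x \<notin> W \<longrightarrow> \<beta> x = 0)"
proof -
  have "\<forall>a\<in>D. \<exists>r>0. ball a r \<subseteq> W" using W open_contains_ball by blast
  then obtain r where r: "\<And>a. a \<in> D \<Longrightarrow> 0 < r a \<and> ball a (r a) \<subseteq> W" by metis
  \<comment> \<open>On the ball of half the radius the argument of \<open>cutoff\<close> is at least
    1/2, whose cube is 1/8; the factor 8 lifts the value to 1.\<close>
  define f where "f a x = 8 * cutoff (1 - (x - a) \<bullet> (x - a) / (r a)\<^sup>2)" for a x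
  have fC2: "C2_on UNIV (f a)" for a
  proof -
    have "C2_on UNIV (\<lambda>x. 1 + (- 1 / (r a)\<^sup>2) * ((x - a) \<bullet> (x - a)))"
      by (intro C2_on_add C2_on_mult C2_on_const C2_on_inner)
    then have "C2_on UNIV (\<lambda>x. 8 * cutoff (1 + (- 1 / (r a)\<^sup>2) * ((x - a) \<bullet> (x - a))))"
      by (intro C2_on_mult C2_on_const C2_on_cutoff)
    then show ?thesis by (simp add: f_def[abs_def])
  qed
  have f0: "0 \<le> f a x" for a x by (simp add: f_def cutoff_nonneg)
  have fz: "f a x = 0" if "a \<in> D" "x \<notin> W" for a x
  proof -
    have "r a \<le> norm (x - a)" using r[OF that(1)] that(2) by (force simp: dist_norm norm_minus_commute)
    then have "(r a)\<^sup>2 \<le> (x - a) \<bullet> (x - a)" using r[OF that(1)] by (simp add: power2_norm_eq_inner[symmetric] power_mono)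
    then show ?thesis using r[OF that(1)] by (simp add: f_def cutoff_eq_0_iff)
  qed
  have f1: "1 \<le> f a x" if "a \<in> D" "x \<in> ball a (r a / 2)" for a x
  proof -
    have "norm (x - a) \<le> r a / 2" using that(2) by (simp add: dist_norm norm_minus_commute)
    then have "(norm (x - a))\<^sup>2 \<le> (r a / 2)\<^sup>2" by (intro power_mono) auto
    then have "(x - a) \<bullet> (x - a) / (r a)\<^sup>2 \<le> 1 / 4"
      using r[OF that(1)] by (simp add: power2_norm_eq_inner[symmetric] power_divide field_simps)
    then have "1 / 2 \<le> max 0 (1 - (x - a) \<bullet> (x - a) / (r a)\<^sup>2)" by (intro max.coboundedI2) linarith
    then have "(1/2) ^ 3 \<le> (max 0 (1 - (x - a) \<bullet> (x - a) / (r a)\<^sup>2)) ^ 3" by (rule power_mono) simp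
    then show ?thesis by (simp add: f_def cutoff_def power_divide)
  qed
  have "D \<subseteq> (\<Union>a\<in>D. ball a (r a / 2))" using r by force
  then obtain A where A: "A \<subseteq> D" "finite A" "D \<subseteq> (\<Union>a\<in>A. ball a (r a / 2))"
    using compactE_image[OF D, of D "\<lambda>a. ball a (r a / 2)"] by (metis open_ball)
  show ?thesis
  proof (intro exI[of _ "\<lambda>x. \<Sum>a\<in>A. f a x"] conjI allI ballI impI)
    show "C2_on UNIV (\<lambda>x. \<Sum>a\<in>A. f a x)" by (intro C2_on_sum A fC2)
    show "0 \<le> (\<Sum>a\<in>A. f a x)" for x by (intro sum_nonneg f0)
    show "(\<Sum>a\<in>A. f a x) = 0" if "x \<notin> W" for x using fz[OF _ that] A(1) by (intro sum.neutral) auto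
    fix x assume "x \<in> D"
    then obtain a where "a \<in> A" "x \<in> ball a (r a / 2)" using A(3) by blast
    then have "1 \<le> f a x" using A(1) by (intro f1) auto
    also have "\<dots> \<le> (\<Sum>a\<in>A. f a x)" using \<open>a \<in> A\<close> A(2) f0 by (intro member_le_sum) auto
    finally show "1 \<le> (\<Sum>a\<in>A. f a x)" .
  qed
qed

text \<open>Compact shells \<open>D n\<close> from an exhaustion carry bumps scaled by a bound of
  \<open>h\<close> on the shell. The bump of index n vanishes on the earlier set \<open>E n\<close>,
  so near every point the series is a finite sum of functions of class C2.\<close>

lemma C2_majorant:
  fixes \<Omega> :: "'a::euclidean_space set" and h :: "'a \<Rightarrow> real"
  assumes \<Omega>: "open \<Omega>" and h: "continuous_on \<Omega> h"
  shows "\<exists>g. C2_on \<Omega> g \<and> (\<forall>x\<in>\<Omega>. h x \<le> g x)"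
proof -
  obtain C :: "nat \<Rightarrow> 'a set" where C: "\<And>n. compact (C n)" "\<And>n. C n \<subseteq> \<Omega>" "\<And>n. C n \<subseteq> interior (C (Suc n))" "\<Union>(range C) = \<Omega>"
    using open_Union_compact_subsets[OF \<Omega>] by metis
  \<comment> \<open>Two empty sets are put in front of the exhaustion, so that the first index N
    with x in \<open>E N\<close> is at least 2 and x lies in the shell
    \<open>D (N - 2)\<close>.\<close>
  define E where "E n = (if n < 2 then {} else C (n - 2))" for n
  have E: "compact (E n)" "E n \<subseteq> \<Omega>" "E n \<subseteq> interior (E (Suc n))" for n
    using C(1,2) C(3)[of "n - 2"] by (auto simp: E_def Suc_diff_le[symmetric] not_less)
  have Emono: "E m \<subseteq> E n" if "m \<le> n" for m n
  proof (rule lift_Suc_mono_le[OF _ that])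
    show "E n \<subseteq> E (Suc n)" for n using E(3)[of n] interior_subset[of "E (Suc n)"] by (rule subset_trans)
  qed
  define D where "D n = E (Suc (Suc n)) - interior (E (Suc n))" for n
  have D: "compact (D n)" "D n \<subseteq> - E n" for n
    unfolding D_def using E(1)[of "Suc (Suc n)"] E(3)[of n] by (auto intro: compact_diff)
  have "\<exists>\<beta>. C2_on UNIV \<beta> \<and> (\<forall>x. 0 \<le> \<beta> x) \<and> (\<forall>x\<in>D n. 1 \<le> \<beta> x) \<and> (\<forall>x. x \<notin> - E n \<longrightarrow> \<beta> x = 0)" for n
    using E(1) by (intro compact_bump D) (auto intro: compact_imp_closed)
  then obtain \<beta> where \<beta>: "\<And>n. C2_on UNIV (\<beta> n)" "\<And>n x. 0 \<le> \<beta> n x" "\<And>n x. x \<in> D n \<Longrightarrow> 1 \<le> \<beta> n x" "\<And>n x. x \<in> E n \<Longrightarrow> \<beta> n x = (0::real)"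
    by (metis ComplD)
  have "\<exists>M. \<forall>x\<in>D n. \<bar>h x\<bar> \<le> M" for n
  proof -
    have "D n \<subseteq> \<Omega>" using E(2) by (auto simp: D_def)
    then have "compact (h ` D n)" using D(1) h by (intro compact_continuous_image) (auto intro: continuous_on_subset)
    then show ?thesis using compact_imp_bounded by (force simp: bounded_iff)
  qed
  then obtain M where M: "\<And>n x. x \<in> D n \<Longrightarrow> \<bar>h x\<bar> \<le> M n" by metis
  define g where "g x = (\<Sum>n. \<bar>M n\<bar> * \<beta> n x)" for x
  \<comment> \<open>For x in \<open>E N\<close> the terms from index N on vanish, since
    \<open>E N\<close> is contained in each later \<open>E n\<close>.\<close>
  have fin: "g x = (\<Sum>n<N. \<bar>M n\<bar> * \<beta> n x)" if "x \<in> E N" for x N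
    unfolding g_def using Emono that \<beta>(4) by (intro suminf_finite) (auto simp: not_less, blast)
  have ex: "\<exists>N. x \<in> E N" if "x \<in> \<Omega>" for x
  proof -
    have "x \<in> \<Union>(range C)" using C(4) that by simp
    then obtain n where "x \<in> C n" by auto
    then have "x \<in> E (Suc (Suc n))" by (simp add: E_def)
    then show ?thesis by blast
  qed
  have "C2_on \<Omega> g"
  proof (rule C2_on_local[OF \<Omega>])
    fix x assume "x \<in> \<Omega>"
    then obtain N where "x \<in> E N" using ex by blast
    then have x: "x \<in> interior (E (Suc N))" using E(3) by blast
    have "C2_on (interior (E (Suc N))) (\<lambda>x. \<Sum>n<Suc N. \<bar>M n\<bar> * \<beta> n x)"
      by (intro C2_on_sum C2_on_mult C2_on_const C2_on_subset[OF \<beta>(1)]) auto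
    then have "C2_on (interior (E (Suc N))) g"
      by (rule C2_on_cong[OF open_interior]) (rule fin, use interior_subset in blast)
    then show "\<exists>V. open V \<and> x \<in> V \<and> C2_on V g" using x by blast
  qed
  moreover have "h x \<le> g x" if "x \<in> \<Omega>" for x
  proof -
    define N where "N = (LEAST N. x \<in> E N)"
    have N: "x \<in> E N" using ex[OF that] unfolding N_def by (auto intro: LeastI)
    have N2: "2 \<le> N" using N by (auto simp: E_def not_less split: if_splits)
    then obtain m where m: "N = Suc (Suc m)" by (metis add_2_eq_Suc le_Suc_ex)
    have "x \<notin> E (Suc m)" unfolding N_def[symmetric] using not_less_Least[of "Suc m" "\<lambda>N. x \<in> E N"] m N_def by simp
    then have xD: "x \<in> D m" using N m interior_subset by (auto simp: D_def)
    have "h x \<le> \<bar>M m\<bar> * 1" using M[OF xD] by simp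
    also have "\<dots> \<le> \<bar>M m\<bar> * \<beta> m x" by (intro mult_left_mono \<beta>(3) xD) simp
    also have "\<dots> \<le> (\<Sum>n<N. \<bar>M n\<bar> * \<beta> n x)"
      using m \<beta>(2) by (intro member_le_sum) auto
    also have "\<dots> = g x" using fin[OF N] by simp
    finally show ?thesis .
  qed
  ultimately show ?thesis by blast
qed

text \<open>On \<open>N\<close>, \<open>u y - \<psi> y\<close> is the convex combination with weight
  \<open>\<theta> y\<close> of \<open>u y - \<phi> y\<close> and \<open>u y + g y\<close>. The first
  exceeds \<open>c\<close> away from \<open>x\<close>, the second exceeds \<open>c\<close> on all of
  \<Omega> by the choice of \<open>g\<close>, so the minimum stays strict.\<close>

lemma strict_min_extension:
  fixes u :: "'a::euclidean_space \<Rightarrow> real"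
  assumes \<Omega>: "open \<Omega>" "continuous_on \<Omega> u" and N: "open N" "x \<in> N" "N \<subseteq> \<Omega>" "C2_on N \<phi>"
    and m: "strict_min_at N (\<lambda>y. u y - \<phi> y) x"
  shows "\<exists>\<psi> V. C2_on \<Omega> \<psi> \<and> strict_min_at \<Omega> (\<lambda>y. u y - \<psi> y) x \<and> open V \<and> x \<in> V \<and> V \<subseteq> N \<and> (\<forall>y\<in>V. \<psi> y = \<phi> y)"
proof -
  define c where "c = u x - \<phi> x"
  have "continuous_on \<Omega> (\<lambda>y. c + 1 - u y)" using \<Omega>(2) by (intro continuous_intros)
  from C2_majorant[OF \<Omega>(1) this] obtain g where g: "C2_on \<Omega> g" "\<And>y. y \<in> \<Omega> \<Longrightarrow> c + 1 - u y \<le> g y" by blast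
  obtain \<rho> where \<rho>: "0 < \<rho>" "ball x \<rho> \<subseteq> N" using N(1,2) open_contains_ball by blast
  define d where "d y = (y - x) \<bullet> (y - x) / \<rho>\<^sup>2" for y
  \<comment> \<open>The nested cut-off equals 1 where \<open>4 * d y \<le> 1\<close>, that is on the
    half-radius ball, and 0 where \<open>4 * d y \<ge> 2\<close>, a region that begins inside the
    ball of radius \<rho>.\<close>
  define \<theta> where "\<theta> y = cutoff (1 - cutoff (4 * d y - 1))" for y
  have \<theta>C2: "C2_on U \<theta>" for U
  proof -
    have "C2_on U (\<lambda>y. cutoff (1 + (-1) * cutoff ((4 / \<rho>\<^sup>2) * ((y - x) \<bullet> (y - x)) + (-1))))"
      by (intro C2_on_add C2_on_mult C2_on_const C2_on_inner C2_on_cutoff)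
    then show ?thesis by (simp add: \<theta>_def[abs_def] d_def)
  qed
  have \<theta>01: "0 \<le> \<theta> y" "\<theta> y \<le> 1" for y
    using cutoff_nonneg[of "4 * d y - 1"] by (auto simp: \<theta>_def cutoff_nonneg intro!: cutoff_le_1)
  have \<theta>1: "\<theta> y = 1" if "y \<in> ball x (\<rho> / 2)" for y
  proof -
    have "norm (y - x) \<le> \<rho> / 2" using that by (simp add: dist_norm norm_minus_commute)
    then have "(norm (y - x))\<^sup>2 \<le> (\<rho> / 2)\<^sup>2" by (intro power_mono) auto
    then have "4 * d y - 1 \<le> 0"
      using \<rho>(1) by (simp add: d_def power2_norm_eq_inner[symmetric] power_divide field_simps)
    then have "cutoff (4 * d y - 1) = 0" by (simp add: cutoff_eq_0_iff)
    then show ?thesis by (simp add: \<theta>_def cutoff_def)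
  qed
  have \<theta>0: "\<theta> y = 0" if "2 * \<rho>\<^sup>2 \<le> 4 * ((y - x) \<bullet> (y - x))" for y
  proof -
    have "2 \<le> 4 * d y" using that \<rho>(1) by (simp add: d_def field_simps)
    then have "1 ^ 3 \<le> (max 0 (4 * d y - 1)) ^ 3" by (intro power_mono) auto
    then show ?thesis by (simp add: \<theta>_def cutoff_eq_0_iff cutoff_def)
  qed
  \<comment> \<open>On this open set \<theta> vanishes. Together with \<open>N\<close> it covers the
    whole space, so each point of \<Omega> has an open neighbourhood on which one of two formulas
    shows \<psi> to be of class C2.\<close>
  define F where "F = {y. 2 * \<rho>\<^sup>2 < 4 * ((y - x) \<bullet> (y - x))}"
  define \<psi> where "\<psi> y = (if y \<in> N then \<theta> y * \<phi> y else 0) - (1 - \<theta> y) * g y" for y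
  have N\<psi>: "C2_on N \<psi>"
  proof (rule C2_on_cong[OF N(1)])
    show "C2_on N (\<lambda>y. \<theta> y * \<phi> y + - ((1 + - \<theta> y) * g y))"
      by (intro C2_on_add C2_on_minus C2_on_mult C2_on_const \<theta>C2 N(4) C2_on_subset[OF g(1) N(3)])
  qed (simp add: \<psi>_def)
  have cl: "y \<in> N \<or> y \<in> F" for y
  proof (cases "y \<in> F")
    case False
    then have "4 * ((y - x) \<bullet> (y - x)) \<le> 2 * \<rho>\<^sup>2" by (simp add: F_def)
    then have "(norm (y - x))\<^sup>2 < \<rho>\<^sup>2"
      using zero_less_power[OF \<rho>(1), of 2] unfolding power2_norm_eq_inner by linarith
    then have "norm (y - x) < \<rho>" using \<rho>(1) by (simp add: power_less_imp_less_base)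
    then show ?thesis using \<rho>(2) by (auto simp: dist_norm norm_minus_commute)
  qed simp
  have Fo: "open F" unfolding F_def by (intro open_Collect_less continuous_intros)
  have F\<psi>: "C2_on (\<Omega> \<inter> F) \<psi>"
  proof (rule C2_on_cong)
    show "open (\<Omega> \<inter> F)" using \<Omega>(1) Fo by blast
    show "C2_on (\<Omega> \<inter> F) (\<lambda>y. - g y)" by (intro C2_on_minus C2_on_subset[OF g(1)]) auto
    show "\<psi> y = - g y" if "y \<in> \<Omega> \<inter> F" for y
      using that \<theta>0[of y] by (auto simp: \<psi>_def F_def)
  qed
  have C2: "C2_on \<Omega> \<psi>"
  proof (rule C2_on_local[OF \<Omega>(1)])
    fix y assume "y \<in> \<Omega>"
    then show "\<exists>V. open V \<and> y \<in> V \<and> C2_on V \<psi>"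
      using cl[of y] N(1) N\<psi> F\<psi> Fo \<Omega>(1) by (metis IntI open_Int)
  qed
  have near: "\<psi> y = \<phi> y" if "y \<in> ball x (\<rho> / 2)" for y
  proof -
    have "y \<in> N" using that \<rho> by (auto simp: subset_iff)
    then show ?thesis using \<theta>1[OF that] by (simp add: \<psi>_def)
  qed
  have "strict_min_at \<Omega> (\<lambda>y. u y - \<psi> y) x"
    unfolding strict_min_at_def
  proof (intro conjI ballI)
    show "x \<in> \<Omega>" using N by blast
    have \<psi>x: "u x - \<psi> x = c" using near[of x] \<rho>(1) by (simp add: c_def)
    fix y assume y: "y \<in> \<Omega> - {x}"
    have ug: "c < u y + g y" using g(2)[of y] y by auto
    have "c < u y - \<psi> y"
    proof (cases "y \<in> N")
      case True
      have u\<phi>: "c < u y - \<phi> y" using m True y by (auto simp: strict_min_at_def c_def)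
      have "u y - \<psi> y - c = \<theta> y * (u y - \<phi> y - c) + (1 - \<theta> y) * (u y + g y - c)"
        using True by (simp add: \<psi>_def algebra_simps)
      also have "\<dots> > 0"
      proof (cases "\<theta> y = 0")
        case False
        then have "0 < \<theta> y * (u y - \<phi> y - c)" using \<theta>01[of y] u\<phi> by (intro mult_pos_pos) auto
        moreover have "0 \<le> (1 - \<theta> y) * (u y + g y - c)" using \<theta>01[of y] ug by (intro mult_nonneg_nonneg) auto
        ultimately show ?thesis by linarith
      qed (use ug in simp)
      finally show ?thesis by simp
    next
      case False
      then have "\<theta> y = 0" using cl[of y] \<theta>0[of y] unfolding F_def by auto
      then show ?thesis using False ug by (simp add: \<psi>_def)
    qed
    then show "u x - \<psi> x < u y - \<psi> y" using \<psi>x by simp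
  qed
  moreover have "ball x (\<rho> / 2) \<subseteq> N" using \<rho> by (auto simp: subset_iff)
  ultimately show ?thesis using C2 near \<rho>(1)
    by (intro exI[of _ \<psi>] exI[of _ "ball x (\<rho> / 2)"]) auto
qed

section \<open>Viscosity solutions and the mean\<close>

lemma strict_max_at_iff_min: "strict_max_at U (\<lambda>y. u y - \<phi> y) x \<longleftrightarrow> strict_min_at U (\<lambda>y. - u y - - \<phi> y) x"
proof -
  have "u y - \<phi> y < u x - \<phi> x \<longleftrightarrow> - u x - - \<phi> x < - u y - - \<phi> y" for y by linarith
  then show ?thesis by (simp only: strict_max_at_def strict_min_at_def)
qed

lemma strict_min_at_shift: "strict_min_at U (\<lambda>y. u y - (\<phi> y + c)) x \<longleftrightarrow> strict_min_at U (\<lambda>y. u y - \<phi> y) x"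
  and strict_max_at_shift: "strict_max_at U (\<lambda>y. u y - (\<phi> y + c)) x \<longleftrightarrow> strict_max_at U (\<lambda>y. u y - \<phi> y) x"
proof -
  have "u a - (\<phi> a + c) < u b - (\<phi> b + c) \<longleftrightarrow> u a - \<phi> a < u b - \<phi> b" for a b by linarith
  then show "strict_min_at U (\<lambda>y. u y - (\<phi> y + c)) x \<longleftrightarrow> strict_min_at U (\<lambda>y. u y - \<phi> y) x"
    "strict_max_at U (\<lambda>y. u y - (\<phi> y + c)) x \<longleftrightarrow> strict_max_at U (\<lambda>y. u y - \<phi> y) x"
    by (simp_all only: strict_min_at_def strict_max_at_def)
qed

lemma strict_max_extension:
  fixes u :: "'a::euclidean_space \<Rightarrow> real"
  assumes \<Omega>: "open \<Omega>" "continuous_on \<Omega> u" and N: "open N" "x \<in> N" "N \<subseteq> \<Omega>" "C2_on N \<phi>"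
    and m: "strict_max_at N (\<lambda>y. u y - \<phi> y) x"
  shows "\<exists>\<psi> V. C2_on \<Omega> \<psi> \<and> strict_max_at \<Omega> (\<lambda>y. u y - \<psi> y) x \<and> open V \<and> x \<in> V \<and> V \<subseteq> N \<and> (\<forall>y\<in>V. \<psi> y = \<phi> y)"
proof -
  obtain \<psi> V where \<psi>: "C2_on \<Omega> \<psi>" "strict_min_at \<Omega> (\<lambda>y. - u y - \<psi> y) x" "open V" "x \<in> V" "V \<subseteq> N" "\<forall>y\<in>V. \<psi> y = - \<phi> y"
    using strict_min_extension[OF \<Omega>(1) continuous_on_minus[OF \<Omega>(2)] N(1-3) C2_on_minus[OF N(4)]] m
    unfolding strict_max_at_iff_min by blast
  have "strict_max_at \<Omega> (\<lambda>y. u y - - \<psi> y) x"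
    unfolding strict_max_at_iff_min using \<psi>(2) by (simp only: minus_minus)
  then show ?thesis using C2_on_minus[OF \<psi>(1)] \<psi>(3-6)
    by (intro exI[of _ "\<lambda>y. - \<psi> y"] exI[of _ V]) auto
qed

context carnot_group
begin

lemma jac_deriv_cong:
  assumes "open V" "y \<in> V" "\<And>z. z \<in> V \<Longrightarrow> f z = g z"
  shows "jac_deriv mul j f y = jac_deriv mul j g y"
proof -
  have "(f has_derivative L) (at y) \<longleftrightarrow> (g has_derivative L) (at y)" for L
    using has_derivative_transform_within_open[OF _ assms(1,2)] assms(3) by metis
  then have "frechet_derivative f (at y) = frechet_derivative g (at y)"
    unfolding frechet_derivative_def by simp
  then show ?thesis by (simp add: jac_deriv_def)
qed

text \<open>All horizontal operators are local, which transfers conclusions from an extended test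
  function to the original one near \<open>x\<close>.\<close>

lemma horizontal_local_cong:
  assumes V: "open V" "x \<in> V" "\<And>z. z \<in> V \<Longrightarrow> f z = g z"
  shows "hgrad deg mul f x = hgrad deg mul g x" "normalized_plap deg mul p f x = normalized_plap deg mul p g x"
proof -
  have jd: "jac_deriv mul j f y = jac_deriv mul j g y" if "y \<in> V" for j y
    by (rule jac_deriv_cong[OF V(1) that V(3)])
  have hg: "hgrad deg mul f y = hgrad deg mul g y" if "y \<in> V" for y
    by (simp add: hgrad_def jd[OF that] cong: if_cong)
  show "hgrad deg mul f x = hgrad deg mul g x" by (rule hg[OF V(2)])
  have hh: "hhess deg mul f x = hhess deg mul g x"
  proof -
    have "jac_deriv mul i (jac_deriv mul j f) x = jac_deriv mul i (jac_deriv mul j g) x" for i j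
      by (rule jac_deriv_cong[OF V(1,2) jd])
    then show ?thesis by (simp only: hhess_def)
  qed
  have "hdiv deg mul (\<lambda>y. (norm (hgrad deg mul f y) powr c) *\<^sub>R hgrad deg mul f y) x =
      hdiv deg mul (\<lambda>y. (norm (hgrad deg mul g y) powr c) *\<^sub>R hgrad deg mul g y) x" for c
    unfolding hdiv_def by (intro sum.cong refl jac_deriv_cong[OF V(1,2)]) (simp add: hg)
  then show "normalized_plap deg mul p f x = normalized_plap deg mul p g x"
    by (simp add: normalized_plap_def hh hg[OF V(2)])
qed

text \<open>The quotient converges, so \<open>Liminf\<close> and \<open>Limsup\<close> both equal
  its limit, whose sign is opposite to that of the operator because \<kappa> > 0.\<close>

lemma mean_Liminf_Limsup:
  assumes N: "open N" "x \<in> N" "C2_on N \<phi>" and G0: "hgrad deg mul \<phi> x \<noteq> 0" and p: "1 < p" "p \<le> (\<infinity>::ereal)"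
  shows "0 \<le> Liminf (at_right 0) (\<lambda>\<epsilon>. ereal ((\<phi> x - mu_p k deg mul p \<epsilon> \<phi> x) / \<epsilon>\<^sup>2)) \<longleftrightarrow> normalized_plap deg mul p \<phi> x \<le> 0"
    "Limsup (at_right 0) (\<lambda>\<epsilon>. ereal ((\<phi> x - mu_p k deg mul p \<epsilon> \<phi> x) / \<epsilon>\<^sup>2)) \<le> 0 \<longleftrightarrow> 0 \<le> normalized_plap deg mul p \<phi> x"
proof -
  obtain \<kappa> where \<kappa>: "0 < \<kappa>" "((\<lambda>\<epsilon>. (\<phi> x - mu_p k deg mul p \<epsilon> \<phi> x) / \<epsilon>\<^sup>2) \<longlongrightarrow> - (\<kappa> * normalized_plap deg mul p \<phi> x)) (at_right 0)"
    using mu_p_expansion[OF assms] by blast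
  have lim: "((\<lambda>\<epsilon>. ereal ((\<phi> x - mu_p k deg mul p \<epsilon> \<phi> x) / \<epsilon>\<^sup>2)) \<longlongrightarrow> ereal (- (\<kappa> * normalized_plap deg mul p \<phi> x))) (at_right 0)"
    using \<kappa>(2) by (rule tendsto_ereal)
  have nb: "at_right (0::real) \<noteq> bot" by simp
  have "0 \<le> ereal (- (\<kappa> * d)) \<longleftrightarrow> d \<le> 0" "ereal (- (\<kappa> * d)) \<le> 0 \<longleftrightarrow> 0 \<le> d" for d
    using \<kappa>(1) by (auto simp: mult_le_0_iff zero_le_mult_iff)
  then show "0 \<le> Liminf (at_right 0) (\<lambda>\<epsilon>. ereal ((\<phi> x - mu_p k deg mul p \<epsilon> \<phi> x) / \<epsilon>\<^sup>2)) \<longleftrightarrow> normalized_plap deg mul p \<phi> x \<le> 0"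
    "Limsup (at_right 0) (\<lambda>\<epsilon>. ereal ((\<phi> x - mu_p k deg mul p \<epsilon> \<phi> x) / \<epsilon>\<^sup>2)) \<le> 0 \<longleftrightarrow> 0 \<le> normalized_plap deg mul p \<phi> x"
    unfolding lim_imp_Liminf[OF nb lim] lim_imp_Limsup[OF nb lim] by blast+
qed

text \<open>Through \<open>mean_Liminf_Limsup\<close> both conditions become the same sign condition
  at the touching point; what differs is the class of test functions. Local ones are extended to
  \<Omega> in one direction; in the other, \<open>N\<close> is taken to be \<Omega> and a constant
  is added to achieve equality with \<open>u\<close> at \<open>x\<close>.\<close>

lemma viscosity_solution_iff_mean:
  assumes p: "1 < p" "p \<le> (\<infinity>::ereal)" and \<Omega>: "open \<Omega>" and u: "continuous_on \<Omega> u"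
  shows "viscosity_solution deg mul p \<Omega> u \<longleftrightarrow> (\<forall>x\<in>\<Omega>. asymptotic_mean_viscosity k deg mul p \<Omega> u x)"
proof
  assume sol: "viscosity_solution deg mul p \<Omega> u"
  show "\<forall>x\<in>\<Omega>. asymptotic_mean_viscosity k deg mul p \<Omega> u x"
    unfolding asymptotic_mean_viscosity_def
  proof (intro ballI conjI allI impI)
    fix x N \<phi>
    assume "open N \<and> x \<in> N \<and> N \<subseteq> \<Omega> \<and> C2_on N \<phi> \<and> strict_min_at N (\<lambda>y. u y - \<phi> y) x \<and> u x = \<phi> x \<and> hgrad deg mul \<phi> x \<noteq> 0"
    then have N: "open N" "x \<in> N" "N \<subseteq> \<Omega>" "C2_on N \<phi>" "strict_min_at N (\<lambda>y. u y - \<phi> y) x" and G: "hgrad deg mul \<phi> x \<noteq> 0" by auto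
    obtain \<psi> V where \<psi>: "C2_on \<Omega> \<psi>" "strict_min_at \<Omega> (\<lambda>y. u y - \<psi> y) x" and V: "open V" "x \<in> V" "\<And>y. y \<in> V \<Longrightarrow> \<psi> y = \<phi> y"
      using strict_min_extension[OF \<Omega> u N] by blast
    have "normalized_plap deg mul p \<psi> x \<le> 0"
      using sol \<psi> G horizontal_local_cong(1)[OF V] N(2,3) by (auto simp: viscosity_solution_def viscosity_supersolution_def)
    then show "0 \<le> Liminf (at_right 0) (\<lambda>\<epsilon>. ereal ((\<phi> x - mu_p k deg mul p \<epsilon> \<phi> x) / \<epsilon>\<^sup>2))"
      using mean_Liminf_Limsup(1)[OF N(1,2,4) G p] horizontal_local_cong(2)[OF V] by simp
  next
    fix x N \<phi>
    assume "open N \<and> x \<in> N \<and> N \<subseteq> \<Omega> \<and> C2_on N \<phi> \<and> strict_max_at N (\<lambda>y. u y - \<phi> y) x \<and> u x = \<phi> x \<and> hgrad deg mul \<phi> x \<noteq> 0"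
    then have N: "open N" "x \<in> N" "N \<subseteq> \<Omega>" "C2_on N \<phi>" "strict_max_at N (\<lambda>y. u y - \<phi> y) x" and G: "hgrad deg mul \<phi> x \<noteq> 0" by auto
    obtain \<psi> V where \<psi>: "C2_on \<Omega> \<psi>" "strict_max_at \<Omega> (\<lambda>y. u y - \<psi> y) x" and V: "open V" "x \<in> V" "\<And>y. y \<in> V \<Longrightarrow> \<psi> y = \<phi> y"
      using strict_max_extension[OF \<Omega> u N] by blast
    have "0 \<le> normalized_plap deg mul p \<psi> x"
      using sol \<psi> G horizontal_local_cong(1)[OF V] N(2,3) by (auto simp: viscosity_solution_def viscosity_subsolution_def)
    then show "Limsup (at_right 0) (\<lambda>\<epsilon>. ereal ((\<phi> x - mu_p k deg mul p \<epsilon> \<phi> x) / \<epsilon>\<^sup>2)) \<le> 0"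
      using mean_Liminf_Limsup(2)[OF N(1,2,4) G p] horizontal_local_cong(2)[OF V] by simp
  qed
next
  assume mean: "\<forall>x\<in>\<Omega>. asymptotic_mean_viscosity k deg mul p \<Omega> u x"
  have lim: "(u \<longlongrightarrow> u x) (at x within \<Omega>)" if "x \<in> \<Omega>" for x
    using u that by (simp add: continuous_on_def)
  have shift: "C2_on \<Omega> (\<lambda>y. \<phi> y + c) \<and> hgrad deg mul (\<lambda>y. \<phi> y + c) x = hgrad deg mul \<phi> x \<and>
      normalized_plap deg mul p (\<lambda>y. \<phi> y + c) x = normalized_plap deg mul p \<phi> x"
    if "C2_on \<Omega> \<phi>" for \<phi> x c
  proof -
    have d: "((\<lambda>y. \<phi> y + c) has_derivative L) (at y) \<longleftrightarrow> (\<phi> has_derivative L) (at y)" for L y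
    proof
      assume "((\<lambda>y. \<phi> y + c) has_derivative L) (at y)"
      from has_derivative_add[OF this has_derivative_const[of "- c"]] show "(\<phi> has_derivative L) (at y)" by simp
    next
      assume "(\<phi> has_derivative L) (at y)"
      from has_derivative_add[OF this has_derivative_const[of c]] show "((\<lambda>y. \<phi> y + c) has_derivative L) (at y)" by simp
    qed
    have jd: "jac_deriv mul j (\<lambda>y. \<phi> y + c) = jac_deriv mul j \<phi>" for j
      unfolding jac_deriv_def frechet_derivative_def d ..
    have hg: "hgrad deg mul (\<lambda>y. \<phi> y + c) = hgrad deg mul \<phi>"
      unfolding hgrad_def jd ..
    have "hhess deg mul (\<lambda>y. \<phi> y + c) = hhess deg mul \<phi>"
      unfolding hhess_def jd ..
    then show ?thesis using C2_on_add[OF that C2_on_const] by (simp add: normalized_plap_def hg)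
  qed
  have "lsc_on \<Omega> u" unfolding lsc_on_def using lim order_tendstoD(1) by blast
  moreover have "usc_on \<Omega> u" unfolding usc_on_def using lim order_tendstoD(2) by blast
  moreover have "normalized_plap deg mul p \<phi> x \<le> 0"
    if x: "x \<in> \<Omega>" and \<phi>: "C2_on \<Omega> \<phi>" "hgrad deg mul \<phi> x \<noteq> 0" "strict_min_at \<Omega> (\<lambda>y. u y - \<phi> y) x" for x \<phi>
  proof -
    define \<psi> where "\<psi> y = \<phi> y + (u x - \<phi> x)" for y
    have \<psi>: "C2_on \<Omega> \<psi>" "hgrad deg mul \<psi> x \<noteq> 0" "normalized_plap deg mul p \<psi> x = normalized_plap deg mul p \<phi> x"
      using shift[OF \<phi>(1), of "u x - \<phi> x" x] \<phi>(2) unfolding \<psi>_def by auto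
    have "strict_min_at \<Omega> (\<lambda>y. u y - \<psi> y) x" using \<phi>(3) unfolding \<psi>_def strict_min_at_shift .
    moreover have "u x = \<psi> x" by (simp add: \<psi>_def)
    ultimately have "0 \<le> Liminf (at_right 0) (\<lambda>\<epsilon>. ereal ((\<psi> x - mu_p k deg mul p \<epsilon> \<psi> x) / \<epsilon>\<^sup>2))"
      using mean[rule_format, OF x] \<Omega> x \<psi>(1,2) unfolding asymptotic_mean_viscosity_def by blast
    then show ?thesis using mean_Liminf_Limsup(1)[OF \<Omega> x \<psi>(1,2) p] \<psi>(3) by simp
  qed
  moreover have "0 \<le> normalized_plap deg mul p \<phi> x"
    if x: "x \<in> \<Omega>" and \<phi>: "C2_on \<Omega> \<phi>" "hgrad deg mul \<phi> x \<noteq> 0" "strict_max_at \<Omega> (\<lambda>y. u y - \<phi> y) x" for x \<phi>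
  proof -
    define \<psi> where "\<psi> y = \<phi> y + (u x - \<phi> x)" for y
    have \<psi>: "C2_on \<Omega> \<psi>" "hgrad deg mul \<psi> x \<noteq> 0" "normalized_plap deg mul p \<psi> x = normalized_plap deg mul p \<phi> x"
      using shift[OF \<phi>(1), of "u x - \<phi> x" x] \<phi>(2) unfolding \<psi>_def by auto
    have "strict_max_at \<Omega> (\<lambda>y. u y - \<psi> y) x" using \<phi>(3) unfolding \<psi>_def strict_max_at_shift .
    moreover have "u x = \<psi> x" by (simp add: \<psi>_def)
    ultimately have "Limsup (at_right 0) (\<lambda>\<epsilon>. ereal ((\<psi> x - mu_p k deg mul p \<epsilon> \<psi> x) / \<epsilon>\<^sup>2)) \<le> 0"
      using mean[rule_format, OF x] \<Omega> x \<psi>(1,2) unfolding asymptotic_mean_viscosity_def by blast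
    then show ?thesis using mean_Liminf_Limsup(2)[OF \<Omega> x \<psi>(1,2) p] \<psi>(3) by simp
  qed
  ultimately show "viscosity_solution deg mul p \<Omega> u"
    unfolding viscosity_solution_def viscosity_supersolution_def viscosity_subsolution_def using u by blast
qed

end

theorem theorem1p1:
  fixes k :: nat
    and deg :: "'n::finite \<Rightarrow> nat"
    and br mul :: "real ^ 'n \<Rightarrow> real ^ 'n \<Rightarrow> real ^ 'n"
    and p :: ereal
    and \<Omega> :: "(real ^ 'n) set"
    and u :: "real ^ 'n \<Rightarrow> real"
  assumes "carnot_group k deg br mul"
    and "1 < p" and "p \<le> \<infinity>"
    and "open \<Omega>"
    and "continuous_on \<Omega> u"
  shows "viscosity_solution deg mul p \<Omega> u \<longleftrightarrow>
    (\<forall>x\<in>\<Omega>. asymptotic_mean_viscosity k deg mul p \<Omega> u x)"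
  using carnot_group.viscosity_solution_iff_mean[OF assms] .

end
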